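(* Let $s\in C^2(\mathbb{R}^{B},\mathbb{R})$ satisfy (S1)-(S3), let $k\ge1$, assume that $( *_0)$ and $( *_1)$ hold, and let $\rho_1,\dots,\rho_4\in(0,\bar\rho)$ be chosen as in the context. If $l\in\mathbb{N}$ is sufficiently large, then for each $\mathbf{m}=(\mathbf{m}_1,\dots,\mathbf{m}_{4k+2})\in\mathbb{Z}^{4k+2}$ with $\mathbf{m}_i<\mathbf{m}_{i+1}$ for $1\le i<4k+2$ and $\mathbf{m}_j+2l<\mathbf{m}_{j+1}$ for even $j<4k+2$, there is a $U\in Y_{\mathbf{m},l}$ such that $J_1(U)=b_{\mathbf{m},l}=\inf_{Y_{\mathbf{m},l}}J_1$. Moreover, $U$ is a solution of (EL) provided that $\mathbf{m}_2-\mathbf{m}_1,\ \mathbf{m}_4-\mathbf{m}_3,\dots,\mathbf{m}_{4k+2}-\mathbf{m}_{4k+1}$ are large enough.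
   Context: Model. Fix integers $n\ge 2$, $r\ge 1$. For $\mathbf{i}=(\mathbf{i}_1,\dots,\mathbf{i}_n)\in\mathbb{Z}^n$ let $\|\mathbf{i}\|=\sum_k|\mathbf{i}_k|$, and let $B=\{\mathbf{k}\in\mathbb{Z}^n:\|\mathbf{k}\|\le r\}$. A configuration is a function $u:\mathbb{Z}^n\to\mathbb{R}$; inequalities between configurations are pointwise ($u<v$ means $u(\mathbf{j})<v(\mathbf{j})$ for all $\mathbf{j}$). A function $s\in C^2(\mathbb{R}^{B},\mathbb{R})$ satisfies: (S1) $s(u+1_B)=s(u)$ for all $u\in\mathbb{R}^B$, where $1_B$ is the constant function $1$; (S2) $s$ is bounded from below, and $s(u)\to\infty$ as $|u(\mathbf{k})-u(\mathbf{j})|\to\infty$ for $\mathbf{k},\mathbf{j}\in B$ with $\|\mathbf{k}-\mathbf{j}\|=1$; (S3) the second partial derivatives satisfy $\partial_{\mathbf{k},\mathbf{j}}s\le 0$ for all $\mathbf{k}\ne\mathbf{j}$ in $B$, and $\partial_{\mathbf{0},\mathbf{j}}s<0$ whenever $\|\mathbf{j}\|=1$. For a configuration $u$ and $\mathbf{j}\in\mathbb{Z}^n$ put $S_{\mathbf{j}}(u)=s\big((u(\mathbf{j}+\mathbf{k}))_{\mathbf{k}\in B}\big)$. The Euler-Lagrange equation is (EL): $\sum_{\mathbf{j}:\|\mathbf{j}-\mathbf{i}\|\le r}\partial_{\mathbf{i}}S_{\mathbf{j}}(u)=0$ for all $\mathbf{i}\in\mathbb{Z}^n$, where $\partial_{\mathbf{i}}$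 is the derivative with respect to $u(\mathbf{i})$. A solution is a configuration satisfying (EL). Periodic minimizers. A configuration is $1$-periodic in $\mathbf{i}_j$ if $u(\mathbf{i}+\mathbf{e}_j)=u(\mathbf{i})$ for all $\mathbf{i}$, $\mathbf{e}_j$ being the $j$th unit vector. Let $c_0=\inf S_{\mathbf{0}}(u)$ over configurations $u$ that are $1$-periodic in all directions, and let $\mathcal{M}_0$ be the set of such $u$ with $S_{\mathbf{0}}(u)=c_0$. In an ordered set $A$ of configurations, $v<w$ in $A$ are adjacent if no $u\in A$ satisfies $v<u<w$. Gap condition $( *_0)$: there are adjacent $v_0,w_0\in\mathcal{M}_0$ with $v_0<w_0$. Basic heteroclinics. For $v<w$ in $\mathcal{M}_0$ let $\hat\Gamma_1(v,w)$ be the set of configurations $u$ that are $1$-periodic in $\mathbf{i}_2,\dots,\mathbf{i}_n$ with $v\le u\le w$. With $\mathbf{T}_i=i\mathbf{e}_1$ and $\|u\|_{\mathbf{T}_i}=|u(\mathbf{T}_i)|$, let $\Gamma_1(v_0,w_0)$ (resp. $\Gamma_1(w_0,v_0)$) be the set of $u\in\hat\Gamma_1(v_0,w_0)$ with $\|u-v_0\|_{\mathbf{T}_i}\to0$ as $i\to-\infty$ and $\|u-w_0\|_{\mathbf{T}_i}\to0$ as $i\to\infty$ (resp. with $v_0$ and $w_0$ interchanged in these limits). Put $J_{1,p}(u)=S_{\mathbf{T}_p}(u)-c_0$, $J_{1;p,q}(u)=\sum_{j=p}^qJ_{1,j}(u)$, $J_1(u)=\liminf_{p\to-\infty,\,q\to\infty}J_{1;p,q}(u)$.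 Let $c_1(v_0,w_0)=\inf_{\Gamma_1(v_0,w_0)}J_1$ and $\mathcal{M}_1(v_0,w_0)=\{u\in\Gamma_1(v_0,w_0):J_1(u)=c_1(v_0,w_0)\}$; $c_1(w_0,v_0)$ and $\mathcal{M}_1(w_0,v_0)$ are defined in the same way from $\Gamma_1(w_0,v_0)$. Gap condition $( *_1)$: there are adjacent $v_1<w_1$ in $\mathcal{M}_1(v_0,w_0)$ and adjacent $\tilde v_1<\tilde w_1$ in $\mathcal{M}_1(w_0,v_0)$. Constrained problem. Let $\rho_-(u)=\|u-v_0\|_{\mathbf{T}_0}$, $\rho_+(u)=\|u-w_0\|_{\mathbf{T}_0}$, $\bar\rho=\|w_0-v_0\|_{\mathbf{T}_0}$, and $(\tau^1_{-i}u)(\mathbf{j})=u(\mathbf{j}+i\mathbf{e}_1)$. Under $( *_1)$ one can and does fix $\rho_1,\dots,\rho_4\in(0,\bar\rho)$ with $\rho_1\notin\rho_-(\mathcal{M}_1(v_0,w_0))$, $\rho_2\notin\rho_+(\mathcal{M}_1(v_0,w_0))$, $\rho_3\notin\rho_+(\mathcal{M}_1(w_0,v_0))$, $\rho_4\notin\rho_-(\mathcal{M}_1(w_0,v_0))$. For $l\in\mathbb{N}$ and $\mathbf{m}\in\mathbb{Z}^{4k+2}$ as in the claim, $Y_{\mathbf{m},l}$ is the set of $u\in\hat\Gamma_1(v_0,w_0)$ with $\|u-v_0\|_{\mathbf{T}_i}\to0$ as $i\to-\infty$, $\|u-w_0\|_{\mathbf{T}_i}\to0$ as $i\to\infty$,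 and (a) $\rho_-(\tau^1_{-i}u)\le\rho_1$ for $\mathbf{m}_{1+4j}-l\le i\le\mathbf{m}_{1+4j}-1$, $j=0,1,\dots,k$; (b) $\rho_+(\tau^1_{-i}u)\le\rho_2$ for $\mathbf{m}_{2+4j}\le i\le\mathbf{m}_{2+4j}+l-1$, $j=0,1,\dots,k$; (c) $\rho_+(\tau^1_{-i}u)\le\rho_3$ for $\mathbf{m}_{3+4j}-l\le i\le\mathbf{m}_{3+4j}-1$, $j=0,1,\dots,k-1$; (d) $\rho_-(\tau^1_{-i}u)\le\rho_4$ for $\mathbf{m}_{4+4j}\le i\le\mathbf{m}_{4+4j}+l-1$, $j=0,1,\dots,k-1$. "Large enough" for the differences $\mathbf{m}_{2i}-\mathbf{m}_{2i-1}$ means: for the given $l$ there is $N$ such that the conclusion holds whenever all these differences are at least $N$. *)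

theory Defs
  imports "HOL-Analysis.Analysis"
begin

text \<open>Points of the lattice are vectors \<open>int ^ 'n\<close> with \<open>n = CARD('n)\<close>; the parameter
  \<open>d :: 'n\<close> below is the coordinate direction that the paper numbers as first. Since an index type
  carries no order, \<open>d\<close> is arbitrary.\<close>

type_synonym 'n configuration = "int ^ 'n \<Rightarrow> real"

definition l1norm :: "int ^ 'n \<Rightarrow> int" where
  "l1norm i = (\<Sum>k\<in>UNIV. \<bar>i $ k\<bar>)"

definition lball :: "nat \<Rightarrow> (int ^ 'n) set" where
  "lball r = {k. l1norm k \<le> int r}"


subsection \<open>Functions on finite-dimensional coordinate spaces\<close>

text \<open>The space of real-valued functions on \<open>A\<close> is represented by the extensional functions. With
  the product topology on functions, for finite \<open>A\<close> it is a copy of Euclidean space, and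
  only the values of \<open>s\<close> on this set matter below.\<close>

definition coord_space :: "'a set \<Rightarrow> ('a \<Rightarrow> real) set" where
  "coord_space A = (A \<rightarrow>\<^sub>E UNIV)"

definition pd :: "'a \<Rightarrow> (('a \<Rightarrow> real) \<Rightarrow> real) \<Rightarrow> ('a \<Rightarrow> real) \<Rightarrow> real" where
  "pd k F u = deriv (\<lambda>t. F (u(k := t))) (u k)"

definition C1_coord :: "'a set \<Rightarrow> (('a \<Rightarrow> real) \<Rightarrow> real) \<Rightarrow> bool" where
  "C1_coord A F \<longleftrightarrow>
     continuous_on (coord_space A) F \<and>
     (\<forall>k\<in>A. (\<forall>u\<in>coord_space A. (\<lambda>t. F (u(k := t))) differentiable (at (u k))) \<and>
            continuous_on (coord_space A) (pd k F))"

definition C2_coord :: "'a set \<Rightarrow> (('a \<Rightarrow> real) \<Rightarrow> real) \<Rightarrow> bool" where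
  "C2_coord A F \<longleftrightarrow> C1_coord A F \<and> (\<forall>k\<in>A. C1_coord A (pd k F))"


subsection \<open>The model\<close>

definition S1 :: "nat \<Rightarrow> (('n::finite) configuration \<Rightarrow> real) \<Rightarrow> bool" where
  "S1 r s \<longleftrightarrow>
     (\<forall>u\<in>coord_space (lball r). s (\<lambda>k\<in>lball r. u k + 1) = s u)"

definition S2 :: "nat \<Rightarrow> (('n::finite) configuration \<Rightarrow> real) \<Rightarrow> bool" where
  "S2 r s \<longleftrightarrow>
     bdd_below (s ` coord_space (lball r)) \<and>
     (\<forall>k\<in>lball r. \<forall>j\<in>lball r. l1norm (k - j) = 1 \<longrightarrow>
        (\<forall>M. \<exists>R. \<forall>u\<in>coord_space (lball r). \<bar>u k - u j\<bar> \<ge> R \<longrightarrow> s u \<ge> M))"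

definition S3 :: "nat \<Rightarrow> (('n::finite) configuration \<Rightarrow> real) \<Rightarrow> bool" where
  "S3 r s \<longleftrightarrow>
     (\<forall>u\<in>coord_space (lball r).
        (\<forall>k\<in>lball r. \<forall>j\<in>lball r. k \<noteq> j \<longrightarrow> pd k (pd j s) u \<le> 0) \<and>
        (\<forall>j. l1norm j = 1 \<longrightarrow> pd 0 (pd j s) u < 0))"

definition S_loc ::
  "nat \<Rightarrow> (('n::finite) configuration \<Rightarrow> real) \<Rightarrow> int ^ 'n \<Rightarrow> 'n configuration \<Rightarrow> real" where
  "S_loc r s j u = s (\<lambda>k\<in>lball r. u (j + k))"

definition is_solution ::
  "nat \<Rightarrow> (('n::finite) configuration \<Rightarrow> real) \<Rightarrow> 'n configuration \<Rightarrow> bool" where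
  "is_solution r s u \<longleftrightarrow>
     (\<forall>i. (\<Sum>j | l1norm (j - i) \<le> int r. pd i (S_loc r s j) u) = 0)"


subsection \<open>Periodic minimizers and gaps\<close>

definition periodic_in :: "'n::finite \<Rightarrow> 'n configuration \<Rightarrow> bool" where
  "periodic_in j u \<longleftrightarrow> (\<forall>i. u (i + axis j 1) = u i)"

definition Per :: "('n::finite) configuration set" where
  "Per = {u. \<forall>j. periodic_in j u}"

definition c0 :: "nat \<Rightarrow> (('n::finite) configuration \<Rightarrow> real) \<Rightarrow> real" where
  "c0 r s = (INF u\<in>Per. S_loc r s 0 u)"

definition M0 :: "nat \<Rightarrow> (('n::finite) configuration \<Rightarrow> real) \<Rightarrow> 'n configuration set" where
  "M0 r s = {u \<in> Per. S_loc r s 0 u = c0 r s}"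

text \<open>The strict order is strict at every site; it is not the library order \<open><\<close> on
  functions. The library order \<open>\<le>\<close> on functions is the pointwise one.\<close>

definition below :: "'n configuration \<Rightarrow> 'n configuration \<Rightarrow> bool"  (infix "\<lless>" 50) where
  "v \<lless> w \<longleftrightarrow> (\<forall>j. v j < w j)"

definition adjacent ::
  "'n configuration set \<Rightarrow> 'n configuration \<Rightarrow> 'n configuration \<Rightarrow> bool" where
  "adjacent A v w \<longleftrightarrow>
     v \<in> A \<and> w \<in> A \<and> v \<lless> w \<and> \<not> (\<exists>u\<in>A. v \<lless> u \<and> u \<lless> w)"


subsection \<open>Basic heteroclinics\<close>

definition T :: "'n::finite \<Rightarrow> int \<Rightarrow> int ^ 'n" where
  "T d i = axis d i"

definition norm_at :: "int ^ 'n \<Rightarrow> 'n configuration \<Rightarrow> real" where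
  "norm_at x u = \<bar>u x\<bar>"

definition Gamma1_hat ::
  "'n::finite \<Rightarrow> 'n configuration \<Rightarrow> 'n configuration \<Rightarrow> 'n configuration set" where
  "Gamma1_hat d v w = {u. (\<forall>j. j \<noteq> d \<longrightarrow> periodic_in j u) \<and> v \<le> u \<and> u \<le> w}"

definition asymptotic ::
  "'n::finite \<Rightarrow> 'n configuration \<Rightarrow> 'n configuration \<Rightarrow> 'n configuration \<Rightarrow> bool" where
  "asymptotic d a b u \<longleftrightarrow>
     ((\<lambda>i. norm_at (T d i) (\<lambda>x. u x - a x)) \<longlongrightarrow> 0) at_bot \<and>
     ((\<lambda>i. norm_at (T d i) (\<lambda>x. u x - b x)) \<longlongrightarrow> 0) at_top"

text \<open>In \<open>Gamma1 d v0 w0 a b\<close> the pair \<open>v0\<close>, \<open>w0\<close> gives the obstacles and \<open>a\<close>, \<open>b\<close>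
  the limits at minus and plus infinity: \<open>(a, b)\<close> is \<open>(v0, w0)\<close> or \<open>(w0, v0)\<close>.\<close>

definition Gamma1 ::
  "'n::finite \<Rightarrow> 'n configuration \<Rightarrow> 'n configuration \<Rightarrow>
   'n configuration \<Rightarrow> 'n configuration \<Rightarrow> 'n configuration set" where
  "Gamma1 d v0 w0 a b = {u \<in> Gamma1_hat d v0 w0. asymptotic d a b u}"

definition J1_term ::
  "'n::finite \<Rightarrow> nat \<Rightarrow> ('n configuration \<Rightarrow> real) \<Rightarrow> int \<Rightarrow> 'n configuration \<Rightarrow> real" where
  "J1_term d r s p u = S_loc r s (T d p) u - c0 r s"

definition J1_part ::
  "'n::finite \<Rightarrow> nat \<Rightarrow> ('n configuration \<Rightarrow> real) \<Rightarrow> int \<Rightarrow> int \<Rightarrow> 'n configuration \<Rightarrow> real" where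
  "J1_part d r s p q u = (\<Sum>j=p..q. J1_term d r s j u)"

definition J1 ::
  "'n::finite \<Rightarrow> nat \<Rightarrow> ('n configuration \<Rightarrow> real) \<Rightarrow> 'n configuration \<Rightarrow> ereal" where
  "J1 d r s u = Liminf (at_bot \<times>\<^sub>F at_top) (\<lambda>(p, q). ereal (J1_part d r s p q u))"

definition c1 ::
  "'n::finite \<Rightarrow> nat \<Rightarrow> ('n configuration \<Rightarrow> real) \<Rightarrow> 'n configuration \<Rightarrow> 'n configuration \<Rightarrow>
   'n configuration \<Rightarrow> 'n configuration \<Rightarrow> ereal" where
  "c1 d r s v0 w0 a b = (INF u\<in>Gamma1 d v0 w0 a b. J1 d r s u)"

definition M1 ::
  "'n::finite \<Rightarrow> nat \<Rightarrow> ('n configuration \<Rightarrow> real) \<Rightarrow> 'n configuration \<Rightarrow> 'n configuration \<Rightarrow>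
   'n configuration \<Rightarrow> 'n configuration \<Rightarrow> 'n configuration set" where
  "M1 d r s v0 w0 a b = {u \<in> Gamma1 d v0 w0 a b. J1 d r s u = c1 d r s v0 w0 a b}"


subsection \<open>The constrained problem\<close>

text \<open>\<open>dist0 d v\<close> is \<open>\<rho>\<^sub>-\<close> for \<open>v = v0\<close> and \<open>\<rho>\<^sub>+\<close> for \<open>v = w0\<close>.\<close>

definition dist0 :: "'n::finite \<Rightarrow> 'n configuration \<Rightarrow> 'n configuration \<Rightarrow> real" where
  "dist0 d v u = norm_at (T d 0) (\<lambda>x. u x - v x)"

text \<open>\<open>shift d i u\<close> is the paper's \<open>\<tau>\<close> with index \<open>- i\<close>.\<close>

definition shift :: "'n::finite \<Rightarrow> int \<Rightarrow> 'n configuration \<Rightarrow> 'n configuration" where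
  "shift d i u = (\<lambda>j. u (j + T d i))"

text \<open>An integer vector with \<open>4 * k + 2\<close> entries is a function \<open>m\<close> of which only the
  values at \<open>1, \<dots>, 4 * k + 2\<close> are used.\<close>

definition admissible :: "nat \<Rightarrow> nat \<Rightarrow> (nat \<Rightarrow> int) \<Rightarrow> bool" where
  "admissible k l m \<longleftrightarrow>
     (\<forall>i. 1 \<le> i \<and> i < 4 * k + 2 \<longrightarrow> m i < m (i + 1)) \<and>
     (\<forall>j. 1 \<le> j \<and> j < 4 * k + 2 \<and> even j \<longrightarrow> m j + 2 * int l < m (j + 1))"

definition Y ::
  "'n::finite \<Rightarrow> 'n configuration \<Rightarrow> 'n configuration \<Rightarrow> real \<Rightarrow> real \<Rightarrow> real \<Rightarrow> real \<Rightarrow>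
   nat \<Rightarrow> (nat \<Rightarrow> int) \<Rightarrow> nat \<Rightarrow> 'n configuration set" where
  "Y d v0 w0 \<rho>1 \<rho>2 \<rho>3 \<rho>4 k m l =
     {u \<in> Gamma1_hat d v0 w0. asymptotic d v0 w0 u \<and>
        (\<forall>j\<in>{0..k}. \<forall>i\<in>{m (1 + 4 * j) - int l .. m (1 + 4 * j) - 1}.
            dist0 d v0 (shift d i u) \<le> \<rho>1) \<and>
        (\<forall>j\<in>{0..k}. \<forall>i\<in>{m (2 + 4 * j) .. m (2 + 4 * j) + int l - 1}.
            dist0 d w0 (shift d i u) \<le> \<rho>2) \<and>
        (\<forall>j\<in>{0..<k}. \<forall>i\<in>{m (3 + 4 * j) - int l .. m (3 + 4 * j) - 1}.
            dist0 d w0 (shift d i u) \<le> \<rho>3) \<and>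
        (\<forall>j\<in>{0..<k}. \<forall>i\<in>{m (4 + 4 * j) .. m (4 + 4 * j) + int l - 1}.
            dist0 d v0 (shift d i u) \<le> \<rho>4)}"

end

theory Submission
  imports Defs
begin

text \<open>Configurations in \<open>Gamma1_hat\<close> depend on the coordinate \<open>d\<close> only, so the problem concerns chains
  \<open>x :: int \<Rightarrow> real\<close> between two wells \<open>a < b\<close>, with an energy density \<open>h\<close> that is submodular because of
  S3. Sorting the translates of a periodic chain yields constant chains and does not increase a submodular
  energy. By compactness and the strict inequality in S3, this also applies to \<open>h x - \<epsilon> * (x 1 - x 0)\<^sup>2\<close>
  on chains in \<open>[a, b]\<close>. Hence the energy of a periodic chain dominates the sum of
  \<open>g x = h (\<lambda>_. x 0) + \<epsilon> * (x 1 - x 0)\<^sup>2\<close> over a period, and a coboundary turns \<open>h\<close> into a density \<open>A \<ge> g \<ge> 0\<close>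
  with lower semicontinuous sums \<open>E\<close>. Every excursion from a well costs a definite amount of \<open>E\<close>.

  For large \<open>l\<close> every constraint window of a chain of bounded energy contains a block close to the
  prescribed well, where the chain can be cut and glued at small cost. This repairs the asymptotics of
  limits of minimizing sequences. If a constraint were attained with equality, the
  piece between two such blocks could be replaced, with a gain, by a constant or by a translate of a
  minimizing heteroclinic; the latter needs room, which is why the differences
  \<open>m (2 * i) - m (2 * i - 1)\<close> have to be large.\<close>

subsection \<open>Sorting translates\<close>

text \<open>\<open>J1\<close> is a liminf of sums of terms of either sign, so it neither splits over
  pieces of the lattice nor is visibly lower semicontinuous. The coboundary comes from
  \<open>V\<close>, the least sum of \<open>h - g\<close> over all pasts of a chain, which the bound
  for periodic chains keeps finite. It changes partial sums by values of \<open>V\<close> at the two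
  ends, whose limits depend on the wells alone; so \<open>J1\<close> and \<open>E\<close> have the
  same minimizers among chains with given limits.

  Minimality in \<open>Y\<close> is weaker than (EL) in three ways: a window constraint may be
  active, the obstacles \<open>v0\<close> and \<open>w0\<close> may be touched, and a variation
  moves a whole hyperplane. Large differences exclude the first. For the second, a one-site
  variation that leaves \<open>[a, b]\<close> has at least the energy of its truncation at a well.
  For the third, submodularity bounds a hyperplane variation by a sum of single-site ones.

  Gluing at a block adds at most \<open>2 * r\<close> terms of size \<open>\<kappa>\<close>.
  Exchanging a transition takes three pairs of such gluings, whence
  \<open>12 * r * \<kappa> < \<gamma>\<close> for the least gain \<open>\<gamma>\<close>.\<close>

fun lattice_insert :: "'a::lattice \<Rightarrow> 'a list \<Rightarrow> 'a list" where
  "lattice_insert x [] = [x]"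
| "lattice_insert x (y # ys) = inf x y # lattice_insert (sup x y) ys"

text \<open>Insertion sort with each comparison replaced by the pair \<open>inf\<close>,
  \<open>sup\<close>. It makes sense without a total order, and every exchange is one use of
  submodularity.\<close>

definition lattice_sort :: "'a::lattice list \<Rightarrow> 'a list" where
  "lattice_sort xs = foldr lattice_insert xs []"

definition submodular_on :: "'a::lattice set \<Rightarrow> ('a \<Rightarrow> real) \<Rightarrow> bool" where
  "submodular_on S F \<longleftrightarrow>
     (\<forall>x\<in>S. \<forall>y\<in>S. inf x y \<in> S \<and> sup x y \<in> S \<and> F (sup x y) + F (inf x y) \<le> F x + F y)"

lemma lattice_insert_sum_le:
  assumes "submodular_on S F" "x \<in> S" "set ys \<subseteq> S"
  shows "set (lattice_insert x ys) \<subseteq> S \<and>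
    sum_list (map F (lattice_insert x ys)) \<le> F x + sum_list (map F ys)"
  using assms(2,3)
proof (induction ys arbitrary: x)
  case (Cons y ys)
  then have 1: "inf x y \<in> S" "sup x y \<in> S" "F (sup x y) + F (inf x y) \<le> F x + F y"
    using assms(1) by (auto simp: submodular_on_def)
  show ?case using Cons.IH[OF 1(2)] Cons.prems 1 by auto
qed auto

lemma lattice_sort_sum_le:
  assumes "submodular_on S F" "set xs \<subseteq> S"
  shows "set (lattice_sort xs) \<subseteq> S \<and>
    sum_list (map F (lattice_sort xs)) \<le> sum_list (map F xs)"
  using assms(2)
proof (induction xs)
  case (Cons x xs)
  then show ?case
    using lattice_insert_sum_le[OF assms(1), of x "lattice_sort xs"]
    by (auto simp: lattice_sort_def)
qed (auto simp: lattice_sort_def)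

text \<open>\<open>inf\<close> and \<open>sup\<close> of functions are taken site by site, so
  sorting a list of functions sorts its values at every site.\<close>

lemma map_lattice_insert:
  "map (\<lambda>f. f i) (lattice_insert f gs) = lattice_insert (f i) (map (\<lambda>g. g i) gs)"
  by (induction gs arbitrary: f) auto

lemma lattice_insert_eq_insort: "sorted ys \<Longrightarrow> lattice_insert x ys = insort x ys" for x :: real
proof (induction ys arbitrary: x)
  case (Cons y ys)
  then show ?case by (cases ys) (auto simp: inf_min sup_max min_def max_def)
qed auto

lemma map_lattice_sort:
  "map (\<lambda>f. f i) (lattice_sort fs) = sort (map (\<lambda>f. f i) fs)" for fs :: "('i \<Rightarrow> real) list"
proof (induction fs)
  case (Cons f fs)
  have "map (\<lambda>f. f i) (lattice_sort (f # fs)) = lattice_insert (f i) (sort (map (\<lambda>f. f i) fs))"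
    using Cons by (simp add: lattice_sort_def map_lattice_insert)
  also have "\<dots> = sort (map (\<lambda>f. f i) (f # fs))"
    by (simp add: lattice_insert_eq_insort)
  finally show ?case .
qed (simp add: lattice_sort_def)

text \<open>Moving the window by one site drops \<open>y i\<close> and appends
  \<open>y (i + int N)\<close>, which is the same value.\<close>

lemma mset_period_shift:
  fixes y :: "int \<Rightarrow> 'a"
  assumes per: "\<And>i. y (i + int N) = y i"
  shows "mset (map (\<lambda>p. y (int p + i)) [0..<N]) = mset (map (\<lambda>p. y (int p)) [0..<N])"
proof -
  have step: "mset (map (\<lambda>p. y (int p + (i + 1))) [0..<N]) = mset (map (\<lambda>p. y (int p + i)) [0..<N])" for i
  proof (cases N)
    case (Suc n)
    have "map (\<lambda>p. y (int p + i)) [0..<N] = y i # map (\<lambda>p. y (int p + (i + 1))) [0..<n]"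
      unfolding Suc upt_conv_Cons[OF zero_less_Suc] map_Suc_upt[symmetric]
      by (simp add: algebra_simps)
    moreover have "map (\<lambda>p. y (int p + (i + 1))) [0..<N] = map (\<lambda>p. y (int p + (i + 1))) [0..<n] @ [y i]"
      using per[of i] by (simp add: Suc algebra_simps)
    ultimately show ?thesis by simp
  qed simp
  show ?thesis
  proof (induction i rule: int_induct[where k = 0])
    case base then show ?case by simp
  next
    case (step1 i) then show ?case using step[of i] by simp
  next
    case (step2 i) then show ?case using step[of "i - 1"] by simp
  qed
qed

text \<open>At every site the translates of a periodic configuration take the same multiset of values,
  so sorting them yields constant configurations, and sorting decreases submodular energies.\<close>

lemma periodic_sum_ge_constants:
  fixes y :: "int \<Rightarrow> real"
  assumes sm: "submodular_on S F"
    and per: "\<And>i. y (i + int N) = y i"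
    and S: "\<And>p. (\<lambda>i. y (p + i)) \<in> S"
  shows "(\<Sum>p<N. F (\<lambda>_. y (int p))) \<le> (\<Sum>p<N. F (\<lambda>i. y (int p + i)))"
proof -
  define fs where "fs = map (\<lambda>p i. y (int p + i)) [0..<N]"
  define c where "c = sort (map (\<lambda>p. y (int p)) [0..<N])"
  have col: "map (\<lambda>g. g i) (lattice_sort fs) = c" for i
    unfolding map_lattice_sort c_def
    by (rule properties_for_sort)
       (use mset_period_shift[of y N i, OF per] in \<open>simp_all add: fs_def comp_def\<close>)
  have len: "length (lattice_sort fs) = length c" using col[of 0] by (metis length_map)
  have "lattice_sort fs = map (\<lambda>t _. t) c"
  proof (rule nth_equalityI)
    fix n assume n: "n < length (lattice_sort fs)"
    show "lattice_sort fs ! n = map (\<lambda>t _. t) c ! n"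
    proof
      fix i
      have "(lattice_sort fs ! n) i = c ! n" using n by (metis col nth_map)
      then show "(lattice_sort fs ! n) i = (map (\<lambda>t _. t) c ! n) i" using n len by simp
    qed
  qed (simp add: len)
  then have "sum_list (map F (lattice_sort fs)) = sum_list (map (\<lambda>t. F (\<lambda>_. t)) c)"
    by (simp add: comp_def)
  also have "\<dots> = sum_mset (image_mset (\<lambda>t. F (\<lambda>_. t)) (mset c))"
    by (simp flip: sum_mset_sum_list)
  also have "\<dots> = sum_list (map (\<lambda>p. F (\<lambda>_. y (int p))) [0..<N])"
    unfolding c_def mset_sort by (simp flip: sum_mset_sum_list add: multiset.map_comp comp_def)
  also have "\<dots> = (\<Sum>p<N. F (\<lambda>_. y (int p)))"
    by (simp add: sum_list_distinct_conv_sum_set atLeast0LessThan)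
  finally have 1: "sum_list (map F (lattice_sort fs)) = (\<Sum>p<N. F (\<lambda>_. y (int p)))" .
  have 2: "sum_list (map F fs) = (\<Sum>p<N. F (\<lambda>i. y (int p + i)))"
    by (simp add: fs_def sum_list_distinct_conv_sum_set atLeast0LessThan comp_def)
  have "set fs \<subseteq> S" using S by (auto simp: fs_def)
  from lattice_sort_sum_le[OF sm this] 1 2 show ?thesis by simp
qed

subsection \<open>Submodularity from mixed derivatives\<close>

lemma coord_space_upd [intro]: "u \<in> coord_space A \<Longrightarrow> k \<in> A \<Longrightarrow> u(k := t) \<in> coord_space A"
  by (auto simp: coord_space_def PiE_def extensional_def)

text \<open>\<open>C1_coord\<close> speaks of the derivative at the current value
  \<open>u k\<close>; applied to \<open>u(k := t)\<close> it covers the whole coordinate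
  line.\<close>

lemma C1_coord_has_pd:
  assumes "C1_coord A F" "u \<in> coord_space A" "k \<in> A"
  shows "((\<lambda>x. F (u(k := x))) has_real_derivative pd k F (u(k := t))) (at t)"
proof -
  have "(\<lambda>x. F ((u(k := t))(k := x))) differentiable (at ((u(k := t)) k))"
    using assms unfolding C1_coord_def by (metis coord_space_upd)
  then show ?thesis by (simp add: pd_def DERIV_deriv_iff_real_differentiable)
qed

text \<open>The bound is integrated twice in the form of monotonicity: the first derivative plus
  \<open>c * y\<close> is nonincreasing along \<open>k\<close>, hence the difference of two rows
  plus \<open>c * (q' - q) * x\<close> is nonincreasing along \<open>j\<close>.\<close>

lemma mixed_difference_le:
  assumes C2: "C2_coord A F" and u: "u \<in> coord_space A" and jk: "j \<in> A" "k \<in> A" "j \<noteq> k"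
    and le: "t \<le> t'" "q \<le> q'"
    and neg: "\<And>x y. t \<le> x \<Longrightarrow> x \<le> t' \<Longrightarrow> q \<le> y \<Longrightarrow> y \<le> q' \<Longrightarrow> pd k (pd j F) (u(j := x, k := y)) \<le> - c"
  shows "F (u(j := t', k := q')) + F (u(j := t, k := q)) + c * (t' - t) * (q' - q)
      \<le> F (u(j := t', k := q)) + F (u(j := t, k := q'))"
proof -
  have C1: "C1_coord A F" "C1_coord A (pd j F)" using C2 jk by (auto simp: C2_coord_def)
  have 1: "pd j F (u(j := x, k := q')) + c * q' \<le> pd j F (u(j := x, k := q)) + c * q"
    if x: "t \<le> x" "x \<le> t'" for x
  proof (rule DERIV_nonpos_imp_nonincreasing[OF le(2), of "\<lambda>y. pd j F (u(j := x, k := y)) + c * y"])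
    fix y assume y: "q \<le> y" "y \<le> q'"
    have "((\<lambda>y. pd j F ((u(j := x))(k := y)) + c * y) has_real_derivative
        pd k (pd j F) ((u(j := x))(k := y)) + c) (at y)"
      using u jk by (auto intro!: derivative_eq_intros C1_coord_has_pd[OF C1(2)])
    then show "\<exists>D. ((\<lambda>y. pd j F (u(j := x, k := y)) + c * y) has_real_derivative D) (at y) \<and> D \<le> 0"
      using neg[OF x y] by fastforce
  qed
  have "F (u(k := q', j := t')) - F (u(k := q, j := t')) + c * (q' - q) * t' \<le>
      F (u(k := q', j := t)) - F (u(k := q, j := t)) + c * (q' - q) * t"
  proof (rule DERIV_nonpos_imp_nonincreasing[OF le(1),
        of "\<lambda>x. F (u(k := q', j := x)) - F (u(k := q, j := x)) + c * (q' - q) * x"])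
    fix x assume x: "t \<le> x" "x \<le> t'"
    have "((\<lambda>x. F ((u(k := q'))(j := x)) - F ((u(k := q))(j := x)) + c * (q' - q) * x) has_real_derivative
        pd j F ((u(k := q'))(j := x)) - pd j F ((u(k := q))(j := x)) + c * (q' - q)) (at x)"
      using u jk by (auto intro!: derivative_eq_intros C1_coord_has_pd[OF C1(1)])
    moreover have "pd j F ((u(k := q'))(j := x)) - pd j F ((u(k := q))(j := x)) + c * (q' - q) \<le> 0"
      using 1[OF x] jk by (simp add: fun_upd_twist algebra_simps)
    ultimately show "\<exists>D. ((\<lambda>x. F (u(k := q', j := x)) - F (u(k := q, j := x)) + c * (q' - q) * x)
        has_real_derivative D) (at x) \<and> D \<le> 0"
      by blast
  qed
  then show ?thesis using jk by (simp add: fun_upd_twist algebra_simps)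
qed

section \<open>From inequalities in two coordinates to submodularity\<close>

context
  fixes A :: "'a set" and X :: "real set" and F :: "('a \<Rightarrow> real) \<Rightarrow> real"
  assumes fin: "finite A"
    and four: "\<And>u j k t t' q q'. u \<in> A \<rightarrow>\<^sub>E X \<Longrightarrow> j \<in> A \<Longrightarrow> k \<in> A \<Longrightarrow> j \<noteq> k \<Longrightarrow>
      t \<in> X \<Longrightarrow> t' \<in> X \<Longrightarrow> q \<in> X \<Longrightarrow> q' \<in> X \<Longrightarrow> t \<le> t' \<Longrightarrow> q \<le> q' \<Longrightarrow>
      F (u(j := t', k := q')) + F (u(j := t, k := q)) \<le> F (u(j := t', k := q)) + F (u(j := t, k := q'))"
begin

text \<open>The coordinates other than \<open>j\<close> are moved from \<open>u\<close> to
  \<open>v\<close> one at a time; each move is one instance of \<open>four\<close> and can only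
  lower the increment in direction \<open>j\<close>.\<close>

lemma decreasing_differences:
  assumes uv: "u \<in> A \<rightarrow>\<^sub>E X" "v \<in> A \<rightarrow>\<^sub>E X" and le: "u \<le> v"
    and j: "j \<in> A" "u j = v j" and t: "t \<in> X" "u j \<le> t"
  shows "F (v(j := t)) + F u \<le> F (u(j := t)) + F v"
proof -
  define w where "w K = (\<lambda>i. if i \<in> K then v i else u i)" for K
  have "F ((w K)(j := t)) + F u \<le> F (u(j := t)) + F (w K)" if "finite K" "K \<subseteq> A - {j}" for K
    using that
  proof (induction K)
    case (insert k K)
    have IH: "F ((w K)(j := t)) + F u \<le> F (u(j := t)) + F (w K)"
      using insert.IH insert.prems by blast
    have wK: "w K \<in> A \<rightarrow>\<^sub>E X" using uv by (auto simp: w_def PiE_def extensional_def)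
    have k: "w K k = u k" "w K j = u j" using insert by (auto simp: w_def)
    have *: "w (insert k K) = (w K)(k := v k)" by (auto simp: w_def)
    have "F ((w K)(j := t, k := v k)) + F ((w K)(j := u j, k := u k))
        \<le> F ((w K)(j := t, k := u k)) + F ((w K)(j := u j, k := v k))"
      using insert.prems j t uv le by (intro four[OF wK]) (auto simp: le_fun_def PiE_iff)
    moreover have "(w K)(j := u j, k := u k) = w K" using k by auto
    moreover have "(w K)(j := t, k := u k) = (w K)(j := t)" using k insert.prems by auto
    moreover have "(w K)(j := u j, k := v k) = w (insert k K)" using k * by auto
    moreover have "(w K)(j := t, k := v k) = (w (insert k K))(j := t)"
      using * insert.prems by (auto simp: fun_upd_twist)
    moreover note IH
    ultimately show ?case by (smt (verit))
  qed (simp add: w_def)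
  from this[of "A - {j}"] have "F ((w (A - {j}))(j := t)) + F u \<le> F (u(j := t)) + F (w (A - {j}))"
    using fin by simp
  moreover have "w (A - {j}) = v"
  proof
    fix i show "w (A - {j}) i = v i"
      using j uv by (cases "i \<in> A") (auto simp: w_def PiE_def extensional_def)
  qed
  ultimately show ?thesis by simp
qed

text \<open>Raising the coordinates where \<open>v < u\<close>, one at a time, leads from
  \<open>inf u v\<close> to \<open>u\<close> and from \<open>v\<close> to \<open>sup u v\<close>.
  The second path lies above the first and agrees with it at the coordinate about to be raised, so
  its increments are smaller.\<close>

lemma submodular_on_PiE: "submodular_on (A \<rightarrow>\<^sub>E X) F"
  unfolding submodular_on_def
proof (intro ballI)
  fix u v assume uv: "u \<in> A \<rightarrow>\<^sub>E X" "v \<in> A \<rightarrow>\<^sub>E X"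
  have inf: "inf u v \<in> A \<rightarrow>\<^sub>E X" and sup: "sup u v \<in> A \<rightarrow>\<^sub>E X"
    using uv by (auto simp: PiE_def extensional_def Pi_def inf_min sup_max min_def max_def)
  define P where "P = {i\<in>A. v i < u i}"
  define V where "V K = (\<lambda>i. if i \<in> K then u i else v i)" for K
  define W where "W K = (\<lambda>i. if i \<in> K then u i else inf u v i)" for K
  have "F (V K) + F (inf u v) \<le> F (W K) + F v" if "finite K" "K \<subseteq> P" for K
    using that
  proof (induction K)
    case (insert k K)
    have VK: "V K \<in> A \<rightarrow>\<^sub>E X" using uv by (auto simp: V_def PiE_def extensional_def)
    have WK: "W K \<in> A \<rightarrow>\<^sub>E X" using uv by (auto simp: W_def PiE_def extensional_def Pi_def inf_min min_def)
    have k: "k \<in> A" "v k < u k" "k \<notin> K" using insert by (auto simp: P_def)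
    have "F ((V K)(k := u k)) + F (W K) \<le> F ((W K)(k := u k)) + F (V K)"
      using k uv by (intro decreasing_differences[OF WK VK])
        (auto simp: le_fun_def W_def V_def inf_min)
    moreover have "(V K)(k := u k) = V (insert k K)" "(W K)(k := u k) = W (insert k K)"
      by (auto simp: V_def W_def)
    moreover have "F (V K) + F (inf u v) \<le> F (W K) + F v" using insert by blast
    ultimately show ?case by (smt (verit))
  qed (simp add: V_def W_def inf_fun_def)
  from this[of P] have "F (V P) + F (inf u v) \<le> F (W P) + F v" using fin by (simp add: P_def)
  moreover have "V P = sup u v"
  proof
    fix i show "V P i = sup u v i"
      using uv by (cases "i \<in> A") (auto simp: V_def P_def PiE_def extensional_def sup_max)
  qed
  moreover have "W P = u"
  proof
    fix i show "W P i = u i"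
      using uv by (cases "i \<in> A") (auto simp: W_def P_def PiE_def extensional_def inf_min)
  qed
  ultimately show "inf u v \<in> A \<rightarrow>\<^sub>E X \<and> sup u v \<in> A \<rightarrow>\<^sub>E X \<and> F (sup u v) + F (inf u v) \<le> F u + F v"
    using inf sup by auto
qed

end

lemma submodular_on_coord_space:
  fixes A :: "'a set"
  assumes "finite A" "C2_coord A F"
    and "\<And>u k j. u \<in> coord_space A \<Longrightarrow> k \<in> A \<Longrightarrow> j \<in> A \<Longrightarrow> k \<noteq> j \<Longrightarrow> pd k (pd j F) u \<le> 0"
  shows "submodular_on (coord_space A) F"
  unfolding coord_space_def
proof (rule submodular_on_PiE[OF assms(1)])
  fix u :: "'a \<Rightarrow> real" and j k and t t' q q' :: real
  assume "u \<in> A \<rightarrow>\<^sub>E UNIV" "j \<in> A" "k \<in> A" "j \<noteq> k" "t \<le> t'" "q \<le> q'"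
  then show "F (u(j := t', k := q')) + F (u(j := t, k := q)) \<le> F (u(j := t', k := q)) + F (u(j := t, k := q'))"
    using mixed_difference_le[OF assms(2), of u j k t t' q q' 0] assms(3)
    by (force simp: coord_space_def PiE_def extensional_def)
qed

text \<open>The mixed difference of the subtracted square is
  \<open>2 * \<epsilon> * (t' - t) * (q' - q)\<close> for the pair \<open>i0\<close>,
  \<open>i1\<close> and zero for all other pairs, so the strict sign of a single mixed derivative
  pays for it.\<close>

lemma submodular_on_box_minus_square:
  fixes A :: "'a set"
  assumes fin: "finite A" and C2: "C2_coord A F" and i0: "i0 \<in> A" "i1 \<in> A" "i0 \<noteq> i1"
    and le: "\<And>u k j. u \<in> coord_space A \<Longrightarrow> k \<in> A \<Longrightarrow> j \<in> A \<Longrightarrow> k \<noteq> j \<Longrightarrow> pd k (pd j F) u \<le> 0"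
    and less: "\<And>u. u \<in> A \<rightarrow>\<^sub>E {a..b} \<Longrightarrow> pd i0 (pd i1 F) u \<le> - 2 * \<epsilon>"
  shows "submodular_on (A \<rightarrow>\<^sub>E {a..b}) (\<lambda>u. F u - \<epsilon> * (u i1 - u i0)\<^sup>2)"
proof (rule submodular_on_PiE[OF fin])
  fix u :: "'a \<Rightarrow> real" and j k and t t' q q' :: real
  assume u: "u \<in> A \<rightarrow>\<^sub>E {a..b}" and jk: "j \<in> A" "k \<in> A" "j \<noteq> k"
    and t: "t \<in> {a..b}" "t' \<in> {a..b}" "q \<in> {a..b}" "q' \<in> {a..b}" "t \<le> t'" "q \<le> q'"
  let ?G = "\<lambda>u. F u - \<epsilon> * (u i1 - u i0)\<^sup>2"
  have cs: "w \<in> coord_space A" if "w \<in> A \<rightarrow>\<^sub>E {a..b}" for w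
    using that by (auto simp: coord_space_def PiE_def)
  have box: "u(j := x, k := y) \<in> A \<rightarrow>\<^sub>E {a..b}" "u(k := x, j := y) \<in> A \<rightarrow>\<^sub>E {a..b}"
    if "x \<in> {a..b}" "y \<in> {a..b}" for x y
    using u jk that by (auto simp: PiE_def extensional_def Pi_def)
  consider "j = i1" "k = i0" | "j = i0" "k = i1" | "\<not> (j = i1 \<and> k = i0)" "\<not> (j = i0 \<and> k = i1)" by blast
  then show "?G (u(j := t', k := q')) + ?G (u(j := t, k := q)) \<le> ?G (u(j := t', k := q)) + ?G (u(j := t, k := q'))"
  proof cases
    case 1
    have "F (u(j := t', k := q')) + F (u(j := t, k := q)) + 2 * \<epsilon> * (t' - t) * (q' - q)
        \<le> F (u(j := t', k := q)) + F (u(j := t, k := q'))"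
      using t jk less[OF box(1)] 1 by (intro mixed_difference_le[OF C2 cs[OF u]]) auto
    then show ?thesis using 1 jk by (simp add: power2_eq_square algebra_simps)
  next
    case 2
    \<comment> \<open>The two directions exchange roles here, since \<open>less\<close> bounds the
      mixed derivative in one order of differentiation.\<close>
    have "F (u(k := q', j := t')) + F (u(k := q, j := t)) + 2 * \<epsilon> * (q' - q) * (t' - t)
        \<le> F (u(k := q', j := t)) + F (u(k := q, j := t'))"
      using t jk less[OF box(2)] 2 by (intro mixed_difference_le[OF C2 cs[OF u]]) auto
    then show ?thesis using 2 jk by (simp add: power2_eq_square algebra_simps fun_upd_twist)
  next
    case 3
    have "F (u(j := t', k := q')) + F (u(j := t, k := q)) + 0 * (t' - t) * (q' - q)
        \<le> F (u(j := t', k := q)) + F (u(j := t, k := q'))"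
      using t jk cs[OF u] by (intro mixed_difference_le[OF C2 cs[OF u]]) (auto intro!: le)
    then show ?thesis using 3 jk i0 by auto
  qed
qed

text \<open>Variations at disjoint sites in the same direction have the joint variation and
  \<open>u\<close> as their \<open>sup\<close> and \<open>inf\<close>, in an order given by the sign
  of \<open>t - c\<close>. So the sites of \<open>K\<close> can be split off one by one.\<close>

lemma submodular_block_variation_le:
  assumes sm: "submodular_on (coord_space A) F" and u: "u \<in> coord_space A"
    and K: "finite K" "K \<subseteq> A" "\<And>k. k \<in> K \<Longrightarrow> u k = c"
  shows "F (\<lambda>k. if k \<in> K then t else u k) - F u \<le> (\<Sum>k\<in>K. F (u(k := t)) - F u)"
  using K
proof (induction K)
  case (insert k K)
  let ?v = "\<lambda>i. if i \<in> K then t else u i" and ?w = "u(k := t)" and ?z = "\<lambda>i. if i \<in> insert k K then t else u i"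
  have vw: "?v \<in> coord_space A" "?w \<in> coord_space A"
    using u insert.prems by (auto simp: coord_space_def PiE_def extensional_def)
  have "F (sup ?v ?w) + F (inf ?v ?w) \<le> F ?v + F ?w"
    using sm vw unfolding submodular_on_def by blast
  moreover have "sup ?v ?w = ?z \<and> inf ?v ?w = u \<or> sup ?v ?w = u \<and> inf ?v ?w = ?z"
  proof (cases "c \<le> t")
    case True
    then have "sup ?v ?w = ?z \<and> inf ?v ?w = u"
      using insert.prems insert.hyps by (auto simp: fun_eq_iff sup_max inf_min)
    then show ?thesis ..
  next
    case False
    then have "sup ?v ?w = u \<and> inf ?v ?w = ?z"
      using insert.prems insert.hyps by (auto simp: fun_eq_iff sup_max inf_min)
    then show ?thesis ..
  qed
  ultimately have "F ?z + F u \<le> F ?v + F ?w" by auto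
  moreover have "F ?v - F u \<le> (\<Sum>k\<in>K. F (u(k := t)) - F u)" using insert by blast
  ultimately show ?case unfolding sum.insert[OF insert.hyps] by linarith
qed simp

subsection \<open>One-dimensional chains\<close>

definition box :: "real \<Rightarrow> real \<Rightarrow> ('i \<Rightarrow> real) set" where
  "box a b = {x. \<forall>i. a \<le> x i \<and> x i \<le> b}"

definition tr :: "int \<Rightarrow> (int \<Rightarrow> real) \<Rightarrow> int \<Rightarrow> real" where
  "tr p x = (\<lambda>i. x (p + i))"

lemma tr_apply: "tr p x i = x (p + i)"
  by (simp add: tr_def)

lemma tr_tr [simp]: "tr p (tr q x) = tr (p + q) x"
  by (auto simp: tr_def algebra_simps)

lemma tr_0 [simp]: "tr 0 x = x"
  by (auto simp: tr_def)

lemma tr_const [simp]: "tr p (\<lambda>_. c) = (\<lambda>_. c)"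
  by (auto simp: tr_def)

lemma tr_box [intro, simp]: "x \<in> box a b \<Longrightarrow> tr p x \<in> box a b"
  by (auto simp: tr_def box_def)

lemma const_box [simp]: "(\<lambda>_. c) \<in> box a b \<longleftrightarrow> a \<le> c \<and> c \<le> b"
  by (auto simp: box_def)

text \<open>Tychonoff; the index type is countable, so compactness of the product yields convergent
  subsequences.\<close>

lemma box_subseq:
  fixes f :: "nat \<Rightarrow> 'i::countable \<Rightarrow> real"
  assumes "\<And>n. f n \<in> box a b"
  shows "\<exists>l s. strict_mono s \<and> l \<in> box a b \<and> (\<forall>i. (\<lambda>n. f (s n) i) \<longlonglongrightarrow> l i)"
proof -
  have *: "box a b = (UNIV \<rightarrow>\<^sub>E {a..b})" by (auto simp: box_def PiE_def Pi_def)
  have "compactin (product_topology (\<lambda>i. euclidean) UNIV) (UNIV \<rightarrow>\<^sub>E {a..b})"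
    by (subst compactin_PiE) auto
  then have "compact (box a b :: ('i \<Rightarrow> real) set)" unfolding * by (simp add: euclidean_product_topology)
  then have "seq_compact (box a b :: ('i \<Rightarrow> real) set)" by (rule compact_imp_seq_compact)
  then obtain l s where ls: "l \<in> box a b" "strict_mono s" "(f \<circ> s) \<longlonglongrightarrow> l"
    using assms unfolding seq_compact_def by blast
  have "(\<lambda>n. f (s n) i) \<longlonglongrightarrow> l i" for i
  proof -
    have "continuous (at l) (\<lambda>x. x i)"
      by (rule continuous_on_interior[OF continuous_on_product_coordinates]) auto
    from isCont_tendsto_compose[OF this ls(3)] show ?thesis by (simp add: comp_def)
  qed
  with ls show ?thesis by auto
qed

text \<open>Convergence is asked for on the window alone, so locality is built in: applied to
  constant sequences it says that chains of the box which agree on the window have equal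
  values.\<close>

definition seq_cont :: "nat \<Rightarrow> real \<Rightarrow> real \<Rightarrow> ((int \<Rightarrow> real) \<Rightarrow> real) \<Rightarrow> bool" where
  "seq_cont r a b F \<longleftrightarrow> (\<forall>f l. (\<forall>n. f n \<in> box a b) \<longrightarrow> l \<in> box a b \<longrightarrow>
     (\<forall>i\<in>{- int r..int r}. (\<lambda>n. f n i) \<longlonglongrightarrow> l i) \<longrightarrow> (\<lambda>n. F (f n)) \<longlonglongrightarrow> F l)"

lemma seq_contD:
  "\<lbrakk>seq_cont r a b F; \<And>n. f n \<in> box a b; l \<in> box a b; \<And>i. i \<in> {- int r..int r} \<Longrightarrow> (\<lambda>n. f n i) \<longlonglongrightarrow> l i\<rbrakk>
    \<Longrightarrow> (\<lambda>n. F (f n)) \<longlonglongrightarrow> F l"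
  by (simp add: seq_cont_def)

text \<open>Pairs violating the claim for tolerances \<open>1 / (n + 1)\<close> have subsequences
  with a common limit on the window.\<close>

lemma seq_cont_uniform:
  assumes F: "seq_cont r a b F" and e: "e > 0"
  shows "\<exists>\<delta>>0. \<forall>x\<in>box a b. \<forall>y\<in>box a b. (\<forall>i\<in>{- int r..int r}. \<bar>x i - y i\<bar> \<le> \<delta>) \<longrightarrow> \<bar>F x - F y\<bar> \<le> e"
proof (rule ccontr)
  assume neg: "\<not> ?thesis"
  have "\<exists>x\<in>box a b. \<exists>y\<in>box a b. (\<forall>i\<in>{- int r..int r}. \<bar>x i - y i\<bar> \<le> 1 / real (Suc n)) \<and> \<bar>F x - F y\<bar> > e" for n
  proof (rule ccontr)
    assume "\<not> ?thesis"
    then have "\<forall>x\<in>box a b. \<forall>y\<in>box a b. (\<forall>i\<in>{- int r..int r}. \<bar>x i - y i\<bar> \<le> 1 / real (Suc n)) \<longrightarrow> \<bar>F x - F y\<bar> \<le> e"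
      by (auto simp: not_less)
    moreover have "0 < 1 / real (Suc n)" by simp
    ultimately show False using neg by blast
  qed
  then have "\<forall>n. \<exists>z. fst z \<in> box a b \<and> snd z \<in> box a b \<and>
      (\<forall>i\<in>{- int r..int r}. \<bar>fst z i - snd z i\<bar> \<le> 1 / real (Suc n)) \<and> \<bar>F (fst z) - F (snd z)\<bar> > e"
    unfolding split_paired_Ex fst_conv snd_conv by blast
  then obtain z where z: "\<forall>n. fst (z n) \<in> box a b \<and> snd (z n) \<in> box a b \<and>
      (\<forall>i\<in>{- int r..int r}. \<bar>fst (z n) i - snd (z n) i\<bar> \<le> 1 / real (Suc n)) \<and>
      \<bar>F (fst (z n)) - F (snd (z n))\<bar> > e"
    by (rule choice[THEN exE])
  define f g where "f n = fst (z n)" and "g n = snd (z n)" for n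
  have fg: "\<And>n. f n \<in> box a b" "\<And>n. g n \<in> box a b"
    "\<And>n i. i \<in> {- int r..int r} \<Longrightarrow> \<bar>f n i - g n i\<bar> \<le> 1 / real (Suc n)" "\<And>n. \<bar>F (f n) - F (g n)\<bar> > e"
    using z unfolding f_def g_def by blast+
  obtain l s where ls: "strict_mono s" "l \<in> box a b" "\<And>i. (\<lambda>n. f (s n) i) \<longlonglongrightarrow> l i"
    using box_subseq[of f, OF fg(1)] by auto
  have "(\<lambda>n. g (s n) i) \<longlonglongrightarrow> l i" if i: "i \<in> {- int r..int r}" for i
  proof -
    have "(\<lambda>n. 1 / real (Suc (s n))) \<longlonglongrightarrow> 0"
      using LIMSEQ_subseq_LIMSEQ[OF LIMSEQ_inverse_real_of_nat ls(1)] by (simp only: comp_def inverse_eq_divide)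
    then have "(\<lambda>n. f (s n) i - g (s n) i) \<longlonglongrightarrow> 0"
      by (rule tendsto_0_le[where K = 1]) (intro always_eventually allI, use fg(3)[OF i] in simp)
    from tendsto_diff[OF ls(3)[of i] this] show ?thesis by simp
  qed
  then have "(\<lambda>n. F (f (s n)) - F (g (s n))) \<longlonglongrightarrow> F l - F l"
    using fg(1,2) ls by (intro tendsto_diff seq_contD[OF F]) blast+
  then have "\<forall>\<^sub>F n in sequentially. \<bar>F (f (s n)) - F (g (s n))\<bar> < e"
    using e by (auto simp: tendsto_iff dist_real_def)
  then obtain n where "\<bar>F (f (s n)) - F (g (s n))\<bar> < e"
    using eventually_happens'[OF sequentially_bot] by blast
  with fg(4)[of "s n"] show False by simp
qed

lemma seq_cont_bounded:
  assumes F: "seq_cont r a b F"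
  shows "\<exists>C>0. \<forall>x\<in>box a b. \<bar>F x\<bar> \<le> C"
proof (rule ccontr)
  assume neg: "\<not> ?thesis"
  have "\<exists>x\<in>box a b. \<bar>F x\<bar> > real (Suc n)" for n
  proof (rule ccontr)
    assume "\<not> ?thesis"
    then have "\<forall>x\<in>box a b. \<bar>F x\<bar> \<le> real (Suc n)" by (auto simp: not_less)
    moreover have "0 < real (Suc n)" by simp
    ultimately show False using neg by blast
  qed
  then obtain f where f: "\<And>n. f n \<in> box a b" "\<And>n. \<bar>F (f n)\<bar> > real (Suc n)" by metis
  obtain l s where ls: "strict_mono s" "l \<in> box a b" "\<And>i. (\<lambda>n. f (s n) i) \<longlonglongrightarrow> l i"
    using box_subseq[of f, OF f(1)] by auto
  have "(\<lambda>n. F (f (s n))) \<longlonglongrightarrow> F l"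
    using f(1) ls by (intro seq_contD[OF F]) blast+
  then have "Bseq (\<lambda>n. F (f (s n)))" by (simp add: convergentI convergent_imp_Bseq)
  then obtain K where K: "\<And>n. \<bar>F (f (s n))\<bar> \<le> K" by (auto simp: Bseq_def)
  obtain n where "K < real n" using reals_Archimedean2 by blast
  moreover have "real n \<le> real (s n)" using ls(1) by (simp add: seq_suble)
  ultimately show False using f(2)[of "s n"] K[of n] by simp
qed

lemma submodular_on_box_translates:
  assumes "submodular_on (box a b) F"
    and "\<And>i. y (i + int N) = y i" "y \<in> box a b"
  shows "(\<Sum>p<N. F (\<lambda>_. y (int p))) \<le> (\<Sum>p<N. F (tr (int p) y))"
  unfolding tr_def
proof (rule periodic_sum_ge_constants[OF assms(1), of y N])
  show "y (i + int N) = y i" for i by (rule assms(2))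
  show "(\<lambda>i. y (p + i)) \<in> box a b" for p using assms(3) by (simp add: box_def)
qed

text \<open>\<open>sub\<close> covers all chains because truncation at a well starts from chains
  that leave \<open>[a, b]\<close>; \<open>sub_box\<close> is confined to the box, where compactness
  provides \<open>\<epsilon>\<close>. The density is normalized by its ground state energy, so it
  vanishes at the wells.\<close>

locale chain =
  fixes r :: nat and h :: "(int \<Rightarrow> real) \<Rightarrow> real" and a b \<epsilon> :: real
  assumes r: "1 \<le> r" and ab: "a < b" and eps: "0 < \<epsilon>"
    and local: "\<And>x y. (\<And>i. i \<in> {- int r..int r} \<Longrightarrow> x i = y i) \<Longrightarrow> h x = h y"
    and cont: "seq_cont r a b h"
    and sub: "submodular_on UNIV h"
    and sub_box: "submodular_on (box a b) (\<lambda>x. h x - \<epsilon> * (x 1 - x 0)\<^sup>2)"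
    and h_nonneg: "0 \<le> h (\<lambda>_. c)"
    and h_a: "h (\<lambda>_. a) = 0" and h_b: "h (\<lambda>_. b) = 0"
    and h_pos: "\<lbrakk>a < c; c < b\<rbrakk> \<Longrightarrow> 0 < h (\<lambda>_. c)"
begin

section \<open>The nonnegative density\<close>

abbreviation "X \<equiv> box a b :: (int \<Rightarrow> real) set"

definition g :: "(int \<Rightarrow> real) \<Rightarrow> real" where
  "g x = h (\<lambda>_. x 0) + \<epsilon> * (x 1 - x 0)\<^sup>2"

text \<open>What remains of \<open>h\<close> once the coercive part \<open>g\<close> is removed. By
  \<open>sub_box\<close> its sum over a period of a periodic chain is nonnegative, which makes it
  the right quantity to minimize over pasts.\<close>

definition B :: "(int \<Rightarrow> real) \<Rightarrow> real" where
  "B x = h x - g x"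

lemma g_nonneg: "0 \<le> g x"
  using eps h_nonneg by (simp add: g_def)

lemma B_local: "(\<And>i. i \<in> {- int r..int r} \<Longrightarrow> x i = y i) \<Longrightarrow> B x = B y"
  using local[of x y] r by (simp add: B_def g_def)

lemma seq_cont_g: "seq_cont r a b g"
  unfolding seq_cont_def
proof (intro allI impI)
  fix f l assume f: "\<forall>n. f n \<in> box a b" and l: "l \<in> box a b"
    and fl: "\<forall>i\<in>{- int r..int r}. (\<lambda>n. f n i) \<longlonglongrightarrow> l i"
  have "(\<lambda>n. h (\<lambda>_. f n 0)) \<longlonglongrightarrow> h (\<lambda>_. l 0)"
    using f l fl r by (intro seq_contD[OF cont]) (auto simp: box_def)
  moreover have "(\<lambda>n. f n 0) \<longlonglongrightarrow> l 0" "(\<lambda>n. f n 1) \<longlonglongrightarrow> l 1" using fl r by auto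
  ultimately show "(\<lambda>n. g (f n)) \<longlonglongrightarrow> g l"
    unfolding g_def by (intro tendsto_intros)
qed

lemma seq_cont_B: "seq_cont r a b B"
  using cont seq_cont_g by (auto simp: seq_cont_def B_def intro!: tendsto_diff)

text \<open>Closing a finite piece of a chain up periodically costs at most the terms whose windows
  meet the ends, so the lower bound for periodic chains carries over.\<close>

lemma sum_B_bounded_below:
  "\<exists>K>0. \<forall>x\<in>X. \<forall>p n. - K \<le> (\<Sum>j<n. B (tr (p + int j) x))"
proof -
  obtain C where C: "C > 0" "\<And>x. x \<in> X \<Longrightarrow> \<bar>B x\<bar> \<le> C" using seq_cont_bounded[OF seq_cont_B] by blast
  \<comment> \<open>At most \<open>2 * r\<close> windows wrap around the period, and each changes
    its term by at most \<open>2 * C\<close>.\<close>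
  have "- (4 * real r * C + 1) \<le> (\<Sum>j<n. B (tr (p + int j) x))" if x: "x \<in> X" for x p n
  proof (cases "n = 0")
    case False
    define y where "y i = x (p + i mod int n)" for i
    have y: "y \<in> X" using x by (auto simp: y_def box_def)
    have "(\<Sum>j<n. h (\<lambda>_. y (int j))) \<le> (\<Sum>j<n. h (tr (int j) y) - \<epsilon> * (tr (int j) y 1 - tr (int j) y 0)\<^sup>2)"
      using submodular_on_box_translates[OF sub_box _ y, of n] by (simp add: y_def[abs_def])
    moreover have "B (tr (int j) y) =
        (h (tr (int j) y) - \<epsilon> * (tr (int j) y 1 - tr (int j) y 0)\<^sup>2) - h (\<lambda>_. y (int j))" for j
      by (simp add: B_def g_def tr_apply)
    ultimately have "0 \<le> (\<Sum>j<n. B (tr (int j) y))"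
      by (simp only: sum_subtractf)
    moreover have "(\<Sum>j<n. B (tr (int j) y) - B (tr (p + int j) x)) \<le> (\<Sum>j<n. if j < r \<or> n \<le> j + r then 2 * C else 0)"
    proof (rule sum_mono)
      fix j assume "j \<in> {..<n}"
      show "B (tr (int j) y) - B (tr (p + int j) x) \<le> (if j < r \<or> n \<le> j + r then 2 * C else 0)"
      proof (cases "j < r \<or> n \<le> j + r")
        case True
        then show ?thesis
          using C(2)[OF tr_box[OF y, of "int j"]] C(2)[OF tr_box[OF x, of "p + int j"]] by simp
      next
        case F: False
        have "B (tr (int j) y) = B (tr (p + int j) x)"
        proof (rule B_local)
          fix i assume "i \<in> {- int r..int r}"
          then have "(int j + i) mod int n = int j + i" using F by (intro mod_pos_pos_trivial) auto
          then show "tr (int j) y i = tr (p + int j) x i" by (simp add: tr_apply y_def add.assoc)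
        qed
        then show ?thesis using F by simp
      qed
    qed
    moreover have "(\<Sum>j<n. if j < r \<or> n \<le> j + r then 2 * C else 0) \<le> 4 * real r * C"
    proof -
      have eq: "(\<Sum>j<n. if j < r \<or> n \<le> j + r then 2 * C else 0) = real (card {j\<in>{..<n}. j < r \<or> n \<le> j + r}) * (2 * C)"
        by (subst sum.inter_filter[symmetric]) auto
      have "card {j\<in>{..<n}. j < r \<or> n \<le> j + r} \<le> card ({..<r} \<union> {n-r..<n})"
        by (rule card_mono) auto
      moreover have "card ({..<r} \<union> {n-r..<n}) \<le> 2 * r"
        using card_Un_le[of "{..<r}" "{n-r..<n}"] by simp
      ultimately have "real (card {j\<in>{..<n}. j < r \<or> n \<le> j + r}) \<le> real (2 * r)" by linarith
      then have "real (card {j\<in>{..<n}. j < r \<or> n \<le> j + r}) * (2 * C) \<le> real (2 * r) * (2 * C)"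
        using C(1) by (intro mult_right_mono) auto
      then show ?thesis unfolding eq by simp
    qed
    ultimately show ?thesis unfolding sum_subtractf by linarith
  next
    case True
    have "0 \<le> 4 * real r * C" using C(1) by simp
    then have "- (4 * real r * C + 1) \<le> 0" by linarith
    then show ?thesis using True by simp
  qed
  then show ?thesis using C(1) by (intro exI[of _ "4 * real r * C + 1"] conjI ballI allI add_nonneg_pos) auto
qed

text \<open>The value function of the past: adding the coboundary of \<open>V\<close> turns \<open>h\<close> into the nonnegative
  density \<open>A\<close> without changing energies except for boundary terms.\<close>

definition V :: "(int \<Rightarrow> real) \<Rightarrow> real" where
  "V x = Inf {(\<Sum>j<n. B (tr (int j - int n) y)) | n y. y \<in> X \<and> (\<forall>i\<ge>- int r. y i = x i)}"

lemma V_le: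
  assumes "y \<in> X" "\<And>i. i \<ge> - int r \<Longrightarrow> y i = x i"
  shows "V x \<le> (\<Sum>j<n. B (tr (int j - int n) y))"
proof -
  obtain K where K: "\<And>x p n. x \<in> X \<Longrightarrow> - K \<le> (\<Sum>j<n. B (tr (p + int j) x))"
    using sum_B_bounded_below by blast
  show ?thesis unfolding V_def
  proof (rule cInf_lower)
    show "bdd_below {(\<Sum>j<n. B (tr (int j - int n) y)) | n y. y \<in> X \<and> (\<forall>i\<ge>- int r. y i = x i)}"
    proof (rule bdd_belowI[of _ "-K"])
      fix t assume "t \<in> {(\<Sum>j<n. B (tr (int j - int n) y)) | n y. y \<in> X \<and> (\<forall>i\<ge>- int r. y i = x i)}"
      then obtain n y where "t = (\<Sum>j<n. B (tr (int j - int n) y))" "y \<in> X" by blast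
      with K[of y "- int n" n] show "- K \<le> t" by simp
    qed
  qed (use assms in auto)
qed

lemma V_ge:
  assumes "x \<in> X" "\<And>n y. y \<in> X \<Longrightarrow> (\<And>i. i \<ge> - int r \<Longrightarrow> y i = x i) \<Longrightarrow> c \<le> (\<Sum>j<n. B (tr (int j - int n) y))"
  shows "c \<le> V x"
  unfolding V_def by (rule cInf_greatest) (use assms in auto)

text \<open>Dynamic programming: a past that competes for \<open>V x\<close>, continued by position
  \<open>0\<close>, competes for \<open>V (tr 1 x)\<close>.\<close>

lemma V_step:
  assumes x: "x \<in> X"
  shows "V (tr 1 x) \<le> V x + B x"
proof -
  have "V (tr 1 x) - B x \<le> V x"
  proof (rule V_ge[OF x])
    fix n y assume y: "y \<in> X" "\<And>i. i \<ge> - int r \<Longrightarrow> y i = x i"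
    have "V (tr 1 x) \<le> (\<Sum>j<Suc n. B (tr (int j - int (Suc n)) (tr 1 y)))"
      using y by (intro V_le) (auto simp: tr_apply)
    also have "\<dots> = (\<Sum>j<n. B (tr (int j - int n) y)) + B y" by simp
    also have "B y = B x" by (rule B_local) (use y in auto)
    finally show "V (tr 1 x) - B x \<le> (\<Sum>j<n. B (tr (int j - int n) y))" by simp
  qed
  then show ?thesis by simp
qed

text \<open>A past \<open>z\<close> of \<open>x\<close> becomes a past \<open>w\<close> of
  \<open>y\<close> by keeping it to the left of \<open>- r\<close>. The last \<open>2 * r\<close>
  terms alone notice, each by at most \<open>e / (2 * r)\<close>. All centres are negative, so site
  \<open>r\<close> is not seen.\<close>

lemma V_uniform:
  assumes e: "e > 0"
  shows "\<exists>\<delta>>0. \<forall>x\<in>X. \<forall>y\<in>X. (\<forall>i\<in>{- int r..<int r}. \<bar>x i - y i\<bar> \<le> \<delta>) \<longrightarrow> \<bar>V x - V y\<bar> \<le> e"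
proof -
  obtain \<delta> where \<delta>: "\<delta> > 0"
    "\<And>x y. x \<in> X \<Longrightarrow> y \<in> X \<Longrightarrow> (\<And>i. i \<in> {- int r..int r} \<Longrightarrow> \<bar>x i - y i\<bar> \<le> \<delta>) \<Longrightarrow> \<bar>B x - B y\<bar> \<le> e / (2 * r)"
    using seq_cont_uniform[OF seq_cont_B, of "e / (2 * r)"] e r by auto
  have *: "V y - e \<le> V x" if x: "x \<in> X" and y: "y \<in> X" and xy: "\<forall>i\<in>{- int r..<int r}. \<bar>x i - y i\<bar> \<le> \<delta>" for x y
  proof (rule V_ge[OF x])
    fix n z assume z: "z \<in> X" "\<And>i. i \<ge> - int r \<Longrightarrow> z i = x i"
    define w where "w i = (if i < - int r then z i else y i)" for i
    have w: "w \<in> X" using y z by (auto simp: w_def box_def)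
    have "V y \<le> (\<Sum>j<n. B (tr (int j - int n) w))"
      using w by (intro V_le) (auto simp: w_def)
    moreover have "(\<Sum>j<n. B (tr (int j - int n) w) - B (tr (int j - int n) z)) \<le>
        (\<Sum>j<n. if n \<le> j + 2 * r then e / (2 * r) else 0)"
    proof (rule sum_mono)
      fix j assume j: "j \<in> {..<n}"
      show "B (tr (int j - int n) w) - B (tr (int j - int n) z) \<le> (if n \<le> j + 2 * r then e / (2 * r) else 0)"
      proof (cases "n \<le> j + 2 * r")
        case True
        have "\<bar>B (tr (int j - int n) w) - B (tr (int j - int n) z)\<bar> \<le> e / (2 * r)"
        proof (rule \<delta>(2))
          fix i assume "i \<in> {- int r..int r}"
          then show "\<bar>tr (int j - int n) w i - tr (int j - int n) z i\<bar> \<le> \<delta>"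
            using j \<delta>(1) z(2) xy
            by (auto simp: tr_apply w_def abs_minus_commute)
        qed (use w z in auto)
        then show ?thesis using True by simp
      next
        case False
        have "B (tr (int j - int n) w) = B (tr (int j - int n) z)"
          by (rule B_local) (use False in \<open>auto simp: tr_apply w_def\<close>)
        then show ?thesis using False by simp
      qed
    qed
    moreover have "(\<Sum>j<n. if n \<le> j + 2 * r then e / (2 * r) else 0) \<le> e"
    proof -
      have "(\<Sum>j<n. if n \<le> j + 2 * r then e / (2 * r) else 0) = real (card {j\<in>{..<n}. n \<le> j + 2 * r}) * (e / (2 * r))"
        by (subst sum.inter_filter[symmetric]) auto
      moreover have "card {j\<in>{..<n}. n \<le> j + 2 * r} \<le> card {n-2*r..<n}"
        by (rule card_mono) auto
      then have "real (card {j\<in>{..<n}. n \<le> j + 2 * r}) \<le> 2 * r" by simp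
      then have "real (card {j\<in>{..<n}. n \<le> j + 2 * r}) * (e / (2 * r)) \<le> (2 * r) * (e / (2 * r))"
        using e by (intro mult_right_mono) auto
      ultimately show ?thesis using r by simp
    qed
    ultimately show "V y - e \<le> (\<Sum>j<n. B (tr (int j - int n) z))" unfolding sum_subtractf by linarith
  qed
  show ?thesis
  proof (intro exI[of _ \<delta>] conjI ballI impI)
    fix x y assume "x \<in> X" "y \<in> X" "\<forall>i\<in>{- int r..<int r}. \<bar>x i - y i\<bar> \<le> \<delta>"
    then show "\<bar>V x - V y\<bar> \<le> e" using *[of x y] *[of y x] by (auto simp: abs_minus_commute)
  qed (rule \<delta>)
qed

lemma V_local:
  assumes "x \<in> X" "y \<in> X" "\<And>i. i \<in> {- int r..<int r} \<Longrightarrow> x i = y i"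
  shows "V x = V y"
proof -
  have "\<bar>V x - V y\<bar> \<le> 0 + e" if e: "e > 0" for e
  proof -
    obtain \<delta> where "\<delta> > 0" "\<forall>x\<in>X. \<forall>y\<in>X. (\<forall>i\<in>{- int r..<int r}. \<bar>x i - y i\<bar> \<le> \<delta>) \<longrightarrow> \<bar>V x - V y\<bar> \<le> e"
      using V_uniform[OF e] by blast
    then show ?thesis using assms by simp
  qed
  then have "\<bar>V x - V y\<bar> \<le> 0" by (rule field_le_epsilon)
  then show ?thesis by simp
qed

definition A :: "(int \<Rightarrow> real) \<Rightarrow> real" where
  "A x = h x + V x - V (tr 1 x)"

lemma g_le_A: "x \<in> X \<Longrightarrow> g x \<le> A x"
  using V_step[of x] by (simp add: A_def B_def)

lemma A_nonneg: "x \<in> X \<Longrightarrow> 0 \<le> A x"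
  using g_le_A[of x] g_nonneg[of x] by simp

lemma A_const: "A (\<lambda>_. c) = h (\<lambda>_. c)"
  by (simp add: A_def)

text \<open>\<open>V\<close> sees the sites from \<open>- r\<close> to \<open>r - 1\<close> and its
  translate those from \<open>- r + 1\<close> to \<open>r\<close>, so \<open>A\<close> keeps the
  window of \<open>h\<close>.\<close>

lemma A_local:
  assumes "x \<in> X" "y \<in> X" "\<And>i. i \<in> {- int r..int r} \<Longrightarrow> x i = y i"
  shows "A x = A y"
proof -
  have "V x = V y" "V (tr 1 x) = V (tr 1 y)"
    by (rule V_local; use assms in \<open>auto simp: tr_apply\<close>)+
  then show ?thesis using local[of x y] assms by (simp add: A_def)
qed

lemma seq_cont_V: 
  assumes f: "\<And>n. f n \<in> X" "l \<in> X" "\<And>i. i \<in> {- int r..<int r} \<Longrightarrow> (\<lambda>n. f n i) \<longlonglongrightarrow> l i"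
  shows "(\<lambda>n. V (f n)) \<longlonglongrightarrow> V l"
  unfolding tendsto_iff dist_real_def
proof (intro allI impI)
  fix e :: real assume e: "e > 0"
  obtain \<delta> where \<delta>: "\<delta> > 0" "\<And>x y. x \<in> X \<Longrightarrow> y \<in> X \<Longrightarrow> (\<forall>i\<in>{- int r..<int r}. \<bar>x i - y i\<bar> \<le> \<delta>) \<Longrightarrow> \<bar>V x - V y\<bar> \<le> e/2"
    using V_uniform[of "e/2"] e by auto
  have "\<forall>\<^sub>F n in sequentially. \<forall>i\<in>{- int r..<int r}. \<bar>f n i - l i\<bar> < \<delta>"
    using f(3) \<delta>(1) by (subst eventually_ball_finite_distrib) (auto simp: tendsto_iff dist_real_def)
  then show "\<forall>\<^sub>F n in sequentially. \<bar>V (f n) - V l\<bar> < e"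
  proof eventually_elim
    case (elim n)
    then have "\<bar>V (f n) - V l\<bar> \<le> e/2" using f by (intro \<delta>) (auto intro: less_imp_le)
    then show ?case using e by simp
  qed
qed

lemma seq_cont_A: "seq_cont r a b A"
  unfolding seq_cont_def
proof (intro allI impI)
  fix f l assume "\<forall>n. f n \<in> box a b" "l \<in> box a b" "\<forall>i\<in>{- int r..int r}. (\<lambda>n. f n i) \<longlonglongrightarrow> l i"
  then show "(\<lambda>n. A (f n)) \<longlonglongrightarrow> A l"
    unfolding A_def by (intro tendsto_diff tendsto_add seq_cont_V seq_contD[OF cont]) (auto simp: tr_apply box_def)
qed

end

subsection \<open>Energies of chains\<close>

lemma int_crossing:
  fixes i j :: int
  assumes "i < j" "Q i" "\<not> Q j"
  shows "\<exists>p. i \<le> p \<and> p < j \<and> Q p \<and> \<not> Q (p + 1)"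
proof (rule ccontr)
  assume neg: "\<not> ?thesis"
  have "p \<le> j \<longrightarrow> Q p" if "i \<le> p" for p
    using that
  proof (induction p rule: int_ge_induct)
    case (step p)
    then show ?case using neg by auto
  qed (use assms in auto)
  then show False using assms by auto
qed

lemma LIMSEQ_int_at_top:
  fixes f :: "int \<Rightarrow> 'a::topological_space"
  assumes "(\<lambda>n. f (int n)) \<longlonglongrightarrow> l"
  shows "(f \<longlongrightarrow> l) at_top"
proof -
  have "filterlim nat at_top at_top"
    unfolding filterlim_at_top
  proof
    fix N show "\<forall>\<^sub>F x in at_top. N \<le> nat x"
      using eventually_ge_at_top[of "int N"] by eventually_elim simp
  qed
  from filterlim_compose[OF assms this] have "((\<lambda>i. f (int (nat i))) \<longlongrightarrow> l) at_top" .
  then show ?thesis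
  proof (rule Lim_transform_eventually)
    show "\<forall>\<^sub>F i in at_top. f (int (nat i)) = f i"
      using eventually_ge_at_top[of 0] by eventually_elim simp
  qed
qed

lemma LIMSEQ_int_at_bot:
  fixes f :: "int \<Rightarrow> 'a::topological_space"
  assumes "(\<lambda>n. f (- int n)) \<longlonglongrightarrow> l"
  shows "(f \<longlongrightarrow> l) at_bot"
proof -
  have "filterlim uminus at_top (at_bot :: int filter)"
    unfolding filterlim_at_top
  proof
    fix N :: int show "\<forall>\<^sub>F x in at_bot. N \<le> - x"
      using eventually_le_at_bot[of "- N"] by eventually_elim simp
  qed
  from filterlim_compose[OF LIMSEQ_int_at_top[of "\<lambda>i. f (- i)", OF assms] this]
  show ?thesis by simp
qed

definition glue :: "int \<Rightarrow> (int \<Rightarrow> real) \<Rightarrow> (int \<Rightarrow> real) \<Rightarrow> int \<Rightarrow> real" where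
  "glue P x y = (\<lambda>i. if i < P then x i else y i)"

lemma glue_box [simp, intro]: "x \<in> box a b \<Longrightarrow> y \<in> box a b \<Longrightarrow> glue P x y \<in> box a b"
  by (auto simp: glue_def box_def)

context chain
begin

text \<open>An unordered sum of nonnegative terms always exists and splits over disjoint sets of
  positions. On \<open>X\<close> the cast to \<open>ennreal\<close> cuts nothing off.\<close>

definition E :: "int set \<Rightarrow> (int \<Rightarrow> real) \<Rightarrow> ennreal" where
  "E S x = (\<Sum>\<^sub>\<infinity>p\<in>S. ennreal (A (tr p x)))"

lemma E_Un: "S \<inter> S' = {} \<Longrightarrow> E (S \<union> S') x = E S x + E S' x"
  unfolding E_def by (rule infsum_Un_disjoint) (auto intro: nonneg_summable_on_complete)

lemma E_split: "E UNIV x = E {..<P} x + E {P..} x"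
proof -
  have "UNIV = {..<P} \<union> {P..}" by auto
  moreover have "{..<P} \<inter> {P..} = {}" by auto
  ultimately show ?thesis using E_Un[of "{..<P}" "{P..}" x] by simp
qed

lemma E_mono: "S \<subseteq> S' \<Longrightarrow> E S x \<le> E S' x"
  unfolding E_def by (rule infsum_mono_neutral) (auto intro: nonneg_summable_on_complete)

lemma E_cong: "(\<And>p. p \<in> S \<Longrightarrow> A (tr p x) = A (tr p y)) \<Longrightarrow> E S x = E S y"
  unfolding E_def by (rule infsum_cong) simp

lemma E_finite: "finite S \<Longrightarrow> x \<in> X \<Longrightarrow> E S x = ennreal (\<Sum>p\<in>S. A (tr p x))"
  unfolding E_def by (subst sum_ennreal[symmetric]) (auto intro!: A_nonneg)

lemma E_tr: "E UNIV (tr p x) = E UNIV x"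
proof -
  have "E UNIV (tr p x) = (\<Sum>\<^sub>\<infinity>q\<in>UNIV. ennreal (A (tr (q + p) x)))"
    by (simp add: E_def)
  also have "\<dots> = E UNIV x" unfolding E_def
    by (rule infsum_reindex_bij_betw[where g = "\<lambda>q. q + p"])
       (auto intro!: bij_betwI[where g = "\<lambda>q. q - p"])
  finally show ?thesis .
qed

lemma E_leI:
  assumes "x \<in> X" "\<And>F. finite F \<Longrightarrow> F \<subseteq> S \<Longrightarrow> (\<Sum>p\<in>F. A (tr p x)) \<le> C"
  shows "E S x \<le> ennreal C"
proof -
  have "E S x = (SUP F\<in>{F. finite F \<and> F \<subseteq> S}. \<Sum>p\<in>F. ennreal (A (tr p x)))"
    unfolding E_def by (rule nonneg_infsum_complete) simp
  also have "\<dots> \<le> ennreal C"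
  proof (rule SUP_least)
    fix F assume "F \<in> {F. finite F \<and> F \<subseteq> S}"
    then show "(\<Sum>p\<in>F. ennreal (A (tr p x))) \<le> ennreal C"
      using assms by (subst sum_ennreal) (auto intro!: A_nonneg ennreal_leI)
  qed
  finally show ?thesis .
qed

lemma sum_A_le_E: "finite F \<Longrightarrow> F \<subseteq> S \<Longrightarrow> x \<in> X \<Longrightarrow> ennreal (\<Sum>p\<in>F. A (tr p x)) \<le> E S x"
  using E_finite[of F x] E_mono[of F S x] by simp

lemma sum_g_le_E:
  assumes "finite F" "F \<subseteq> S" "x \<in> X"
  shows "ennreal (\<Sum>p\<in>F. g (tr p x)) \<le> E S x"
  using sum_mono[of F "\<lambda>p. g (tr p x)" "\<lambda>p. A (tr p x)"] g_le_A assms sum_A_le_E[OF assms]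
  by (meson ennreal_leI order_trans tr_box)

text \<open>Finite partial sums are continuous, and \<open>E\<close> is their supremum.\<close>

lemma E_lsc:
  assumes f: "\<And>n. f n \<in> X" "l \<in> X" "\<And>i. (\<lambda>n. f n i) \<longlonglongrightarrow> l i"
    and c: "\<And>n. E S (f n) \<le> ennreal (c n)" "\<And>n. 0 \<le> c n" "c \<longlonglongrightarrow> C"
  shows "E S l \<le> ennreal C"
proof (rule E_leI[OF f(2)])
  fix F assume F: "finite F" "F \<subseteq> S"
  have "(\<lambda>n. \<Sum>p\<in>F. A (tr p (f n))) \<longlonglongrightarrow> (\<Sum>p\<in>F. A (tr p l))"
    by (intro tendsto_sum seq_contD[OF seq_cont_A]) (use f in \<open>auto simp: tr_apply\<close>)
  moreover have "(\<Sum>p\<in>F. A (tr p (f n))) \<le> c n" for n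
  proof -
    have "ennreal (\<Sum>p\<in>F. A (tr p (f n))) \<le> ennreal (c n)"
      using order_trans[OF sum_A_le_E[OF F f(1)] c(1)] .
    then show ?thesis using c(2)[of n] by simp
  qed
  ultimately show "(\<Sum>p\<in>F. A (tr p l)) \<le> C"
    using LIMSEQ_le[OF _ c(3)] by blast
qed

text \<open>The potential \<open>h (\<lambda>_. c)\<close> has a positive minimum on the compact
  interval that stays \<open>\<delta>\<close> away from both wells.\<close>

lemma phi_gap:
  assumes "\<delta> > 0"
  shows "\<exists>\<eta>>0. \<forall>c. a \<le> c \<longrightarrow> c \<le> b \<longrightarrow> h (\<lambda>_. c) < \<eta> \<longrightarrow> c < a + \<delta> \<or> b - \<delta> < c"
proof (cases "a + \<delta> \<le> b - \<delta>")
  case True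
  have "continuous_on {a + \<delta>..b - \<delta>} (\<lambda>c. h (\<lambda>_. c))"
    unfolding continuous_on_sequentially comp_def
  proof (intro allI ballI impI)
    fix f c assume c: "c \<in> {a + \<delta>..b - \<delta>}" and f: "(\<forall>n. f n \<in> {a + \<delta>..b - \<delta>}) \<and> f \<longlonglongrightarrow> c"
    have "a \<le> f n \<and> f n \<le> b" for n using f assms by (smt (verit) atLeastAtMost_iff)
    moreover have "a \<le> c \<and> c \<le> b" using c assms by auto
    ultimately show "(\<lambda>n. h (\<lambda>_. f n)) \<longlonglongrightarrow> h (\<lambda>_. c)"
      using f by (intro seq_contD[OF cont]) auto
  qed
  then obtain c where c: "c \<in> {a + \<delta>..b - \<delta>}" "\<forall>d\<in>{a + \<delta>..b - \<delta>}. h (\<lambda>_. c) \<le> h (\<lambda>_. d)"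
    using continuous_attains_inf[of "{a + \<delta>..b - \<delta>}" "\<lambda>c. h (\<lambda>_. c)"] True by auto
  have "0 < h (\<lambda>_. c)" using c(1) assms by (intro h_pos) auto
  moreover have "d < a + \<delta> \<or> b - \<delta> < d" if "h (\<lambda>_. d) < h (\<lambda>_. c)" for d
    using c(2) that by (meson atLeastAtMost_iff not_le)
  ultimately show ?thesis by blast
next
  case False
  then show ?thesis by (intro exI[of _ 1]) auto
qed

text \<open>A vanishing potential forces the values close to the wells, and vanishing increments
  rule out further jumps between the wells.\<close>

lemma well_dichotomy:
  fixes f :: "nat \<Rightarrow> real"
  assumes f: "\<And>n. a \<le> f n \<and> f n \<le> b"
    and phi: "(\<lambda>n. h (\<lambda>_. f n)) \<longlonglongrightarrow> 0" and inc: "(\<lambda>n. f (Suc n) - f n) \<longlonglongrightarrow> 0"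
  shows "f \<longlonglongrightarrow> a \<or> f \<longlonglongrightarrow> b"
proof -
  have wells: "\<forall>\<^sub>F n in sequentially. f n < a + \<delta> \<or> b - \<delta> < f n" if "\<delta> > 0" for \<delta>
  proof -
    obtain \<eta> where \<eta>: "\<eta> > 0" "\<And>c. a \<le> c \<Longrightarrow> c \<le> b \<Longrightarrow> h (\<lambda>_. c) < \<eta> \<Longrightarrow> c < a + \<delta> \<or> b - \<delta> < c"
      using phi_gap[OF \<open>\<delta> > 0\<close>] by blast
    have "\<forall>\<^sub>F n in sequentially. h (\<lambda>_. f n) < \<eta>"
      using phi \<eta>(1) by (rule order_tendstoD(2))
    then show ?thesis by (rule eventually_mono) (use f \<eta>(2) in blast)
  qed
  \<comment> \<open>With thirds, the \<open>\<delta>\<close>-neighbourhoods of the two wells are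
    \<open>\<delta>\<close> apart.\<close>
  define \<delta> where "\<delta> = (b - a) / 3"
  have \<delta>: "\<delta> > 0" using ab by (simp add: \<delta>_def)
  have "\<forall>\<^sub>F n in sequentially. \<bar>f (Suc n) - f n\<bar> < \<delta>"
    using tendstoD[OF inc \<delta>] by (simp add: dist_real_def)
  with wells[OF \<delta>] have "\<forall>\<^sub>F n in sequentially. (f n < a + \<delta> \<or> b - \<delta> < f n) \<and> \<bar>f (Suc n) - f n\<bar> < \<delta>"
    by (rule eventually_conj)
  then obtain N where N: "\<And>n. n \<ge> N \<Longrightarrow> (f n < a + \<delta> \<or> b - \<delta> < f n) \<and> \<bar>f (Suc n) - f n\<bar> < \<delta>"
    unfolding eventually_sequentially by blast
  show ?thesis
  proof (cases "f N < a + \<delta>")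
    case True
    have near: "f n < a + \<delta>" if "N \<le> n" for n
      using that
    proof (induction n rule: dec_induct)
      case (step n)
      then show ?case using N[of n] N[of "Suc n"] ab by (auto simp: \<delta>_def field_simps)
    qed (rule True)
    have "f \<longlonglongrightarrow> a"
    proof (rule tendstoI)
      fix e :: real assume "e > 0"
      then have "\<forall>\<^sub>F n in sequentially. f n < a + min e \<delta> \<or> b - min e \<delta> < f n" using \<delta> by (intro wells) auto
      with eventually_ge_at_top[of N] show "\<forall>\<^sub>F n in sequentially. dist (f n) a < e"
      proof eventually_elim
        case (elim n)
        then show ?case using near[of n] f[of n] ab by (auto simp: dist_real_def \<delta>_def field_simps)
      qed
    qed
    then show ?thesis ..
  next
    case False
    have near: "b - \<delta> < f n" if "N \<le> n" for n
      using that
    proof (induction n rule: dec_induct)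
      case base then show ?case using False N[of N] by auto
    next
      case (step n)
      then show ?case using N[of n] N[of "Suc n"] ab by (auto simp: \<delta>_def field_simps)
    qed
    have "f \<longlonglongrightarrow> b"
    proof (rule tendstoI)
      fix e :: real assume "e > 0"
      then have "\<forall>\<^sub>F n in sequentially. f n < a + min e \<delta> \<or> b - min e \<delta> < f n" using \<delta> by (intro wells) auto
      with eventually_ge_at_top[of N] show "\<forall>\<^sub>F n in sequentially. dist (f n) b < e"
      proof eventually_elim
        case (elim n)
        then show ?case using near[of n] f[of n] ab by (auto simp: dist_real_def \<delta>_def field_simps)
      qed
    qed
    then show ?thesis ..
  qed
qed

section \<open>Limits of chains of finite energy\<close>

lemma g_parts: "h (\<lambda>_. x p) \<le> g (tr p x)" "\<epsilon> * (x (p + 1) - x p)\<^sup>2 \<le> g (tr p x)"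
  using h_nonneg eps by (auto simp: g_def tr_apply)

lemma g_tendsto_0:
  fixes q :: "nat \<Rightarrow> int"
  assumes x: "x \<in> X" and fin: "E UNIV x < \<infinity>" and q: "inj q"
  shows "(\<lambda>n. g (tr (q n) x)) \<longlonglongrightarrow> 0"
proof -
  obtain C where C: "E UNIV x = ennreal C" "0 \<le> C"
    using fin by (cases "E UNIV x") auto
  have "(\<Sum>i<n. g (tr (q i) x)) \<le> C" for n
  proof -
    have "ennreal (\<Sum>p\<in>q ` {..<n}. g (tr p x)) \<le> ennreal C"
      using sum_g_le_E[of "q ` {..<n}" UNIV x] x C by simp
    then show ?thesis using C q
      by (simp add: sum.reindex inj_on_subset[OF q])
  qed
  then have "summable (\<lambda>n. g (tr (q n) x))"
    by (intro summableI_nonneg_bounded g_nonneg)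
  then show ?thesis by (rule summable_LIMSEQ_zero)
qed

lemma increment_tendsto_0:
  fixes q :: "nat \<Rightarrow> int"
  assumes "x \<in> X" "E UNIV x < \<infinity>" "inj q"
  shows "(\<lambda>n. x (q n + 1) - x (q n)) \<longlonglongrightarrow> 0"
proof -
  have "(\<lambda>n. g (tr (q n) x) / \<epsilon>) \<longlonglongrightarrow> 0"
    using tendsto_divide[OF g_tendsto_0[OF assms] tendsto_const, of \<epsilon>] eps by simp
  then have "(\<lambda>n. (x (q n + 1) - x (q n))\<^sup>2) \<longlonglongrightarrow> 0"
    by (rule tendsto_sandwich[rotated 3, where f = "\<lambda>_. 0"])
       (use eps g_parts(2)[of x "q _"] in \<open>auto simp: field_simps\<close>)
  from tendsto_real_sqrt[OF this] have "(\<lambda>n. \<bar>x (q n + 1) - x (q n)\<bar>) \<longlonglongrightarrow> 0" by simp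
  then show ?thesis by (rule tendsto_rabs_zero_cancel)
qed

lemma potential_tendsto_0:
  fixes q :: "nat \<Rightarrow> int"
  assumes "x \<in> X" "E UNIV x < \<infinity>" "inj q"
  shows "(\<lambda>n. h (\<lambda>_. x (q n))) \<longlonglongrightarrow> 0"
  by (rule tendsto_sandwich[OF _ _ tendsto_const g_tendsto_0[OF assms]])
     (auto simp: h_nonneg g_parts)

lemma finite_energy_limits:
  assumes x: "x \<in> X" and fin: "E UNIV x < \<infinity>"
  shows "((x \<longlongrightarrow> a) at_top \<or> (x \<longlongrightarrow> b) at_top) \<and> ((x \<longlongrightarrow> a) at_bot \<or> (x \<longlongrightarrow> b) at_bot)"
proof
  have "(\<lambda>n. x (int n)) \<longlonglongrightarrow> a \<or> (\<lambda>n. x (int n)) \<longlonglongrightarrow> b"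
  proof (rule well_dichotomy)
    show "(\<lambda>n. h (\<lambda>_. x (int n))) \<longlonglongrightarrow> 0"
      by (rule potential_tendsto_0[OF x fin]) (auto simp: inj_on_def)
    show "(\<lambda>n. x (int (Suc n)) - x (int n)) \<longlonglongrightarrow> 0"
      using increment_tendsto_0[OF x fin, of int] by (simp add: inj_on_def add.commute)
  qed (use x in \<open>auto simp: box_def\<close>)
  then show "(x \<longlongrightarrow> a) at_top \<or> (x \<longlongrightarrow> b) at_top" using LIMSEQ_int_at_top by blast
  have "(\<lambda>n. x (- int n)) \<longlonglongrightarrow> a \<or> (\<lambda>n. x (- int n)) \<longlonglongrightarrow> b"
  proof (rule well_dichotomy)
    show "(\<lambda>n. h (\<lambda>_. x (- int n))) \<longlonglongrightarrow> 0"
      by (rule potential_tendsto_0[OF x fin]) (auto simp: inj_on_def)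
    have "(\<lambda>n. x ((- int n - 1) + 1) - x (- int n - 1)) \<longlonglongrightarrow> 0"
      by (rule increment_tendsto_0[OF x fin]) (auto simp: inj_on_def)
    from tendsto_minus[OF this] show "(\<lambda>n. x (- int (Suc n)) - x (- int n)) \<longlonglongrightarrow> 0"
      by (simp add: minus_diff_commute)
  qed (use x in \<open>auto simp: box_def\<close>)
  then show "(x \<longlongrightarrow> a) at_bot \<or> (x \<longlongrightarrow> b) at_bot" using LIMSEQ_int_at_bot by blast
qed

section \<open>The cost of leaving a well, and blocks of sites near the wells\<close>

definition excursion :: "real \<Rightarrow> real \<Rightarrow> real \<Rightarrow> bool" where
  "excursion \<sigma> \<rho> \<gamma> \<longleftrightarrow> (\<forall>x\<in>X. \<forall>i j. \<bar>x i - \<sigma>\<bar> < \<rho> / 2 \<longrightarrow> \<rho> \<le> \<bar>x j - \<sigma>\<bar> \<longrightarrow>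
    \<gamma> \<le> (\<Sum>p = min i j..max i j. g (tr p x)))"

lemma excursion_mono: "excursion \<sigma> \<rho> \<gamma> \<Longrightarrow> \<gamma>' \<le> \<gamma> \<Longrightarrow> excursion \<sigma> \<rho> \<gamma>'"
  unfolding excursion_def by (blast intro: order_trans)

text \<open>On the way some step crosses the distance \<open>\<rho> / 2\<close>. Either it lands at
  distance at most \<open>3 * \<rho> / 4\<close>, hence more than \<open>\<rho> / 4\<close> away
  from both wells, and the potential is at least \<open>\<eta>\<close>; or it has length at least
  \<open>\<rho> / 4\<close> and the quadratic term pays.\<close>

lemma ex_excursion:
  assumes \<sigma>: "\<sigma> = a \<or> \<sigma> = b" and \<rho>: "0 < \<rho>" "\<rho> < b - a"
  shows "\<exists>\<gamma>>0. excursion \<sigma> \<rho> \<gamma>"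
proof -
  obtain \<eta> where \<eta>: "\<eta> > 0" "\<And>c. a \<le> c \<Longrightarrow> c \<le> b \<Longrightarrow> h (\<lambda>_. c) < \<eta> \<Longrightarrow> c < a + \<rho>/4 \<or> b - \<rho>/4 < c"
    using phi_gap[of "\<rho>/4"] \<rho> by auto
  define \<gamma> where "\<gamma> = min \<eta> (\<epsilon> * (\<rho> / 4)\<^sup>2)"
  have "\<gamma> \<le> (\<Sum>p = min i j..max i j. g (tr p x))"
    if x: "x \<in> X" and i: "\<bar>x i - \<sigma>\<bar> < \<rho> / 2" and j: "\<rho> \<le> \<bar>x j - \<sigma>\<bar>" for x i j
  proof -
    have xb: "a \<le> x p" "x p \<le> b" for p using x by (auto simp: box_def)
    have sum: "g (tr p x) \<le> (\<Sum>p = min i j..max i j. g (tr p x))" if "p \<in> {min i j..max i j}" for p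
      using that by (intro member_le_sum) (auto simp: g_nonneg)
    have "i \<noteq> j" using i j \<rho> by auto
    have "\<exists>p q q'. p \<in> {min i j..max i j} \<and> p + 1 \<in> {min i j..max i j} \<and> {q, q'} = {p, p + 1} \<and>
        \<bar>x q - \<sigma>\<bar> < \<rho> / 2 \<and> \<rho> / 2 \<le> \<bar>x q' - \<sigma>\<bar>"
    proof (cases "i < j")
      case True
      from int_crossing[OF this, of "\<lambda>p. \<bar>x p - \<sigma>\<bar> < \<rho> / 2"] i j \<rho>
      obtain p where p: "i \<le> p" "p < j" "\<bar>x p - \<sigma>\<bar> < \<rho> / 2" "\<rho> / 2 \<le> \<bar>x (p + 1) - \<sigma>\<bar>"
        by (auto simp: not_less)
      show ?thesis
        by (rule exI[of _ p], rule exI[of _ p], rule exI[of _ "p + 1"]) (use True p in auto)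
    next
      case False
      with \<open>i \<noteq> j\<close> have ji: "j < i" by simp
      from int_crossing[OF this, of "\<lambda>p. \<rho> / 2 \<le> \<bar>x p - \<sigma>\<bar>"] i j \<rho>
      obtain p where p: "j \<le> p" "p < i" "\<rho> / 2 \<le> \<bar>x p - \<sigma>\<bar>" "\<bar>x (p + 1) - \<sigma>\<bar> < \<rho> / 2"
        by (auto simp: not_le)
      show ?thesis
        by (rule exI[of _ p], rule exI[of _ "p + 1"], rule exI[of _ p]) (use ji p in auto)
    qed
    then obtain p q q' where p: "p \<in> {min i j..max i j}" "p + 1 \<in> {min i j..max i j}"
      and q: "{q, q'} = {p, p + 1}" "\<bar>x q - \<sigma>\<bar> < \<rho> / 2" "\<rho> / 2 \<le> \<bar>x q' - \<sigma>\<bar>" by blast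
    show ?thesis
    proof (cases "\<bar>x q' - \<sigma>\<bar> \<le> 3 * \<rho> / 4")
      case True
      have "\<not> h (\<lambda>_. x q') < \<eta>"
        using \<eta>(2)[OF xb[of q']] True q(3) \<sigma> \<rho> xb[of q'] by auto
      then have "\<gamma> \<le> g (tr q' x)" using g_parts(1)[of x q'] by (simp add: \<gamma>_def)
      also have "q' \<in> {min i j..max i j}" using q(1) p by (auto simp: doubleton_eq_iff)
      note sum[OF this]
      finally show ?thesis .
    next
      case False
      have "\<rho> / 4 \<le> \<bar>x q' - x q\<bar>"
        using q(2) False by linarith
      then have "\<rho> / 4 \<le> \<bar>x (p + 1) - x p\<bar>"
        using q(1) by (auto simp: doubleton_eq_iff abs_minus_commute)
      then have "(\<rho> / 4)\<^sup>2 \<le> (x (p + 1) - x p)\<^sup>2"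
        using \<rho> by (metis abs_le_square_iff abs_of_pos divide_pos_pos zero_less_numeral)
      then have "\<epsilon> * (\<rho> / 4)\<^sup>2 \<le> \<epsilon> * (x (p + 1) - x p)\<^sup>2" using eps by simp
      then have "\<gamma> \<le> g (tr p x)" using g_parts(2)[of x p] by (simp add: \<gamma>_def)
      also note sum[OF p(1)]
      finally show ?thesis .
    qed
  qed
  moreover have "\<gamma> > 0" using \<eta> eps \<rho> by (simp add: \<gamma>_def)
  ultimately show ?thesis unfolding excursion_def by blast
qed

text \<open>A block of \<open>4 * r + 1\<close> sites leaves room for a cut at its centre. Its sites
  may a priori be close to different wells; \<open>block_near\<close> later uses the constraints to
  decide between them.\<close>

definition blocks :: "real \<Rightarrow> real \<Rightarrow> nat \<Rightarrow> bool" where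
  "blocks C \<delta> l \<longleftrightarrow> (\<forall>x\<in>X. E UNIV x \<le> ennreal C \<longrightarrow> (\<forall>i. \<exists>P. i + 2 * int r \<le> P \<and> P + 2 * int r < i + int l \<and>
    (\<forall>p\<in>{P - 2 * int r..P + 2 * int r}. x p < a + \<delta> \<or> b - \<delta> < x p)))"

text \<open>Pigeonhole: cut the window into \<open>M\<close> groups of \<open>4 * r + 1\<close>
  sites. If no group were a block, each would contain a site with potential at least
  \<open>\<eta>\<close>, and the energy would exceed \<open>C\<close>.\<close>

lemma ex_blocks:
  assumes \<delta>: "\<delta> > 0"
  shows "\<exists>l. blocks C \<delta> l"
proof -
  obtain \<eta> where \<eta>: "\<eta> > 0" "\<And>c. a \<le> c \<Longrightarrow> c \<le> b \<Longrightarrow> h (\<lambda>_. c) < \<eta> \<Longrightarrow> c < a + \<delta> \<or> b - \<delta> < c"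
    using phi_gap[OF \<delta>] by blast
  \<comment> \<open>The maximum with \<open>0\<close> matches the cast, since
    \<open>ennreal C\<close> is \<open>0\<close> for negative \<open>C\<close>.\<close>
  obtain M :: nat where M: "M * \<eta> > max C 0" using ex_less_of_nat_mult[OF \<eta>(1)] by blast
  define w where "w = 4 * int r + 1"
  have w: "w > 0" by (simp add: w_def)
  show ?thesis
    unfolding blocks_def
  proof (rule exI[of _ "nat (int M * w)"], intro ballI impI allI, rule ccontr)
    fix x and i :: int
    assume x: "x \<in> X" and Ex: "E UNIV x \<le> ennreal C"
      and neg: "\<not> (\<exists>P. i + 2 * int r \<le> P \<and> P + 2 * int r < i + int (nat (int M * w)) \<and>
        (\<forall>p\<in>{P - 2 * int r..P + 2 * int r}. x p < a + \<delta> \<or> b - \<delta> < x p))"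
    have "\<exists>p. i + int n * w \<le> p \<and> p < i + int n * w + w \<and> \<eta> \<le> h (\<lambda>_. x p)" if n: "n < M" for n
    proof -
      define P where "P = i + int n * w + 2 * int r"
      have "int n * w + w \<le> int M * w"
        using n w mult_right_mono[of "int n + 1" "int M" w] by (simp add: algebra_simps)
      moreover have "0 \<le> int n * w" using w by simp
      ultimately have "i + 2 * int r \<le> P" "P + 2 * int r < i + int (nat (int M * w))"
        using w by (auto simp: P_def w_def)
      with neg obtain p where p: "p \<in> {P - 2 * int r..P + 2 * int r}" "\<not> (x p < a + \<delta> \<or> b - \<delta> < x p)"
        by blast
      then have "\<eta> \<le> h (\<lambda>_. x p)" using \<eta>(2)[of "x p"] x by (auto simp: box_def not_less[symmetric])
      then show ?thesis using p(1) by (intro exI[of _ p]) (auto simp: P_def w_def)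
    qed
    then obtain p where p: "\<And>n. n < M \<Longrightarrow> i + int n * w \<le> p n \<and> p n < i + int n * w + w \<and> \<eta> \<le> h (\<lambda>_. x (p n))"
      by metis
    \<comment> \<open>The chosen site determines its group, so the chosen sites are distinct and
      their terms may be added.\<close>
    have "int n = (p n - i) div w" if "n < M" for n
    proof -
      have "p n - i = (p n - i - int n * w) + int n * w" by simp
      moreover have "(p n - i - int n * w) div w = 0" using p[OF that] by (intro div_pos_pos_trivial) auto
      ultimately show ?thesis using w div_mult_self1[of w "p n - i - int n * w" "int n"] by simp
    qed
    then have inj: "inj_on p {..<M}" by (metis inj_onI lessThan_iff of_nat_eq_iff)
    have "real M * \<eta> \<le> (\<Sum>n<M. g (tr (p n) x))"
    proof -
      have "(\<Sum>n<M. \<eta>) \<le> (\<Sum>n<M. g (tr (p n) x))"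
        by (rule sum_mono) (use p g_parts(1)[of x] order_trans in blast)
      then show ?thesis by simp
    qed
    also have "\<dots> = (\<Sum>q\<in>p ` {..<M}. g (tr q x))" using inj by (simp add: sum.reindex)
    finally have "ennreal (real M * \<eta>) \<le> ennreal (\<Sum>q\<in>p ` {..<M}. g (tr q x))" by (rule ennreal_leI)
    also have "\<dots> \<le> E UNIV x" using x by (intro sum_g_le_E) auto
    also note Ex
    also have "ennreal C \<le> ennreal (max C 0)" by (simp add: ennreal_leI)
    finally show False using M by simp
  qed
qed

text \<open>The radius is \<open>2 * r\<close> because a gluing at \<open>P\<close> affects terms
  centred within \<open>r\<close> of \<open>P\<close>, and their windows reach \<open>r\<close>
  further.\<close>

definition near :: "real \<Rightarrow> real \<Rightarrow> int \<Rightarrow> (int \<Rightarrow> real) \<Rightarrow> bool" where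
  "near \<delta> \<sigma> P x \<longleftrightarrow> (\<forall>i\<in>{P - 2 * int r..P + 2 * int r}. \<bar>x i - \<sigma>\<bar> \<le> \<delta>)"

definition flat :: "real \<Rightarrow> real \<Rightarrow> bool" where
  "flat \<kappa> \<delta> \<longleftrightarrow> (\<forall>x\<in>X. \<forall>\<sigma>\<in>{a, b}. (\<forall>i\<in>{- int r..int r}. \<bar>x i - \<sigma>\<bar> \<le> \<delta>) \<longrightarrow> A x \<le> \<kappa>)"

lemma flat_mono: "flat \<kappa> \<delta> \<Longrightarrow> \<delta>' \<le> \<delta> \<Longrightarrow> flat \<kappa> \<delta>'"
  unfolding flat_def by (meson order_trans)

lemma ex_flat:
  assumes "\<kappa> > 0"
  shows "\<exists>\<delta>>0. flat \<kappa> \<delta>"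
proof -
  obtain \<delta> where \<delta>: "\<delta> > 0"
    "\<forall>x\<in>X. \<forall>y\<in>X. (\<forall>i\<in>{- int r..int r}. \<bar>x i - y i\<bar> \<le> \<delta>) \<longrightarrow> \<bar>A x - A y\<bar> \<le> \<kappa>"
    using seq_cont_uniform[OF seq_cont_A assms] by blast
  have "flat \<kappa> \<delta>"
    unfolding flat_def
  proof (intro ballI impI)
    fix x \<sigma> assume "x \<in> X" "\<sigma> \<in> {a, b}" "\<forall>i\<in>{- int r..int r}. \<bar>x i - \<sigma>\<bar> \<le> \<delta>"
    then have "\<bar>A x - A (\<lambda>_. \<sigma>)\<bar> \<le> \<kappa>" using ab by (intro \<delta>(2)[rule_format]) auto
    moreover have "A (\<lambda>_. \<sigma>) = 0" using \<open>\<sigma> \<in> {a, b}\<close> h_a h_b by (auto simp: A_const)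
    ultimately show "A x \<le> \<kappa>" by simp
  qed
  with \<delta>(1) show ?thesis by blast
qed

section \<open>Cutting and gluing at blocks\<close>

lemma near_glue: "near \<delta> \<sigma> P x \<Longrightarrow> near \<delta> \<sigma> P y \<Longrightarrow> near \<delta> \<sigma> P (glue Q x y)"
  by (auto simp: near_def glue_def)

lemma near_glue_left: "P + 2 * int r < Q \<Longrightarrow> near \<delta> \<sigma> P (glue Q x y) \<longleftrightarrow> near \<delta> \<sigma> P x"
  by (auto simp: near_def glue_def)

lemma near_const [simp]: "0 \<le> \<delta> \<Longrightarrow> near \<delta> \<sigma> P (\<lambda>_. \<sigma>)"
  by (auto simp: near_def)

text \<open>Terms left of \<open>P - r\<close> see \<open>x\<close> alone and terms from
  \<open>P + r\<close> on see \<open>y\<close> alone. The \<open>2 * r\<close> terms in between have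
  windows close to the well \<open>\<sigma>\<close>, where \<open>flat\<close> bounds them by
  \<open>\<kappa>\<close>.\<close>

lemma E_glue:
  assumes fl: "flat \<kappa> \<delta>" and \<kappa>: "0 \<le> \<kappa>" and \<sigma>: "\<sigma> \<in> {a, b}" and xy: "x \<in> X" "y \<in> X"
    and near: "near \<delta> \<sigma> P x" "near \<delta> \<sigma> P y"
  shows "E S (glue P x y) \<le> E (S \<inter> {..<P}) x + E (S \<inter> {P..}) y + ennreal (2 * real r * \<kappa>)"
proof -
  let ?z = "glue P x y"
  have z: "?z \<in> X" using xy by auto
  let ?L = "S \<inter> {..<P - int r}" and ?M = "S \<inter> {P - int r..<P + int r}" and ?R = "S \<inter> {P + int r..}"
  have "S = ?L \<union> (?M \<union> ?R)" by auto
  then have "E S ?z = E (?L \<union> (?M \<union> ?R)) ?z" by simp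
  also have "\<dots> = E ?L ?z + (E ?M ?z + E ?R ?z)" by (subst E_Un E_Un; (subst E_Un)?) auto
  also have "E ?L ?z = E ?L x"
    by (rule E_cong, rule A_local) (use xy z in \<open>auto simp: tr_apply glue_def\<close>)
  also have "E ?R ?z = E ?R y"
    by (rule E_cong, rule A_local) (use xy z in \<open>auto simp: tr_apply glue_def\<close>)
  also have "E ?M ?z \<le> ennreal (2 * real r * \<kappa>)"
  proof (rule E_leI[OF z])
    fix F assume F: "finite F" "F \<subseteq> ?M"
    have "(\<Sum>p\<in>F. A (tr p ?z)) \<le> (\<Sum>p\<in>F. \<kappa>)"
    proof (rule sum_mono)
      fix p assume "p \<in> F"
      then have "p \<in> {P - int r..<P + int r}" using F by auto
      then have "\<forall>i\<in>{- int r..int r}. \<bar>tr p ?z i - \<sigma>\<bar> \<le> \<delta>"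
        using near by (auto simp: tr_apply glue_def near_def)
      then show "A (tr p ?z) \<le> \<kappa>" using fl z \<sigma> unfolding flat_def by blast
    qed
    also have "\<dots> = real (card F) * \<kappa>" by simp
    also have "card F \<le> card {P - int r..<P + int r}" using F by (intro card_mono) auto
    then have "real (card F) * \<kappa> \<le> 2 * real r * \<kappa>" using \<kappa> by (intro mult_right_mono) auto
    finally show "(\<Sum>p\<in>F. A (tr p ?z)) \<le> 2 * real r * \<kappa>" .
  qed
  also have "E ?L x \<le> E (S \<inter> {..<P}) x" by (rule E_mono) auto
  also have "E ?R y \<le> E (S \<inter> {P..}) y" by (rule E_mono) auto
  finally show ?thesis by (simp add: ac_simps add_left_mono add_mono)
qed

lemma E_const: "\<sigma> \<in> {a, b} \<Longrightarrow> E S (\<lambda>_. \<sigma>) = 0"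
  using h_a h_b by (auto simp: E_def A_const)

lemma ex_near_at_bot:
  assumes "(x \<longlongrightarrow> \<sigma>) at_bot" "\<delta> > 0"
  shows "\<exists>P. P + 2 * int r < i \<and> near \<delta> \<sigma> P x"
proof -
  have "\<forall>\<^sub>F p in at_bot. \<bar>x p - \<sigma>\<bar> < \<delta>" using tendstoD[OF assms] by (simp add: dist_real_def)
  then obtain N where "\<And>p. p \<le> N \<Longrightarrow> \<bar>x p - \<sigma>\<bar> < \<delta>" by (auto simp: eventually_at_bot_linorder)
  then show ?thesis
    by (intro exI[of _ "min N (i - 1) - 2 * int r"]) (auto simp: near_def intro!: less_imp_le)
qed

lemma ex_near_at_top:
  assumes "(x \<longlongrightarrow> \<sigma>) at_top" "\<delta> > 0"
  shows "\<exists>P. i < P - 2 * int r \<and> near \<delta> \<sigma> P x"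
proof -
  have "\<forall>\<^sub>F p in at_top. \<bar>x p - \<sigma>\<bar> < \<delta>" using tendstoD[OF assms] by (simp add: dist_real_def)
  then obtain N where "\<And>p. p \<ge> N \<Longrightarrow> \<bar>x p - \<sigma>\<bar> < \<delta>" by (auto simp: eventually_at_top_linorder)
  then show ?thesis
    by (intro exI[of _ "max N (i + 1) + 2 * int r"]) (auto simp: near_def intro!: less_imp_le)
qed

end

subsection \<open>Heteroclinic chains\<close>

lemma glue_tendsto_at_bot: "(x \<longlongrightarrow> \<sigma>) at_bot \<Longrightarrow> (glue P x y \<longlongrightarrow> \<sigma>) at_bot"
proof (erule Lim_transform_eventually)
  show "\<forall>\<^sub>F i in at_bot. x i = glue P x y i"
    using eventually_le_at_bot[of "P - 1"] by eventually_elim (simp add: glue_def)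
qed

lemma glue_tendsto_at_top: "(y \<longlongrightarrow> \<sigma>) at_top \<Longrightarrow> (glue P x y \<longlongrightarrow> \<sigma>) at_top"
proof (erule Lim_transform_eventually)
  show "\<forall>\<^sub>F i in at_top. y i = glue P x y i"
    using eventually_ge_at_top[of P] by eventually_elim (simp add: glue_def)
qed

lemma tr_tendsto_at_bot:
  assumes "(x \<longlongrightarrow> \<sigma>) at_bot"
  shows "(tr p x \<longlongrightarrow> \<sigma>) at_bot"
proof -
  have "filterlim (\<lambda>i. p + i) at_bot at_bot"
    unfolding filterlim_at_bot
  proof
    fix Z show "\<forall>\<^sub>F i in at_bot. p + i \<le> Z"
      using eventually_le_at_bot[of "Z - p"] by eventually_elim simp
  qed
  from filterlim_compose[OF assms this] show ?thesis by (simp add: tr_def[abs_def])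
qed

lemma tr_tendsto_at_top:
  assumes "(x \<longlongrightarrow> \<sigma>) at_top"
  shows "(tr p x \<longlongrightarrow> \<sigma>) at_top"
proof -
  have "filterlim (\<lambda>i. p + i) at_top at_top"
    unfolding filterlim_at_top
  proof
    fix Z show "\<forall>\<^sub>F i in at_top. Z \<le> p + i"
      using eventually_ge_at_top[of "Z - p"] by eventually_elim simp
  qed
  from filterlim_compose[OF assms this] show ?thesis by (simp add: tr_def[abs_def])
qed

context chain
begin

lemma near_center: "near \<delta> \<sigma> P x \<Longrightarrow> \<bar>x P - \<sigma>\<bar> \<le> \<delta>" "near \<delta> \<sigma> P x \<Longrightarrow> \<bar>x (P - 1) - \<sigma>\<bar> \<le> \<delta>"
  using r by (auto simp: near_def)

definition het :: "real \<Rightarrow> real \<Rightarrow> (int \<Rightarrow> real) set" where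
  "het \<sigma> \<sigma>' = {x \<in> X. (x \<longlongrightarrow> \<sigma>) at_bot \<and> (x \<longlongrightarrow> \<sigma>') at_top}"

text \<open>Finiteness is included because energies are compared by cancelling common parts in
  \<open>ennreal\<close>.\<close>

definition minimizer :: "(int \<Rightarrow> real) set \<Rightarrow> (int \<Rightarrow> real) \<Rightarrow> bool" where
  "minimizer K x \<longleftrightarrow> x \<in> K \<and> E UNIV x < \<infinity> \<and> (\<forall>z\<in>K. E UNIV x \<le> E UNIV z)"

lemma het_tr: "x \<in> het \<sigma> \<sigma>' \<Longrightarrow> tr p x \<in> het \<sigma> \<sigma>'"
  by (auto simp: het_def intro: tr_tendsto_at_bot tr_tendsto_at_top)

lemma excursion_le_E:
  assumes "excursion \<sigma> \<rho> \<gamma>"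
    and "x \<in> X" "\<bar>x i - \<sigma>\<bar> < \<rho> / 2" "\<rho> \<le> \<bar>x j - \<sigma>\<bar>" "{min i j..max i j} \<subseteq> S"
  shows "ennreal \<gamma> \<le> E S x"
proof -
  have "ennreal \<gamma> \<le> ennreal (\<Sum>p = min i j..max i j. g (tr p x))"
    using assms unfolding excursion_def by (intro ennreal_leI) blast
  also have "\<dots> \<le> E S x" using assms by (intro sum_g_le_E) auto
  finally show ?thesis .
qed

text \<open>The tail is replaced by a constant well, which has no energy, so the price is that of
  one gluing.\<close>

lemma E_cut_right:
  assumes "flat \<kappa> \<delta>" "0 \<le> \<kappa>" "0 \<le> \<delta>" "\<sigma> \<in> {a, b}" "x \<in> X" "near \<delta> \<sigma> P x"
  shows "E UNIV (glue P x (\<lambda>_. \<sigma>)) \<le> E {..<P} x + ennreal (2 * real r * \<kappa>)"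
proof -
  have "(\<lambda>_. \<sigma>) \<in> X" using assms(4) ab by auto
  from E_glue[OF assms(1,2,4,5) this assms(6) near_const[OF assms(3)], of UNIV] show ?thesis
    using assms(4) by (simp add: E_const)
qed

lemma E_cut_left:
  assumes "flat \<kappa> \<delta>" "0 \<le> \<kappa>" "0 \<le> \<delta>" "\<sigma> \<in> {a, b}" "x \<in> X" "near \<delta> \<sigma> P x"
  shows "E UNIV (glue P (\<lambda>_. \<sigma>) x) \<le> E {P..} x + ennreal (2 * real r * \<kappa>)"
proof -
  have "(\<lambda>_. \<sigma>) \<in> X" using assms(4) ab by auto
  from E_glue[OF assms(1,2,4) this assms(5) near_const[OF assms(3)] assms(6), of UNIV] show ?thesis
    using assms(4) by (simp add: E_const)
qed

lemma two_cuts: "0 \<le> \<kappa> \<Longrightarrow> ennreal (2 * real r * \<kappa>) + ennreal (2 * real r * \<kappa>) = ennreal (4 * real r * \<kappa>)"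
  by (simp flip: ennreal_plus)

lemma E_cut_both:
  assumes fl: "flat \<kappa> \<delta>" and \<kappa>: "0 \<le> \<kappa>" and \<delta>: "0 \<le> \<delta>" and \<sigma>: "\<sigma> \<in> {a, b}" "\<sigma>' \<in> {a, b}"
    and x: "x \<in> X" "near \<delta> \<sigma> P x" "near \<delta> \<sigma>' Q x" and PQ: "P + 2 * int r < Q"
  shows "E UNIV (glue P (\<lambda>_. \<sigma>) (glue Q x (\<lambda>_. \<sigma>'))) \<le> E {P..<Q} x + ennreal (4 * real r * \<kappa>)"
proof -
  have c: "(\<lambda>_. \<sigma>) \<in> X" "(\<lambda>_. \<sigma>') \<in> X" using \<sigma> ab by auto
  have eq: "{P..} \<inter> {..<Q} = {P..<Q}" by auto
  have "E UNIV (glue P (\<lambda>_. \<sigma>) (glue Q x (\<lambda>_. \<sigma>'))) \<le>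
      E (UNIV \<inter> {..<P}) (\<lambda>_. \<sigma>) + E (UNIV \<inter> {P..}) (glue Q x (\<lambda>_. \<sigma>')) + ennreal (2 * real r * \<kappa>)"
    \<comment> \<open>The distance between \<open>P\<close> and \<open>Q\<close> keeps the block at
      \<open>P\<close> untouched by the cut at \<open>Q\<close>.\<close>
    using c x PQ \<delta> by (intro E_glue[OF fl \<kappa> \<sigma>(1)]) (auto simp: near_glue_left)
  also have "E (UNIV \<inter> {P..}) (glue Q x (\<lambda>_. \<sigma>')) \<le>
      E ({P..} \<inter> {..<Q}) x + E ({P..} \<inter> {Q..}) (\<lambda>_. \<sigma>') + ennreal (2 * real r * \<kappa>)"
    using c x PQ \<delta> by (simp, intro E_glue[OF fl \<kappa> \<sigma>(2)]) auto
  finally show ?thesis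
    using \<sigma> two_cuts[OF \<kappa>] by (simp add: E_const eq add.assoc)
qed

text \<open>Two gluings. Since both chains are close to the wells at both blocks, the inner glued
  chain is again close to \<open>\<sigma>\<close> at \<open>P\<close>, whatever the distance of the
  blocks.\<close>

lemma E_replace:
  assumes fl: "flat \<kappa> \<delta>" and \<kappa>: "0 \<le> \<kappa>" and \<sigma>: "\<sigma> \<in> {a, b}" "\<sigma>' \<in> {a, b}"
    and xy: "x \<in> X" "y \<in> X"
    and near: "near \<delta> \<sigma> P x" "near \<delta> \<sigma> P y" "near \<delta> \<sigma>' Q x" "near \<delta> \<sigma>' Q y"
  shows "E UNIV (glue P x (glue Q y x)) \<le>
    E {..<P} x + (E {P..<Q} y + E {Q..} x) + ennreal (4 * real r * \<kappa>)"
proof -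
  have eq: "{P..} \<inter> {..<Q} = {P..<Q}" by auto
  have "E UNIV (glue P x (glue Q y x)) \<le>
      E (UNIV \<inter> {..<P}) x + E (UNIV \<inter> {P..}) (glue Q y x) + ennreal (2 * real r * \<kappa>)"
    using xy near by (intro E_glue[OF fl \<kappa> \<sigma>(1)]) (auto simp: near_glue)
  also have "E (UNIV \<inter> {P..}) (glue Q y x) \<le>
      E ({P..} \<inter> {..<Q}) y + E ({P..} \<inter> {Q..}) x + ennreal (2 * real r * \<kappa>)"
    using xy near by (simp, intro E_glue[OF fl \<kappa> \<sigma>(2)]) auto
  also have "E ({P..} \<inter> {Q..}) x \<le> E {Q..} x" by (rule E_mono) auto
  finally show ?thesis
    using two_cuts[OF \<kappa>] by (simp add: eq add.assoc add_left_mono)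
qed

lemma E_split3: "P \<le> Q \<Longrightarrow> E UNIV x = E {..<P} x + (E {P..<Q} x + E {Q..} x)"
proof -
  assume "P \<le> Q"
  then have "{P..} = {P..<Q} \<union> {Q..}" "{P..<Q} \<inter> {Q..} = {}" by auto
  then show ?thesis using E_split[of x P] E_Un[of "{P..<Q}" "{Q..}" x] by simp
qed

text \<open>In the limit of a minimizing sequence, a well reached on the wrong side leaves behind a full
  transition and a separate excursion, which together cost more than a minimizer.\<close>

lemma strict_excess:
  assumes \<sigma>: "(\<sigma>, \<sigma>') = (a, b) \<or> (\<sigma>, \<sigma>') = (b, a)"
    and q: "minimizer (het \<sigma> \<sigma>') q"
    and \<tau>: "\<tau> \<in> {a, b}" and \<rho>: "0 < \<rho>" "\<rho> < b - a"
    and avoid: "\<And>x. minimizer (het \<sigma> \<sigma>') x \<Longrightarrow> \<bar>x 0 - \<tau>\<bar> \<noteq> \<rho>"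
  shows "\<exists>\<gamma>>0. \<forall>x\<in>het \<sigma> \<sigma>'. \<forall>i. \<bar>x i - \<tau>\<bar> = \<rho> \<longrightarrow> E UNIV q + ennreal \<gamma> \<le> E UNIV x"
proof -
  obtain e where e: "E UNIV q = ennreal e" "0 \<le> e"
    using q unfolding minimizer_def by (cases "E UNIV q") auto
  \<comment> \<open>Energy and class are invariant under translation, so site \<open>0\<close>
    suffices.\<close>
  have "\<exists>\<gamma>>0. \<forall>x\<in>het \<sigma> \<sigma>'. \<bar>x 0 - \<tau>\<bar> = \<rho> \<longrightarrow> E UNIV q + ennreal \<gamma> \<le> E UNIV x"
  proof (rule ccontr)
    assume neg: "\<not> ?thesis"
    have "\<exists>x. x \<in> het \<sigma> \<sigma>' \<and> \<bar>x 0 - \<tau>\<bar> = \<rho> \<and> E UNIV x \<le> ennreal (e + 1 / real (Suc n))" for n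
    proof (rule ccontr)
      assume no: "\<not> ?thesis"
      have "E UNIV q + ennreal (1 / real (Suc n)) \<le> E UNIV x" if "x \<in> het \<sigma> \<sigma>'" "\<bar>x 0 - \<tau>\<bar> = \<rho>" for x
      proof -
        have "\<not> E UNIV x \<le> ennreal (e + 1 / real (Suc n))" using no that by blast
        then show ?thesis using e by (simp add: ennreal_plus)
      qed
      moreover have "0 < 1 / real (Suc n)" by simp
      ultimately show False using neg by blast
    qed
    then obtain f where f: "\<And>n. f n \<in> het \<sigma> \<sigma>'" "\<And>n. \<bar>f n 0 - \<tau>\<bar> = \<rho>"
      "\<And>n. E UNIV (f n) \<le> ennreal (e + 1 / real (Suc n))" by metis
    have fX: "f n \<in> X" for n using f(1)[of n] by (simp add: het_def)
    obtain l s where ls: "strict_mono s" "l \<in> X" "\<And>i. (\<lambda>n. f (s n) i) \<longlonglongrightarrow> l i"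
      using box_subseq[of f, OF fX] by auto
    have s0: "(\<lambda>n. 1 / real (Suc (s n))) \<longlonglongrightarrow> 0"
      using LIMSEQ_subseq_LIMSEQ[OF LIMSEQ_inverse_real_of_nat ls(1)]
      by (simp only: comp_def inverse_eq_divide)
    have l0: "\<bar>l 0 - \<tau>\<bar> = \<rho>"
    proof -
      have "(\<lambda>n. \<bar>f (s n) 0 - \<tau>\<bar>) \<longlonglongrightarrow> \<bar>l 0 - \<tau>\<bar>" by (intro tendsto_intros ls)
      then show ?thesis using LIMSEQ_unique[OF _ tendsto_const] f(2) by simp
    qed
    have El: "E UNIV l \<le> ennreal e"
    proof (rule E_lsc[OF fX ls(2,3)])
      show "E UNIV (f (s n)) \<le> ennreal (e + 1 / real (Suc (s n)))" for n by (rule f(3))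
      show "(\<lambda>n. e + 1 / real (Suc (s n))) \<longlonglongrightarrow> e" using tendsto_add[OF tendsto_const s0] by simp
    qed (use e in auto)
    \<comment> \<open>A value at distance \<open>\<rho>\<close> from one well is at distance
      \<open>b - a - \<rho>\<close> from the other; \<open>\<rho>0\<close> is a lower bound for
      both.\<close>
    define \<rho>0 where "\<rho>0 = min \<rho> (b - a - \<rho>)"
    have \<rho>0: "0 < \<rho>0" "\<rho>0 < b - a" using \<rho> by (auto simp: \<rho>0_def)
    have far: "\<rho>0 \<le> \<bar>x 0 - \<sigma>''\<bar>" if "\<bar>x 0 - \<tau>\<bar> = \<rho>" "\<sigma>'' \<in> {a, b}" "x \<in> X" for x \<sigma>''
    proof -
      have "a \<le> x 0" "x 0 \<le> b" using that by (auto simp: box_def)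
      then show ?thesis using that \<tau> \<rho> by (auto simp: \<rho>0_def)
    qed
    obtain \<gamma>a where \<gamma>a: "\<gamma>a > 0" "excursion a \<rho>0 \<gamma>a"
      using ex_excursion[of a \<rho>0] \<rho>0 by auto
    obtain \<gamma>b where \<gamma>b: "\<gamma>b > 0" "excursion b \<rho>0 \<gamma>b"
      using ex_excursion[of b \<rho>0] \<rho>0 by auto
    define \<gamma> where "\<gamma> = min \<gamma>a \<gamma>b"
    have \<gamma>: "\<gamma> > 0" using \<gamma>a \<gamma>b by (simp add: \<gamma>_def)
    have exc: "ennreal \<gamma> \<le> E S x"
      if "x \<in> X" "\<bar>x i - \<sigma>''\<bar> < \<rho>0 / 2" "\<rho>0 \<le> \<bar>x j - \<sigma>''\<bar>" "{min i j..max i j} \<subseteq> S" "\<sigma>'' \<in> {a, b}" for x i j S \<sigma>''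
    proof -
      have "excursion \<sigma>'' \<rho>0 \<gamma>"
        using that(5) excursion_mono[OF \<gamma>a(2)] excursion_mono[OF \<gamma>b(2)] by (auto simp: \<gamma>_def)
      from excursion_le_E[OF this that(1-4)] show ?thesis .
    qed
    \<comment> \<open>A single cut then costs \<open>\<gamma> / 2\<close>, half of what an excursion
      costs; the other half absorbs the error \<open>1 / (n + 1)\<close> of the minimizing
      sequence.\<close>
    define \<kappa> where "\<kappa> = \<gamma> / (4 * real r)"
    have \<kappa>: "\<kappa> > 0" "2 * real r * \<kappa> = \<gamma> / 2" using \<gamma> r by (auto simp: \<kappa>_def)
    obtain \<delta>0 where \<delta>0: "\<delta>0 > 0" "flat \<kappa> \<delta>0" using ex_flat[OF \<kappa>(1)] by blast
    define \<delta> where "\<delta> = min \<delta>0 (\<rho>0 / 4)"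
    have \<delta>: "0 < \<delta>" "\<delta> < \<rho>0 / 2" "flat \<kappa> \<delta>"
      using \<delta>0 \<rho>0 flat_mono[OF \<delta>0(2), of \<delta>] by (auto simp: \<delta>_def)
    have \<kappa>0: "0 \<le> \<kappa>" and \<delta>0: "0 \<le> \<delta>" using \<kappa> \<delta> by auto
    have approx: "\<exists>n. near \<delta> \<sigma>'' P (f n) \<and> 1 / real (Suc n) < \<gamma> / 2" if "near (\<delta> / 2) \<sigma>'' P l" for P \<sigma>''
    proof -
      have "\<forall>\<^sub>F n in sequentially. \<forall>i\<in>{P - 2 * int r..P + 2 * int r}. \<bar>f (s n) i - l i\<bar> < \<delta> / 2"
        using tendstoD[OF ls(3), of "\<delta> / 2"] \<delta>(1) by (subst eventually_ball_finite_distrib) (auto simp: dist_real_def)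
      moreover have "\<forall>\<^sub>F n in sequentially. 1 / real (Suc (s n)) < \<gamma> / 2"
        by (rule order_tendstoD(2)[OF s0]) (use \<gamma> in simp)
      ultimately have "\<forall>\<^sub>F n in sequentially.
          (\<forall>i\<in>{P - 2 * int r..P + 2 * int r}. \<bar>f (s n) i - l i\<bar> < \<delta> / 2) \<and> 1 / real (Suc (s n)) < \<gamma> / 2"
        by (rule eventually_conj)
      then obtain n where n: "\<forall>i\<in>{P - 2 * int r..P + 2 * int r}. \<bar>f (s n) i - l i\<bar> < \<delta> / 2"
          "1 / real (Suc (s n)) < \<gamma> / 2"
        using eventually_happens'[OF sequentially_bot] by blast
      have "near \<delta> \<sigma>'' P (f (s n))"
        unfolding near_def
      proof
        fix i assume i: "i \<in> {P - 2 * int r..P + 2 * int r}"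
        then have "\<bar>f (s n) i - l i\<bar> < \<delta> / 2" "\<bar>l i - \<sigma>''\<bar> \<le> \<delta> / 2"
          using n that by (auto simp: near_def)
        then show "\<bar>f (s n) i - \<sigma>''\<bar> \<le> \<delta>" by linarith
      qed
      with n show ?thesis by blast
    qed
    \<comment> \<open>One side of the cut carries a whole transition up to
      \<open>\<gamma> / 2\<close>, the other an excursion of cost \<open>\<gamma>\<close>; together
      they exceed the energy allowed for \<open>f n\<close>.\<close>
    have contra: False
      if "1 / real (Suc n) < \<gamma> / 2" "E UNIV q \<le> E S (f n) + ennreal (\<gamma> / 2)" "ennreal \<gamma> \<le> E S' (f n)"
        "E UNIV (f n) = E S (f n) + E S' (f n)" for n S S'
    proof -
      have "ennreal (e + \<gamma>) \<le> (E S (f n) + ennreal (\<gamma> / 2)) + E S' (f n)"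
        using that e \<gamma> by (simp add: ennreal_plus add_mono)
      also have "\<dots> = E UNIV (f n) + ennreal (\<gamma> / 2)" using that(4) by (simp add: ac_simps)
      also have "\<dots> \<le> ennreal (e + 1 / real (Suc n)) + ennreal (\<gamma> / 2)" using f(3) by (rule add_right_mono)
      also have "\<dots> = ennreal (e + 1 / real (Suc n) + \<gamma> / 2)"
        using e \<gamma> by (intro ennreal_plus[symmetric]) auto
      finally have "e + \<gamma> \<le> e + 1 / real (Suc n) + \<gamma> / 2" using e \<gamma> by (subst (asm) ennreal_le_iff) auto
      then show False using that(1) by simp
    qed
    have fin: "E UNIV l < \<infinity>" using El by (simp add: order_le_less_trans)
    from finite_energy_limits[OF ls(2) fin] \<sigma>
    consider "(l \<longlongrightarrow> \<sigma>') at_bot" | "(l \<longlongrightarrow> \<sigma>) at_top" | "(l \<longlongrightarrow> \<sigma>) at_bot" "(l \<longlongrightarrow> \<sigma>') at_top" by blast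
    then show False
    proof cases
      case 1
      \<comment> \<open>The terms of \<open>f n\<close> before \<open>P\<close> complete the
        transition to \<open>\<sigma>'\<close>, yet at site \<open>0\<close> the chain is away from
        \<open>\<sigma>'\<close> again.\<close>
      obtain P where P: "P + 2 * int r < 0" "near (\<delta> / 2) \<sigma>' P l" using ex_near_at_bot[OF 1, of "\<delta> / 2" 0] \<delta> by auto
      obtain n where n: "near \<delta> \<sigma>' P (f n)" "1 / real (Suc n) < \<gamma> / 2" using approx[OF P(2)] by blast
      have \<sigma>': "\<sigma>' \<in> {a, b}" using \<sigma> by auto
      have "glue P (f n) (\<lambda>_. \<sigma>') \<in> het \<sigma> \<sigma>'"
        using f(1)[of n] \<sigma>' ab by (auto simp: het_def intro!: glue_tendsto_at_bot glue_tendsto_at_top)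
      then have "E UNIV q \<le> E {..<P} (f n) + ennreal (\<gamma> / 2)"
        using q order_trans[OF _ E_cut_right[OF \<delta>(3) \<kappa>0 \<delta>0 \<sigma>' fX n(1), unfolded \<kappa>(2)]]
        unfolding minimizer_def by blast
      moreover have "ennreal \<gamma> \<le> E {P..} (f n)"
      proof (rule exc[OF fX _ _ _ \<sigma>'])
        show "\<bar>f n P - \<sigma>'\<bar> < \<rho>0 / 2" using near_center(1)[OF n(1)] \<delta>(2) by simp
        show "\<rho>0 \<le> \<bar>f n 0 - \<sigma>'\<bar>" by (rule far[OF f(2) \<sigma>' fX])
      qed (use P in auto)
      ultimately show False by (rule contra[OF n(2) _ _ E_split])
    next
      case 2
      obtain P where P: "0 < P - 2 * int r" "near (\<delta> / 2) \<sigma> P l" using ex_near_at_top[OF 2, of "\<delta> / 2" 0] \<delta> by auto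
      obtain n where n: "near \<delta> \<sigma> P (f n)" "1 / real (Suc n) < \<gamma> / 2" using approx[OF P(2)] by blast
      have \<sigma>1: "\<sigma> \<in> {a, b}" using \<sigma> by auto
      have "glue P (\<lambda>_. \<sigma>) (f n) \<in> het \<sigma> \<sigma>'"
        using f(1)[of n] \<sigma>1 ab by (auto simp: het_def intro!: glue_tendsto_at_bot glue_tendsto_at_top)
      then have "E UNIV q \<le> E {P..} (f n) + ennreal (\<gamma> / 2)"
        using q order_trans[OF _ E_cut_left[OF \<delta>(3) \<kappa>0 \<delta>0 \<sigma>1 fX n(1), unfolded \<kappa>(2)]]
        unfolding minimizer_def by blast
      moreover have "ennreal \<gamma> \<le> E {..<P} (f n)"
      proof (rule exc[OF fX _ _ _ \<sigma>1])
        show "\<bar>f n (P - 1) - \<sigma>\<bar> < \<rho>0 / 2" using near_center(2)[OF n(1)] \<delta>(2) by simp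
        show "\<rho>0 \<le> \<bar>f n 0 - \<sigma>\<bar>" by (rule far[OF f(2) \<sigma>1 fX])
      qed (use P in auto)
      moreover have "E UNIV (f n) = E {P..} (f n) + E {..<P} (f n)"
        using E_split[of "f n" P] by (simp add: add.commute)
      ultimately show False by (rule contra[OF n(2)])
    next
      case 3
      \<comment> \<open>The limit has kept both asymptotics, so it is itself a minimizer at the
        forbidden distance.\<close>
      then have "l \<in> het \<sigma> \<sigma>'" using ls(2) by (simp add: het_def)
      then have "minimizer (het \<sigma> \<sigma>') l"
        using q order_trans[OF El] fin unfolding minimizer_def e(1) by blast
      with avoid l0 show False by blast
    qed
  qed
  then obtain \<gamma> where \<gamma>: "\<gamma> > 0" "\<And>x. x \<in> het \<sigma> \<sigma>' \<Longrightarrow> \<bar>x 0 - \<tau>\<bar> = \<rho> \<Longrightarrow> E UNIV q + ennreal \<gamma> \<le> E UNIV x"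
    by blast
  have "E UNIV q + ennreal \<gamma> \<le> E UNIV x" if "x \<in> het \<sigma> \<sigma>'" "\<bar>x i - \<tau>\<bar> = \<rho>" for x i
    using \<gamma>(2)[OF het_tr[OF that(1), of i]] that(2) by (simp add: E_tr tr_apply)
  with \<gamma>(1) show ?thesis by blast
qed

text \<open>A chain that starts at the wrong well makes an excursion before it is close to
  \<open>\<sigma>\<close> at \<open>P\<close>. Cutting this part off saves \<open>\<gamma>\<close>
  and costs one gluing.\<close>

lemma repair_left:
  assumes fl: "flat \<kappa> \<delta>" and \<kappa>: "0 \<le> \<kappa>" and \<delta>: "0 \<le> \<delta>" "\<delta> < \<rho> / 2" and \<sigma>: "\<sigma> \<in> {a, b}"
    and \<rho>: "\<rho> < b - a"
    and exc: "excursion \<sigma> \<rho> \<gamma>" and \<gamma>: "2 * real r * \<kappa> \<le> \<gamma>"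
    and x: "x \<in> X" "E UNIV x < \<infinity>" and P: "near \<delta> \<sigma> P x"
  shows "\<exists>z. (z \<longlongrightarrow> \<sigma>) at_bot \<and> E UNIV z \<le> E UNIV x \<and> (z = x \<or> z = glue P (\<lambda>_. \<sigma>) x)"
proof (cases "(x \<longlongrightarrow> \<sigma>) at_bot")
  case False
  obtain \<sigma>' where \<sigma>': "(x \<longlongrightarrow> \<sigma>') at_bot" "\<sigma>' \<in> {a, b}" "\<sigma>' \<noteq> \<sigma>"
    using finite_energy_limits[OF x] False \<sigma> by blast
  have d: "\<bar>\<sigma>' - \<sigma>\<bar> = b - a" using \<sigma> \<sigma>' ab by auto
  \<comment> \<open>Within \<open>b - a - \<rho>\<close> of the other well a value is at distance at
    least \<open>\<rho>\<close> from \<open>\<sigma>\<close>.\<close>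
  obtain Q where Q: "Q + 2 * int r < P" "near (b - a - \<rho>) \<sigma>' Q x"
    using ex_near_at_bot[OF \<sigma>'(1), of "b - a - \<rho>" P] \<rho> by auto
  have "\<bar>x Q - \<sigma>'\<bar> \<le> b - a - \<rho>" using near_center(1)[OF Q(2)] .
  then have far: "\<rho> \<le> \<bar>x Q - \<sigma>\<bar>" using d by linarith
  have nr: "\<bar>x (P - 1) - \<sigma>\<bar> < \<rho> / 2" using near_center(2)[OF P] \<delta> by simp
  have "ennreal (2 * real r * \<kappa>) \<le> ennreal \<gamma>" using \<gamma> by (rule ennreal_leI)
  also have "\<dots> \<le> E {..<P} x"
    by (rule excursion_le_E[OF exc x(1) nr far]) (use Q in auto)
  finally have "E {P..} x + ennreal (2 * real r * \<kappa>) \<le> E {..<P} x + E {P..} x"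
    by (simp add: add.commute add_left_mono)
  then have "E UNIV (glue P (\<lambda>_. \<sigma>) x) \<le> E UNIV x"
    using order_trans[OF E_cut_left[OF fl \<kappa> \<delta>(1) \<sigma> x(1) P]] E_split[of x P] by simp
  moreover have "(glue P (\<lambda>_. \<sigma>) x \<longlongrightarrow> \<sigma>) at_bot" by (rule glue_tendsto_at_bot) simp
  ultimately show ?thesis by blast
qed blast

lemma repair_right:
  assumes fl: "flat \<kappa> \<delta>" and \<kappa>: "0 \<le> \<kappa>" and \<delta>: "0 \<le> \<delta>" "\<delta> < \<rho> / 2" and \<sigma>: "\<sigma> \<in> {a, b}"
    and \<rho>: "\<rho> < b - a"
    and exc: "excursion \<sigma> \<rho> \<gamma>" and \<gamma>: "2 * real r * \<kappa> \<le> \<gamma>"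
    and x: "x \<in> X" "E UNIV x < \<infinity>" and P: "near \<delta> \<sigma> P x"
  shows "\<exists>z. (z \<longlongrightarrow> \<sigma>) at_top \<and> E UNIV z \<le> E UNIV x \<and> (z = x \<or> z = glue P x (\<lambda>_. \<sigma>))"
proof (cases "(x \<longlongrightarrow> \<sigma>) at_top")
  case False
  obtain \<sigma>' where \<sigma>': "(x \<longlongrightarrow> \<sigma>') at_top" "\<sigma>' \<in> {a, b}" "\<sigma>' \<noteq> \<sigma>"
    using finite_energy_limits[OF x] False \<sigma> by blast
  have d: "\<bar>\<sigma>' - \<sigma>\<bar> = b - a" using \<sigma> \<sigma>' ab by auto
  obtain Q where Q: "P < Q - 2 * int r" "near (b - a - \<rho>) \<sigma>' Q x"
    using ex_near_at_top[OF \<sigma>'(1), of "b - a - \<rho>" P] \<rho> by auto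
  have "\<bar>x Q - \<sigma>'\<bar> \<le> b - a - \<rho>" using near_center(1)[OF Q(2)] .
  then have far: "\<rho> \<le> \<bar>x Q - \<sigma>\<bar>" using d by linarith
  have nr: "\<bar>x P - \<sigma>\<bar> < \<rho> / 2" using near_center(1)[OF P] \<delta> by simp
  have "ennreal (2 * real r * \<kappa>) \<le> ennreal \<gamma>" using \<gamma> by (rule ennreal_leI)
  also have "\<dots> \<le> E {P..} x"
    by (rule excursion_le_E[OF exc x(1) nr far]) (use Q in auto)
  finally have "E {..<P} x + ennreal (2 * real r * \<kappa>) \<le> E {..<P} x + E {P..} x"
    by (simp add: add_left_mono)
  then have "E UNIV (glue P x (\<lambda>_. \<sigma>)) \<le> E UNIV x"
    using order_trans[OF E_cut_right[OF fl \<kappa> \<delta>(1) \<sigma> x(1) P]] E_split[of x P] by simp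
  moreover have "(glue P x (\<lambda>_. \<sigma>) \<longlongrightarrow> \<sigma>) at_top" by (rule glue_tendsto_at_top) simp
  ultimately show ?thesis by blast
qed blast

text \<open>Between two blocks at the same well an excursion could be replaced by the constant,
  saving \<open>\<gamma>\<close> for the price of two gluings.\<close>

lemma rest_strict:
  assumes fl: "flat \<kappa> \<delta>" and \<kappa>: "0 \<le> \<kappa>" and \<delta>: "0 \<le> \<delta>" "\<delta> < \<rho> / 2" and \<sigma>: "\<sigma> \<in> {a, b}"
    and exc: "excursion \<sigma> \<rho> \<gamma>" and \<gamma>: "4 * real r * \<kappa> < \<gamma>"
    and U: "minimizer K U" "U \<in> X" and PQ: "near \<delta> \<sigma> P U" "near \<delta> \<sigma> Q U" "P \<le> i" "i < Q"
    and K: "glue P U (glue Q (\<lambda>_. \<sigma>) U) \<in> K"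
  shows "\<bar>U i - \<sigma>\<bar> < \<rho>"
proof (rule ccontr)
  assume "\<not> ?thesis"
  then have far: "\<rho> \<le> \<bar>U i - \<sigma>\<bar>" by simp
  have c: "(\<lambda>_. \<sigma>) \<in> X" using \<sigma> ab by auto
  have nr: "\<bar>U P - \<sigma>\<bar> < \<rho> / 2" using near_center(1)[OF PQ(1)] \<delta> by simp
  have exU: "ennreal \<gamma> \<le> E {P..<Q} U"
    by (rule excursion_le_E[OF exc U(2) nr far]) (use PQ in auto)
  have "E UNIV U \<le> E UNIV (glue P U (glue Q (\<lambda>_. \<sigma>) U))"
    using U K unfolding minimizer_def by blast
  also have "\<dots> \<le> E {..<P} U + (0 + E {Q..} U) + ennreal (4 * real r * \<kappa>)"
    using E_replace[OF fl \<kappa> \<sigma> \<sigma> U(2) c PQ(1) _ PQ(2)] \<delta> \<sigma> by (simp add: E_const)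
  finally have 1: "E UNIV U \<le> E {..<P} U + E {Q..} U + ennreal (4 * real r * \<kappa>)" by simp
  have 2: "E UNIV U = E {..<P} U + E {Q..} U + E {P..<Q} U"
    using E_split3[of P Q U] PQ by (simp add: ac_simps)
  have "E {..<P} U + E {Q..} U < \<infinity>"
    using U(1) unfolding minimizer_def 2 by simp
  moreover have "E {..<P} U + E {Q..} U + ennreal \<gamma> \<le> E {..<P} U + E {Q..} U + ennreal (4 * real r * \<kappa>)"
    using order_trans[OF add_left_mono[OF exU] 1[unfolded 2]] .
  ultimately have "ennreal \<gamma> \<le> ennreal (4 * real r * \<kappa>)"
    unfolding ennreal_add_left_cancel_le by auto
  then show False using \<gamma> \<kappa> by (simp add: ennreal_le_iff not_le)
qed

text \<open>If the distance \<open>\<rho>\<close> were attained, the piece of \<open>U\<close>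
  between the blocks, extended by constants, would be a heteroclinic of energy at least that of
  \<open>q\<close> plus \<open>\<gamma>\<close>. Replacing the piece by \<open>y\<close> would gain,
  because \<open>4 * r * \<kappa>\<close> is paid three times: for the extension, for the excess of
  \<open>y\<close> over \<open>q\<close>, and for the exchange.\<close>

lemma transition_strict:
  assumes fl: "flat \<kappa> \<delta>" and \<kappa>: "0 \<le> \<kappa>" and \<delta>: "0 \<le> \<delta>" and \<sigma>: "\<sigma> \<in> {a, b}" "\<sigma>' \<in> {a, b}"
    and q: "minimizer (het \<sigma> \<sigma>') q"
    and exc: "\<And>x i. x \<in> het \<sigma> \<sigma>' \<Longrightarrow> \<bar>x i - \<tau>\<bar> = \<rho> \<Longrightarrow> E UNIV q + ennreal \<gamma> \<le> E UNIV x"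
    and \<gamma>: "12 * real r * \<kappa> < \<gamma>"
    and U: "minimizer K U" "U \<in> X"
    and PQ: "near \<delta> \<sigma> P U" "near \<delta> \<sigma>' Q U" "P \<le> i" "i < Q" "P + 2 * int r < Q"
    and y: "y \<in> X" "E UNIV y \<le> E UNIV q + ennreal (4 * real r * \<kappa>)" "near \<delta> \<sigma> P y" "near \<delta> \<sigma>' Q y"
    and K: "glue P U (glue Q y U) \<in> K"
  shows "\<bar>U i - \<tau>\<bar> \<noteq> \<rho>"
proof
  assume eq: "\<bar>U i - \<tau>\<bar> = \<rho>"
  obtain e where e: "E UNIV q = ennreal e" "0 \<le> e"
    using q unfolding minimizer_def by (cases "E UNIV q") auto
  let ?ext = "glue P (\<lambda>_. \<sigma>) (glue Q U (\<lambda>_. \<sigma>'))"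
  have "?ext \<in> het \<sigma> \<sigma>'"
    using U(2) \<sigma> ab by (auto simp: het_def intro!: glue_tendsto_at_bot glue_tendsto_at_top)
  moreover have "?ext i = U i" using PQ by (simp add: glue_def)
  ultimately have "ennreal e + ennreal \<gamma> \<le> E UNIV ?ext" using exc[of ?ext i] eq e by simp
  also have "\<dots> \<le> E {P..<Q} U + ennreal (4 * real r * \<kappa>)"
    using PQ by (intro E_cut_both[OF fl \<kappa> \<delta> \<sigma> U(2)]) auto
  finally have 1: "ennreal e + ennreal \<gamma> \<le> E {P..<Q} U + ennreal (4 * real r * \<kappa>)" .
  have "E UNIV U \<le> E UNIV (glue P U (glue Q y U))"
    using U K unfolding minimizer_def by blast
  also have "\<dots> \<le> E {..<P} U + (E {P..<Q} y + E {Q..} U) + ennreal (4 * real r * \<kappa>)"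
    using PQ y by (intro E_replace[OF fl \<kappa> \<sigma> U(2)]) auto
  also have "E {P..<Q} y \<le> E UNIV y" by (rule E_mono) auto
  also note y(2)
  finally have 2: "E UNIV U \<le> E {..<P} U + (ennreal e + ennreal (4 * real r * \<kappa>) + E {Q..} U) + ennreal (4 * real r * \<kappa>)"
    using e by (simp add: add_left_mono add_right_mono)
  have 3: "E UNIV U = E {..<P} U + (E {P..<Q} U + E {Q..} U)"
    using E_split3[of P Q U] PQ by simp
  have "E UNIV U < \<infinity>" using U by (simp add: minimizer_def)
  with 3 obtain \<alpha> \<beta> \<eta> where \<alpha>: "E {..<P} U = ennreal \<alpha>" "0 \<le> \<alpha>" and \<beta>: "E {P..<Q} U = ennreal \<beta>" "0 \<le> \<beta>"
    and \<eta>: "E {Q..} U = ennreal \<eta>" "0 \<le> \<eta>"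
    by (cases "E {..<P} U"; cases "E {P..<Q} U"; cases "E {Q..} U") auto
  define c where "c = 4 * real r * \<kappa>"
  have c: "0 \<le> c" "3 * c < \<gamma>" using \<kappa> \<gamma> by (auto simp: c_def)
  have \<gamma>0: "0 \<le> \<gamma>" using c by simp
  have "ennreal (e + \<gamma>) \<le> ennreal (\<beta> + c)"
    using 1 e \<gamma>0 \<beta> c unfolding c_def[symmetric] by (simp add: ennreal_plus)
  then have "e + \<gamma> \<le> \<beta> + c" using \<beta> c by (subst (asm) ennreal_le_iff) auto
  moreover have "ennreal (\<alpha> + (\<beta> + \<eta>)) \<le> ennreal (\<alpha> + (e + c + \<eta>) + c)"
  proof -
    have "ennreal (\<alpha> + (\<beta> + \<eta>)) = E UNIV U" using 3 \<alpha> \<beta> \<eta> by (simp add: ennreal_plus)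
    also have "\<dots> \<le> ennreal \<alpha> + (ennreal e + ennreal c + ennreal \<eta>) + ennreal c"
      using 2 unfolding \<alpha>(1) \<eta>(1) c_def .
    also have "\<dots> = ennreal (\<alpha> + (e + c + \<eta>) + c)" using \<alpha> e \<eta> c ennreal_plus[of c c] by (simp add: ennreal_plus)
    finally show ?thesis .
  qed
  then have "\<alpha> + (\<beta> + \<eta>) \<le> \<alpha> + (e + c + \<eta>) + c" using \<alpha> e \<eta> c by (subst (asm) ennreal_le_iff) auto
  ultimately show False using c by simp
qed

end

subsection \<open>Constrained minimizers\<close>

text \<open>Zone \<open>t\<close> is where the chain rests between transitions; transition
  \<open>t\<close> runs from \<open>m (2 * t + 1)\<close> to \<open>m (2 * t + 2)\<close>. Zones
  \<open>0\<close> and \<open>2 * k + 1\<close> are half-infinite.\<close>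

definition zone :: "nat \<Rightarrow> (nat \<Rightarrow> int) \<Rightarrow> nat \<Rightarrow> int \<Rightarrow> bool" where
  "zone k m t i \<longleftrightarrow> t \<le> 2 * k + 1 \<and> (1 \<le> t \<longrightarrow> m (2 * t) \<le> i) \<and> (t \<le> 2 * k \<longrightarrow> i < m (2 * t + 1))"

lemma admissible_less:
  assumes adm: "admissible k l m" and ij: "1 \<le> i" "i < j" "j \<le> 4 * k + 2"
  shows "m i < m j"
  using ij(2,3)
proof (induction j rule: less_induct)
  case (less j)
  have "1 \<le> j - 1" "j - 1 < 4 * k + 2" using ij(1) less.prems by auto
  then have "m (j - 1) < m (j - 1 + 1)" using adm unfolding admissible_def by blast
  then have step: "m (j - 1) < m j" using less.prems by simp
  show ?case
  proof (cases "i = j - 1")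
    case False
    then have "m i < m (j - 1)" using less.prems by (intro less.IH) auto
    with step show ?thesis by simp
  qed (use step in simp)
qed

lemma admissible_le:
  assumes "admissible k l m" "1 \<le> i" "i \<le> j" "j \<le> 4 * k + 2"
  shows "m i \<le> m j"
  using admissible_less[OF assms(1,2), of j] assms by (cases "i = j") auto

text \<open>A bounded zone has a constraint window of length \<open>l\<close> at each end, and this
  gap keeps the two apart.\<close>

lemma admissible_gap:
  assumes "admissible k l m" "1 \<le> t" "t \<le> 2 * k"
  shows "m (2 * t) + 2 * int l < m (2 * t + 1)"
  using assms unfolding admissible_def by auto

lemma zone_mono:
  assumes adm: "admissible k l m" and z: "zone k m t i" "zone k m t' j" "i \<le> j"
  shows "t \<le> t'"
proof (rule ccontr)
  assume "\<not> t \<le> t'"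
  then have "t' < t" by simp
  then have "m (2 * t' + 1) \<le> m (2 * t)" using z by (intro admissible_le[OF adm]) (auto simp: zone_def)
  then show False using z \<open>t' < t\<close> by (auto simp: zone_def)
qed

lemma zone_unique: "admissible k l m \<Longrightarrow> zone k m t i \<Longrightarrow> zone k m t' i \<Longrightarrow> t = t'"
  using zone_mono[of k l m t i t' i] zone_mono[of k l m t' i t i] by simp

context chain
begin

section \<open>Windows, zones and competitors\<close>

definition side :: "nat \<Rightarrow> real" where
  "side t = (if even t then a else b)"

lemma side_mem [simp]: "side t \<in> {a, b}" "a \<le> side t" "side t \<le> b"
  using ab by (auto simp: side_def)

lemma side_Suc: "(side t, side (Suc t)) = (a, b) \<or> (side t, side (Suc t)) = (b, a)"
  by (simp add: side_def)

text \<open>Conditions (a) to (d) as one finite set of sites with a well and a tolerance: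
  \<open>\<rho>\<close> belongs to the window before a transition, \<open>\<rho>'\<close> to the one
  after it, and parity distinguishes the two directions.\<close>

definition constraints :: "nat \<Rightarrow> (nat \<Rightarrow> real) \<Rightarrow> (nat \<Rightarrow> real) \<Rightarrow> (nat \<Rightarrow> int) \<Rightarrow> nat \<Rightarrow> (int \<times> real \<times> real) set" where
  "constraints k \<rho> \<rho>' m l = (\<Union>t\<le>2*k. (\<lambda>i. (i, side t, \<rho> t)) ` {m (2*t+1) - int l..m (2*t+1) - 1} \<union>
     (\<lambda>i. (i, side (Suc t), \<rho>' t)) ` {m (2*t+2)..m (2*t+2) + int l - 1})"

definition constrained :: "nat \<Rightarrow> (nat \<Rightarrow> real) \<Rightarrow> (nat \<Rightarrow> real) \<Rightarrow> (nat \<Rightarrow> int) \<Rightarrow> nat \<Rightarrow> (int \<Rightarrow> real) set" where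
  "constrained k \<rho> \<rho>' m l = {x \<in> het a b. \<forall>(i, \<sigma>, d)\<in>constraints k \<rho> \<rho>' m l. \<bar>x i - \<sigma>\<bar> \<le> d}"

lemma finite_constraints [simp]: "finite (constraints k \<rho> \<rho>' m l)"
  by (simp add: constraints_def)

lemma constraint_cases:
  assumes "(i, \<sigma>, d) \<in> constraints k \<rho> \<rho>' m l"
  obtains (left) t where "t \<le> 2 * k" "m (2*t+1) - int l \<le> i" "i < m (2*t+1)" "\<sigma> = side t" "d = \<rho> t"
  | (right) t where "t \<le> 2 * k" "m (2*t+2) \<le> i" "i < m (2*t+2) + int l" "\<sigma> = side (Suc t)" "d = \<rho>' t"
  using assms unfolding constraints_def by fastforce

lemma constraint_leftI:
  "t \<le> 2 * k \<Longrightarrow> m (2*t+1) - int l \<le> i \<Longrightarrow> i < m (2*t+1) \<Longrightarrow> (i, side t, \<rho> t) \<in> constraints k \<rho> \<rho>' m l"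
  unfolding constraints_def by fastforce

lemma constraint_rightI:
  "t \<le> 2 * k \<Longrightarrow> m (2*t+2) \<le> i \<Longrightarrow> i < m (2*t+2) + int l \<Longrightarrow> (i, side (Suc t), \<rho>' t) \<in> constraints k \<rho> \<rho>' m l"
  unfolding constraints_def by fastforce

lemma zone_left:
  assumes "admissible k l m" "t \<le> 2 * k" "m (2*t+1) - int l \<le> i" "i < m (2*t+1)"
  shows "zone k m t i"
  using assms admissible_gap[OF assms(1), of t] by (auto simp: zone_def)

lemma zone_right:
  assumes "admissible k l m" "t \<le> 2 * k" "m (2*t+2) \<le> i" "i < m (2*t+2) + int l"
  shows "zone k m (Suc t) i"
  using assms admissible_gap[OF assms(1), of "Suc t"] by (auto simp: zone_def)

lemma constraint_zone:
  assumes "admissible k l m" "(i, \<sigma>, d) \<in> constraints k \<rho> \<rho>' m l"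
  shows "\<exists>t. zone k m t i \<and> \<sigma> = side t"
  using assms(2)
  by (rule constraint_cases; use zone_left[OF assms(1)] zone_right[OF assms(1)] in blast)

lemma constraint_pos:
  assumes "\<And>t. t \<le> 2 * k \<Longrightarrow> 0 < \<rho> t" "\<And>t. t \<le> 2 * k \<Longrightarrow> 0 < \<rho>' t" "(i, \<sigma>, d) \<in> constraints k \<rho> \<rho>' m l"
  shows "0 < d"
  using assms(3) by (rule constraint_cases; use assms(1,2) in blast)

text \<open>All constrained sites lie in zones and ask for closeness to the well of their zone; a
  replacement that equals this well in the zones satisfies them with room to spare.\<close>

lemma constrained_glue:
  assumes adm: "admissible k l m" and pos: "\<And>t. t \<le> 2 * k \<Longrightarrow> 0 < \<rho> t" "\<And>t. t \<le> 2 * k \<Longrightarrow> 0 < \<rho>' t"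
    and x: "x \<in> constrained k \<rho> \<rho>' m l" and y: "y \<in> X"
    and val: "\<And>t i. zone k m t i \<Longrightarrow> P \<le> i \<Longrightarrow> i < Q \<Longrightarrow> y i = side t"
  shows "glue P x (glue Q y x) \<in> constrained k \<rho> \<rho>' m l"
proof -
  have "glue P x (glue Q y x) \<in> het a b"
    using x y by (auto simp: constrained_def het_def intro!: glue_tendsto_at_bot glue_tendsto_at_top)
  moreover have "\<bar>glue P x (glue Q y x) i - \<sigma>\<bar> \<le> d" if c: "(i, \<sigma>, d) \<in> constraints k \<rho> \<rho>' m l" for i \<sigma> d
  proof (cases "P \<le> i \<and> i < Q")
    case True
    obtain t where "zone k m t i" "\<sigma> = side t" using constraint_zone[OF adm c] by blast
    then have "y i = \<sigma>" using val True by blast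
    moreover have "0 < d" using constraint_pos[OF pos c] .
    ultimately show ?thesis using True by (simp add: glue_def)
  next
    case False
    then have "glue P x (glue Q y x) i = x i" by (auto simp: glue_def)
    then show ?thesis using x c by (auto simp: constrained_def)
  qed
  ultimately show ?thesis by (auto simp: constrained_def)
qed

text \<open>The comparison chain that performs every transition as a single jump at
  \<open>m (2 * t + 1)\<close>; the cardinality counts the jumps made so far.\<close>

definition step :: "nat \<Rightarrow> (nat \<Rightarrow> int) \<Rightarrow> int \<Rightarrow> real" where
  "step k m i = side (card {t. t \<le> 2 * k \<and> m (2*t+1) \<le> i})"

lemma step_zone:
  assumes adm: "admissible k l m" and z: "zone k m t i"
  shows "step k m i = side t"
proof -
  have "{t'. t' \<le> 2 * k \<and> m (2*t'+1) \<le> i} = {..<t}"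
  proof (intro equalityI subsetI)
    fix t' assume t': "t' \<in> {t'. t' \<le> 2 * k \<and> m (2*t'+1) \<le> i}"
    have False if "t \<le> t'"
    proof -
      have "m (2*t+1) \<le> m (2*t'+1)" using t' that by (intro admissible_le[OF adm]) auto
      then show False using z t' that by (auto simp: zone_def)
    qed
    then show "t' \<in> {..<t}" by force
  next
    fix t' assume t': "t' \<in> {..<t}"
    have "m (2*t'+1) \<le> m (2*t)" using t' z by (intro admissible_le[OF adm]) (auto simp: zone_def)
    then show "t' \<in> {t'. t' \<le> 2 * k \<and> m (2*t'+1) \<le> i}" using t' z by (auto simp: zone_def)
  qed
  then show ?thesis by (simp add: step_def)
qed

lemma step_box: "step k m \<in> X"
  by (simp add: step_def box_def)

lemma step_constrained:
  assumes adm: "admissible k l m" and pos: "\<And>t. t \<le> 2 * k \<Longrightarrow> 0 < \<rho> t" "\<And>t. t \<le> 2 * k \<Longrightarrow> 0 < \<rho>' t"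
  shows "step k m \<in> constrained k \<rho> \<rho>' m l"
proof -
  have "step k m i = a" if "i \<le> m 1 - 1" for i
    using step_zone[OF adm, of 0 i] that by (simp add: zone_def side_def)
  then have "(step k m \<longlongrightarrow> a) at_bot"
    by (intro tendsto_eventually eventually_mono[OF eventually_le_at_bot[of "m 1 - 1"]])
  moreover have "step k m i = b" if "m (4 * k + 2) \<le> i" for i
    using step_zone[OF adm, of "2 * k + 1" i] that by (simp add: zone_def side_def)
  then have "(step k m \<longlongrightarrow> b) at_top"
    by (intro tendsto_eventually eventually_mono[OF eventually_ge_at_top[of "m (4 * k + 2)"]])
  moreover have "\<bar>step k m i - \<sigma>\<bar> \<le> d" if c: "(i, \<sigma>, d) \<in> constraints k \<rho> \<rho>' m l" for i \<sigma> d
  proof -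
    obtain t where t: "zone k m t i" "\<sigma> = side t" using constraint_zone[OF adm c] by blast
    then show ?thesis using step_zone[OF adm t(1)] constraint_pos[OF pos c] by simp
  qed
  ultimately show ?thesis by (auto simp: constrained_def het_def step_box)
qed

text \<open>Terms whose windows meet none of the \<open>2 * k + 1\<close> jumps vanish. The bound
  does not depend on \<open>m\<close>, which allows the length of the windows to be fixed before
  \<open>m\<close> is given.\<close>

lemma E_step:
  assumes C: "\<And>x. x \<in> X \<Longrightarrow> A x \<le> C" "0 \<le> C"
  shows "E UNIV (step k m) \<le> ennreal (real ((2 * k + 1) * (2 * r + 1)) * C)"
proof (rule E_leI[OF step_box])
  fix F :: "int set" assume F: "finite F"
  define J where "J = (\<Union>t\<le>2*k. {m (2*t+1) - int r..m (2*t+1) + int r})"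
  have fin: "finite J" by (simp add: J_def)
  have "card J \<le> (\<Sum>t\<le>2*k. card {m (2*t+1) - int r..m (2*t+1) + int r})"
    unfolding J_def by (rule card_UN_le) simp
  also have "\<dots> = (2 * k + 1) * (2 * r + 1)"
    by (simp add: nat_add_distrib nat_mult_distrib algebra_simps flip: of_nat_add)
  finally have J: "card J \<le> (2 * k + 1) * (2 * r + 1)" .
  have zero: "A (tr p (step k m)) = 0" if p: "p \<notin> J" for p
  proof -
    have "A (tr p (step k m)) = A (\<lambda>_. step k m p)"
    proof (rule A_local)
      fix i assume i: "i \<in> {- int r..int r}"
      have "m (2*t+1) \<le> p + i \<longleftrightarrow> m (2*t+1) \<le> p" if "t \<le> 2 * k" for t
        using p i that unfolding J_def by force
      then have "{t. t \<le> 2 * k \<and> m (2*t+1) \<le> p + i} = {t. t \<le> 2 * k \<and> m (2*t+1) \<le> p}" by blast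
      then show "tr p (step k m) i = step k m p" by (simp add: tr_apply step_def)
    qed (simp_all add: step_box, simp add: step_def)
    also have "\<dots> = 0" using h_a h_b by (auto simp: A_const step_def side_def)
    finally show ?thesis .
  qed
  have "(\<Sum>p\<in>F. A (tr p (step k m))) = (\<Sum>p\<in>F \<inter> J. A (tr p (step k m)))"
    using F zero by (intro sum.mono_neutral_right) auto
  also have "\<dots> \<le> (\<Sum>p\<in>F \<inter> J. C)" by (intro sum_mono C) (simp add: step_box)
  also have "\<dots> = real (card (F \<inter> J)) * C" by simp
  also have "\<dots> \<le> real ((2 * k + 1) * (2 * r + 1)) * C"
  proof (rule mult_right_mono[OF _ C(2)])
    have "card (F \<inter> J) \<le> card J" using fin by (intro card_mono) auto
    then show "real (card (F \<inter> J)) \<le> real ((2 * k + 1) * (2 * r + 1))"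
      using J by (meson of_nat_le_iff order_trans)
  qed
  finally show "(\<Sum>p\<in>F. A (tr p (step k m))) \<le> real ((2 * k + 1) * (2 * r + 1)) * C" .
qed

text \<open>The constraint \<open>d\<close>, with \<open>d + \<delta> \<le> b - a\<close>, excludes
  closeness to the other well, so the whole block is close to \<open>\<sigma>\<close>.\<close>

lemma block_near:
  assumes blk: "blocks C \<delta> L"
    and x: "x \<in> X" "E UNIV x \<le> ennreal C" and Ll: "L \<le> l"
    and \<sigma>: "\<sigma> \<in> {a, b}" and d: "d + \<delta> \<le> b - a"
    and con: "\<And>i. j \<le> i \<Longrightarrow> i < j + int l \<Longrightarrow> \<bar>x i - \<sigma>\<bar> \<le> d"
  shows "\<exists>P. j + 2 * int r \<le> P \<and> P + 2 * int r < j + int l \<and> near \<delta> \<sigma> P x"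
proof -
  obtain P where P: "j + 2 * int r \<le> P" "P + 2 * int r < j + int L"
    "\<forall>p\<in>{P - 2 * int r..P + 2 * int r}. x p < a + \<delta> \<or> b - \<delta> < x p"
    using blk x unfolding blocks_def by blast
  have "near \<delta> \<sigma> P x"
    unfolding near_def
  proof
    fix p assume p: "p \<in> {P - 2 * int r..P + 2 * int r}"
    then have "\<bar>x p - \<sigma>\<bar> \<le> d" using P Ll by (intro con) auto
    moreover have "x p < a + \<delta> \<or> b - \<delta> < x p" using P(3) p by blast
    moreover have "a \<le> x p" "x p \<le> b" using x(1) by (auto simp: box_def)
    ultimately show "\<bar>x p - \<sigma>\<bar> \<le> \<delta>" using \<sigma> d by auto
  qed
  then show ?thesis using P Ll by (intro exI[of _ P]) auto
qed

text \<open>The direct method. The closed constraints survive a pointwise limit, the asymptotics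
  need not. They are restored at blocks in the first and the last window; what is cut off there lies
  in the two half-infinite zones, where the constant meets every constraint.\<close>

theorem ex_constrained_minimizer:
  assumes adm: "admissible k l m"
    and \<rho>: "\<And>t. t \<le> 2 * k \<Longrightarrow> 0 < \<rho> t \<and> \<rho> t + \<delta> \<le> b - a" "\<And>t. t \<le> 2 * k \<Longrightarrow> 0 < \<rho>' t \<and> \<rho>' t + \<delta> \<le> b - a"
    and fl: "flat \<kappa> \<delta>" and \<kappa>: "0 \<le> \<kappa>" and \<delta>: "0 \<le> \<delta>" "\<delta> < \<rho>0 / 2" and \<rho>0: "\<rho>0 < b - a"
    and exc: "\<And>\<sigma>. \<sigma> \<in> {a, b} \<Longrightarrow> excursion \<sigma> \<rho>0 \<gamma>" and \<gamma>: "2 * real r * \<kappa> \<le> \<gamma>"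
    and C: "E UNIV (step k m) \<le> ennreal C" "0 \<le> C"
    and blk: "blocks C \<delta> L" and Ll: "L \<le> l"
  shows "\<exists>U. minimizer (constrained k \<rho> \<rho>' m l) U \<and> E UNIV U \<le> ennreal C"
proof -
  let ?K = "constrained k \<rho> \<rho>' m l"
  have pos: "\<And>t. t \<le> 2 * k \<Longrightarrow> 0 < \<rho> t" "\<And>t. t \<le> 2 * k \<Longrightarrow> 0 < \<rho>' t" using \<rho> by auto
  have st: "step k m \<in> ?K" by (rule step_constrained[OF adm pos])
  define I where "I = (INF z\<in>?K. E UNIV z)"
  have I_le: "I \<le> E UNIV z" if "z \<in> ?K" for z unfolding I_def using that by (rule INF_lower)
  have IC: "I \<le> ennreal C" using I_le[OF st] C(1) by (rule order_trans)
  then have Ifin: "I < \<infinity>" by (simp add: order_le_less_trans)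
  then obtain e where e: "I = ennreal e" "0 \<le> e" by (cases I) auto
  have "\<exists>x. x \<in> ?K \<and> E UNIV x \<le> ennreal (e + 1 / real (Suc n))" for n
  proof (rule ccontr)
    assume "\<not> ?thesis"
    then have "ennreal (e + 1 / real (Suc n)) \<le> I"
      unfolding I_def by (intro INF_greatest) (auto simp: not_le intro: less_imp_le)
    then show False using e by (simp add: ennreal_le_iff)
  qed
  then obtain f where f: "\<And>n. f n \<in> ?K" "\<And>n. E UNIV (f n) \<le> ennreal (e + 1 / real (Suc n))" by metis
  have fX: "f n \<in> X" for n using f(1)[of n] by (simp add: constrained_def het_def)
  obtain x s where x: "strict_mono s" "x \<in> X" "\<And>i. (\<lambda>n. f (s n) i) \<longlonglongrightarrow> x i"
    using box_subseq[of f, OF fX] by auto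
  have s0: "(\<lambda>n. 1 / real (Suc (s n))) \<longlonglongrightarrow> 0"
    using LIMSEQ_subseq_LIMSEQ[OF LIMSEQ_inverse_real_of_nat x(1)]
    by (simp only: comp_def inverse_eq_divide)
  have Ex: "E UNIV x \<le> I"
    unfolding e(1)
  proof (rule E_lsc[OF fX x(2,3)])
    show "E UNIV (f (s n)) \<le> ennreal (e + 1 / real (Suc (s n)))" for n by (rule f(2))
    show "(\<lambda>n. e + 1 / real (Suc (s n))) \<longlonglongrightarrow> e" using tendsto_add[OF tendsto_const s0] by simp
  qed (use e in auto)
  have con: "\<bar>x i - \<sigma>\<bar> \<le> d" if c: "(i, \<sigma>, d) \<in> constraints k \<rho> \<rho>' m l" for i \<sigma> d
  proof (rule LIMSEQ_le_const2)
    show "(\<lambda>n. \<bar>f (s n) i - \<sigma>\<bar>) \<longlonglongrightarrow> \<bar>x i - \<sigma>\<bar>" by (intro tendsto_intros x)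
    show "\<exists>N. \<forall>n\<ge>N. \<bar>f (s n) i - \<sigma>\<bar> \<le> d" using f(1) c by (fastforce simp: constrained_def)
  qed
  have fin: "E UNIV x < \<infinity>" using Ex Ifin by (rule order_le_less_trans)
  have sides: "a = side 0" "b = side (Suc (2 * k))" by (simp_all add: side_def)
  have "\<exists>P. (m 1 - int l) + 2 * int r \<le> P \<and> P + 2 * int r < (m 1 - int l) + int l \<and> near \<delta> a P x"
  proof (rule block_near[OF blk x(2) _ Ll])
    show "\<bar>x i - a\<bar> \<le> \<rho> 0" if "m 1 - int l \<le> i" "i < m 1 - int l + int l" for i
      using con[OF constraint_leftI[of 0]] that sides(1) by simp
  qed (use Ex IC \<rho> in auto)
  then obtain P where P: "P + 2 * int r < m 1" "near \<delta> a P x" by auto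
  obtain y where y: "(y \<longlongrightarrow> a) at_bot" "E UNIV y \<le> E UNIV x" "y = x \<or> y = glue P (\<lambda>_. a) x"
    using repair_left[OF fl \<kappa> \<delta> insertI1 \<rho>0 exc[OF insertI1] \<gamma> x(2) fin P(2)] by auto
  have yX: "y \<in> X" using y(3) x(2) ab by auto
  have Ey: "E UNIV y \<le> ennreal C" using order_trans[OF order_trans[OF y(2) Ex] IC] .
  have cony: "\<bar>y i - \<sigma>\<bar> \<le> d" if c: "(i, \<sigma>, d) \<in> constraints k \<rho> \<rho>' m l" for i \<sigma> d
  proof (cases "y = x \<or> P \<le> i")
    case True
    then have "y i = x i" using y(3) by (auto simp: glue_def)
    then show ?thesis using con[OF c] by simp
  next
    case False
    obtain t where t: "zone k m t i" "\<sigma> = side t" using constraint_zone[OF adm c] by blast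
    have "zone k m 0 i" using False P by (auto simp: zone_def)
    then have "t = 0" using zone_unique[OF adm t(1)] by blast
    then have "\<sigma> = a" using t by (simp add: side_def)
    then show ?thesis using False y(3) constraint_pos[OF pos c] by (auto simp: glue_def)
  qed
  \<comment> \<open>The block is sought in \<open>y\<close>, since the second repair acts on the
    chain already repaired on the left.\<close>
  have "\<exists>Q. m (4*k+2) + 2 * int r \<le> Q \<and> Q + 2 * int r < m (4*k+2) + int l \<and> near \<delta> b Q y"
  proof (rule block_near[OF blk yX Ey Ll])
    show "\<bar>y i - b\<bar> \<le> \<rho>' (2 * k)" if "m (4*k+2) \<le> i" "i < m (4*k+2) + int l" for i
      using cony[OF constraint_rightI[of "2 * k"]] that sides(2) by simp
  qed (use \<rho> in auto)
  then obtain Q where Q: "m (4*k+2) + 2 * int r \<le> Q" "near \<delta> b Q y" by auto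
  have finy: "E UNIV y < \<infinity>" using y(2) fin by (rule order_le_less_trans)
  obtain z where z: "(z \<longlongrightarrow> b) at_top" "E UNIV z \<le> E UNIV y" "z = y \<or> z = glue Q y (\<lambda>_. b)"
    using repair_right[OF fl \<kappa> \<delta> _ \<rho>0 exc[OF insertI2[OF singletonI]] \<gamma> yX finy Q(2)] by auto
  have conz: "\<bar>z i - \<sigma>\<bar> \<le> d" if c: "(i, \<sigma>, d) \<in> constraints k \<rho> \<rho>' m l" for i \<sigma> d
  proof (cases "z = y \<or> i < Q")
    case True
    then have "z i = y i" using z(3) by (auto simp: glue_def)
    then show ?thesis using cony[OF c] by simp
  next
    case False
    obtain t where t: "zone k m t i" "\<sigma> = side t" using constraint_zone[OF adm c] by blast
    have "zone k m (2 * k + 1) i" using False Q by (auto simp: zone_def)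
    then have "t = 2 * k + 1" using zone_unique[OF adm t(1)] by blast
    then have "\<sigma> = b" using t by (simp add: side_def)
    then show ?thesis using False z(3) constraint_pos[OF pos c] by (auto simp: glue_def)
  qed
  have "(z \<longlongrightarrow> a) at_bot" "z \<in> X"
    using z(3) y(1) yX ab by (auto intro: glue_tendsto_at_bot)
  then have "z \<in> ?K" using z(1) conz by (auto simp: constrained_def het_def)
  moreover have "E UNIV z \<le> I" using order_trans[OF order_trans[OF z(2) y(2)] Ex] .
  moreover have "E UNIV z \<le> E UNIV z'" if "z' \<in> ?K" for z'
    using order_trans[OF \<open>E UNIV z \<le> I\<close> I_le[OF that]] .
  ultimately have "minimizer ?K z"
    using order_le_less_trans[OF \<open>E UNIV z \<le> I\<close> Ifin] unfolding minimizer_def by blast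
  moreover have "E UNIV z \<le> ennreal C" using \<open>E UNIV z \<le> I\<close> IC by (rule order_trans)
  ultimately have "minimizer ?K z \<and> E UNIV z \<le> ennreal C" ..
  then show ?thesis by blast
qed

subsection \<open>Strictness of the constraints\<close>

text \<open>Each window contains a block. A constrained site on the transition side of its block
  lies between blocks at different wells, where \<open>transition_strict\<close> applies. On the
  other side it lies between two blocks of the same zone, the second coming from the neighbouring
  window or from the asymptotics, and \<open>rest_strict\<close> applies.\<close>

lemma minimizer_strict:
  assumes adm: "admissible k l m"
    and \<rho>: "\<And>t. t \<le> 2 * k \<Longrightarrow> \<rho>0 \<le> \<rho> t \<and> \<rho> t + \<delta> \<le> b - a" "\<And>t. t \<le> 2 * k \<Longrightarrow> \<rho>0 \<le> \<rho>' t \<and> \<rho>' t + \<delta> \<le> b - a"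
    and fl: "flat \<kappa> \<delta>" and \<kappa>: "0 \<le> \<kappa>" and \<delta>: "0 < \<delta>" "\<delta> < \<rho>0 / 2"
    and exc: "\<And>\<sigma>. \<sigma> \<in> {a, b} \<Longrightarrow> excursion \<sigma> \<rho>0 \<gamma>" and \<gamma>: "12 * real r * \<kappa> < \<gamma>"
    and q: "\<And>t. t \<le> 2 * k \<Longrightarrow> minimizer (het (side t) (side (Suc t))) (q t)"
    and exq: "\<And>t x i. t \<le> 2 * k \<Longrightarrow> x \<in> het (side t) (side (Suc t)) \<Longrightarrow>
        \<bar>x i - side t\<bar> = \<rho> t \<or> \<bar>x i - side (Suc t)\<bar> = \<rho>' t \<Longrightarrow> E UNIV (q t) + ennreal \<gamma> \<le> E UNIV x"
    and R: "0 \<le> R" "\<And>t i. t \<le> 2 * k \<Longrightarrow> i \<le> - R \<Longrightarrow> \<bar>q t i - side t\<bar> \<le> \<delta>"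
      "\<And>t i. t \<le> 2 * k \<Longrightarrow> R \<le> i \<Longrightarrow> \<bar>q t i - side (Suc t)\<bar> \<le> \<delta>"
    and blk: "blocks C \<delta> L" and Ll: "L \<le> l"
    and U: "minimizer (constrained k \<rho> \<rho>' m l) U" "E UNIV U \<le> ennreal C"
    and N: "\<And>t. t \<le> 2 * k \<Longrightarrow> 2 * R + 4 * int r + 1 \<le> m (2 * t + 2) - m (2 * t + 1)"
    and c: "(i, \<sigma>, d) \<in> constraints k \<rho> \<rho>' m l"
  shows "\<bar>U i - \<sigma>\<bar> < d"
proof -
  let ?K = "constrained k \<rho> \<rho>' m l"
  have UK: "U \<in> ?K" using U(1) by (simp add: minimizer_def)
  then have UX: "U \<in> X" and Ulim: "(U \<longlongrightarrow> a) at_bot" "(U \<longlongrightarrow> b) at_top"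
    by (auto simp: constrained_def het_def)
  have Ucon: "\<bar>U i - \<sigma>\<bar> \<le> d" if "(i, \<sigma>, d) \<in> constraints k \<rho> \<rho>' m l" for i \<sigma> d
    using UK that by (auto simp: constrained_def)
  have \<delta>0: "0 \<le> \<delta>" using \<delta> by simp
  have pos: "\<And>t. t \<le> 2 * k \<Longrightarrow> 0 < \<rho> t" "\<And>t. t \<le> 2 * k \<Longrightarrow> 0 < \<rho>' t"
    using \<rho> \<delta> by force+
  have lblock: "\<exists>P. (m (2*t+1) - int l) + 2 * int r \<le> P \<and> P + 2 * int r < (m (2*t+1) - int l) + int l \<and>
      near \<delta> (side t) P U" if t: "t \<le> 2 * k" for t
  proof (rule block_near[OF blk UX U(2) Ll side_mem(1)])
    show "\<bar>U i - side t\<bar> \<le> \<rho> t" if "m (2*t+1) - int l \<le> i" "i < m (2*t+1) - int l + int l" for i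
      using Ucon[OF constraint_leftI[OF t, of m l i]] that by simp
  qed (use \<rho>(1)[OF t] in auto)
  have rblock: "\<exists>P. m (2*t+2) + 2 * int r \<le> P \<and> P + 2 * int r < m (2*t+2) + int l \<and>
      near \<delta> (side (Suc t)) P U" if t: "t \<le> 2 * k" for t
  proof (rule block_near[OF blk UX U(2) Ll side_mem(1)])
    show "\<bar>U i - side (Suc t)\<bar> \<le> \<rho>' t" if "m (2*t+2) \<le> i" "i < m (2*t+2) + int l" for i
      using Ucon[OF constraint_rightI[OF t, of m i l]] that by simp
  qed (use \<rho>(2)[OF t] in auto)
  have rest: "\<bar>U i - side t\<bar> < \<rho>0"
    if PQ: "near \<delta> (side t) P U" "near \<delta> (side t) Q U" "P \<le> i" "i < Q"
      and z: "zone k m t P" "zone k m t (Q - 1)" for t P Q i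
  proof (rule rest_strict[OF fl \<kappa> \<delta>0 \<delta>(2) side_mem(1) exc[OF side_mem(1)] _ U(1) UX PQ])
    show "4 * real r * \<kappa> < \<gamma>"
      using \<gamma> mult_nonneg_nonneg[of "real r" \<kappa>] \<kappa> by linarith
    show "glue P U (glue Q (\<lambda>_. side t) U) \<in> ?K"
    proof (rule constrained_glue[OF adm pos UK])
      fix t' j assume "zone k m t' j" "P \<le> j" "j < Q"
      moreover from this have "zone k m t j" using z by (auto simp: zone_def)
      ultimately show "side t = side t'" using zone_unique[OF adm] by blast
    qed simp_all
  qed
  have trans: "\<bar>U i - side t\<bar> \<noteq> \<rho> t \<and> \<bar>U i - side (Suc t)\<bar> \<noteq> \<rho>' t"
    if t: "t \<le> 2 * k" and P: "(m (2*t+1) - int l) + 2 * int r \<le> P" "P + 2 * int r < m (2*t+1)" "near \<delta> (side t) P U"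
      and Q: "m (2*t+2) + 2 * int r \<le> Q" "Q + 2 * int r < m (2*t+2) + int l" "near \<delta> (side (Suc t)) Q U"
      and i: "P \<le> i" "i < Q" for t P Q i
  proof -
    define P0 Q0 where "P0 = m (2*t+1)" and "Q0 = m (2*t+2)"
    \<comment> \<open>This translate places the core \<open>{- R..R}\<close> of the heteroclinic to
      the right of the block at \<open>P0\<close>; the lower bound on \<open>Q0 - P0\<close> lets it
      end before the block at \<open>Q0\<close>.\<close>
    define w where "w = tr (- (P0 + R + 2 * int r)) (q t)"
    \<comment> \<open>Cutting at \<open>P0\<close> and \<open>Q0\<close> makes the replacement equal
      to the wells throughout both zones, whatever windows they contain.\<close>
    define y where "y = glue P0 (\<lambda>_. side t) (glue Q0 w (\<lambda>_. side (Suc t)))"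
    have N': "2 * R + 4 * int r + 1 \<le> Q0 - P0" using N[OF t] by (simp add: P0_def Q0_def)
    have qX: "q t \<in> X" using q[OF t] by (simp add: minimizer_def het_def)
    then have wX: "w \<in> X" by (simp add: w_def)
    have yX: "y \<in> X" using wX by (simp add: y_def)
    have nw: "near \<delta> (side t) P0 w" "near \<delta> (side (Suc t)) Q0 w"
      using R(2,3)[OF t] N' by (auto simp: near_def w_def tr_apply)
    have "E UNIV y \<le> E {P0..<Q0} w + ennreal (4 * real r * \<kappa>)"
      unfolding y_def using N' R(1) by (intro E_cut_both[OF fl \<kappa> \<delta>0 side_mem(1) side_mem(1) wX nw]) auto
    also have "E {P0..<Q0} w \<le> E UNIV w" by (rule E_mono) auto
    finally have Ey: "E UNIV y \<le> E UNIV (q t) + ennreal (4 * real r * \<kappa>)"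
      by (simp add: w_def E_tr add_right_mono)
    have ny: "near \<delta> (side t) P y" "near \<delta> (side (Suc t)) Q y"
      using P Q \<delta>0 N' R(1) by (auto simp: near_def y_def glue_def P0_def Q0_def)
    have zP: "zone k m t P" by (rule zone_left[OF adm t]) (use P in auto)
    have zQ: "zone k m (Suc t) Q" by (rule zone_right[OF adm t]) (use Q in auto)
    have K: "glue P U (glue Q y U) \<in> ?K"
    proof (rule constrained_glue[OF adm pos UK yX])
      fix t' j assume z: "zone k m t' j" and j: "P \<le> j" "j < Q"
      have "t \<le> t'" "t' \<le> Suc t" using zone_mono[OF adm zP z] zone_mono[OF adm z zQ] j by auto
      then consider "t' = t" | "t' = Suc t" by linarith
      then show "y j = side t'"
      proof cases
        case 1
        then have "j < P0" using z t by (auto simp: zone_def P0_def)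
        then show ?thesis using 1 by (simp add: y_def glue_def)
      next
        case 2
        then have "Q0 \<le> j" using z by (auto simp: zone_def Q0_def)
        then show ?thesis using 2 N' R(1) by (simp add: y_def glue_def)
      qed
    qed
    have PQ: "P + 2 * int r < Q" using P Q N[OF t] R(1) by linarith
    show ?thesis
      by (intro conjI transition_strict[OF fl \<kappa> \<delta>0 side_mem(1) side_mem(1) q[OF t] _ \<gamma> U(1) UX
            P(3) Q(3) i PQ yX Ey ny K] exq[OF t]) auto
  qed
  from c show ?thesis
  proof (cases rule: constraint_cases)
    case (left t)
    obtain P where P: "(m (2*t+1) - int l) + 2 * int r \<le> P" "P + 2 * int r < m (2*t+1)" "near \<delta> (side t) P U"
      using lblock[OF left(1)] by auto
    obtain Q where Q: "m (2*t+2) + 2 * int r \<le> Q" "Q + 2 * int r < m (2*t+2) + int l" "near \<delta> (side (Suc t)) Q U"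
      using rblock[OF left(1)] by auto
    show ?thesis
    proof (cases "P \<le> i")
      case True
      have "i < Q" using left Q N[OF left(1)] R(1) by linarith
      then have "\<bar>U i - side t\<bar> \<noteq> \<rho> t" using trans[OF left(1) P Q True] by blast
      then show ?thesis using Ucon[OF c] left by simp
    next
      case False
      have zP: "zone k m t (P - 1)" 
        by (rule zone_left[OF adm left(1)]) (use P r in auto)
      obtain P' where P': "P' \<le> i" "near \<delta> (side t) P' U" "zone k m t P'"
      proof (cases t)
        case 0
        obtain P' where "P' + 2 * int r < i" "near \<delta> a P' U" using ex_near_at_bot[OF Ulim(1) \<delta>(1)] by blast
        then show ?thesis using that[of P'] 0 left by (auto simp: side_def zone_def)
      next
        case (Suc t')
        then have t': "t' \<le> 2 * k" using left by simp
        obtain P' where P'': "m (2*t'+2) + 2 * int r \<le> P'" "P' + 2 * int r < m (2*t'+2) + int l"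
            "near \<delta> (side (Suc t')) P' U"
          using rblock[OF t'] by auto
        have "zone k m (Suc t') P'" by (rule zone_right[OF adm t']) (use P'' in auto)
        moreover have "P' \<le> i" using P'' left admissible_gap[OF adm, of t] Suc by auto
        ultimately show ?thesis using that[of P'] P'' Suc by simp
      qed
      have "\<bar>U i - side t\<bar> < \<rho>0"
        using rest[OF P'(2) P(3) P'(1) _ P'(3) zP] False by simp
      then show ?thesis using \<rho>(1)[OF left(1)] left by simp
    qed
  next
    case (right t)
    obtain P where P: "(m (2*t+1) - int l) + 2 * int r \<le> P" "P + 2 * int r < m (2*t+1)" "near \<delta> (side t) P U"
      using lblock[OF right(1)] by auto
    obtain Q where Q: "m (2*t+2) + 2 * int r \<le> Q" "Q + 2 * int r < m (2*t+2) + int l" "near \<delta> (side (Suc t)) Q U"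
      using rblock[OF right(1)] by auto
    show ?thesis
    proof (cases "i < Q")
      case True
      have "P \<le> i" using right P N[OF right(1)] R(1) by linarith
      then have "\<bar>U i - side (Suc t)\<bar> \<noteq> \<rho>' t" using trans[OF right(1) P Q _ True] by blast
      then show ?thesis using Ucon[OF c] right by simp
    next
      case False
      have zQ: "zone k m (Suc t) Q"
        by (rule zone_right[OF adm right(1)]) (use Q in auto)
      obtain Q' where Q': "i < Q'" "near \<delta> (side (Suc t)) Q' U" "zone k m (Suc t) (Q' - 1)"
      proof (cases "t = 2 * k")
        case True
        obtain Q' where "i < Q' - 2 * int r" "near \<delta> b Q' U" using ex_near_at_top[OF Ulim(2) \<delta>(1)] by blast
        then show ?thesis using that[of Q'] True right by (auto simp: side_def zone_def)
      next
        case False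
        then have t': "Suc t \<le> 2 * k" using right by simp
        obtain Q' where Q'': "(m (2*Suc t+1) - int l) + 2 * int r \<le> Q'" "Q' + 2 * int r < m (2*Suc t+1)"
            "near \<delta> (side (Suc t)) Q' U"
          using lblock[OF t'] by auto
        have "zone k m (Suc t) (Q' - 1)" by (rule zone_left[OF adm t']) (use Q'' r in auto)
        moreover have "i < Q'" using Q'' right admissible_gap[OF adm, of "Suc t"] t' by auto
        ultimately show ?thesis using that[of Q'] Q'' by simp
      qed
      have "\<bar>U i - side (Suc t)\<bar> < \<rho>0"
        using rest[OF Q(3) Q'(2) _ Q'(1) zQ Q'(3)] False by simp
      then show ?thesis using \<rho>(2)[OF right(1)] right by simp
    qed
  qed
qed

lemma A_bounded: "\<exists>C>0. \<forall>x\<in>X. A x \<le> C"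
  using seq_cont_bounded[OF seq_cont_A] by (meson abs_le_D1)

text \<open>The gain \<open>\<gamma>\<close> is fixed first, then the gluing price
  \<open>\<kappa>\<close>, the closeness \<open>\<delta>\<close>, the energy bound \<open>C\<close>,
  the window length \<open>L\<close>, and the core radius \<open>R\<close> of the heteroclinics.
  None of them depends on \<open>m\<close>.\<close>

theorem constrained_minimizers:
  assumes q: "\<And>t. minimizer (het (side t) (side (Suc t))) (q t)"
    and \<rho>: "\<And>t. 0 < \<rho> t \<and> \<rho> t < b - a" "\<And>t. 0 < \<rho>' t \<and> \<rho>' t < b - a"
    and avoid: "\<And>t x. minimizer (het (side t) (side (Suc t))) x \<Longrightarrow>
        \<bar>x 0 - side t\<bar> \<noteq> \<rho> t \<and> \<bar>x 0 - side (Suc t)\<bar> \<noteq> \<rho>' t"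
  shows "\<exists>L. \<forall>l\<ge>L. \<exists>N. \<forall>m. admissible k l m \<longrightarrow> (\<exists>U. minimizer (constrained k \<rho> \<rho>' m l) U \<and>
    ((\<forall>t\<le>2*k. N \<le> m (2*t+2) - m (2*t+1)) \<longrightarrow> (\<forall>(i, \<sigma>, d)\<in>constraints k \<rho> \<rho>' m l. \<bar>U i - \<sigma>\<bar> < d)))"
proof -
  define D where "D = \<rho> ` {..2*k} \<union> \<rho>' ` {..2*k}"
  have D: "finite D" "D \<noteq> {}" "\<And>d. d \<in> D \<Longrightarrow> 0 < d \<and> d < b - a" using \<rho> by (auto simp: D_def)
  have inD: "t \<le> 2 * k \<Longrightarrow> \<rho> t \<in> D" "t \<le> 2 * k \<Longrightarrow> \<rho>' t \<in> D" for t by (auto simp: D_def)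
  define \<rho>0 where "\<rho>0 = Min D"
  have \<rho>0: "0 < \<rho>0" "\<rho>0 < b - a" "\<And>d. d \<in> D \<Longrightarrow> \<rho>0 \<le> d"
    using D Min_in[OF D(1,2)] by (auto simp: \<rho>0_def)
  have "\<exists>\<gamma>>0. \<forall>x\<in>het (side t) (side (Suc t)). \<forall>i. \<bar>x i - side t\<bar> = \<rho> t \<or> \<bar>x i - side (Suc t)\<bar> = \<rho>' t \<longrightarrow>
      E UNIV (q t) + ennreal \<gamma> \<le> E UNIV x" for t
  proof -
    obtain \<gamma>1 where \<gamma>1: "\<gamma>1 > 0" "\<forall>x\<in>het (side t) (side (Suc t)). \<forall>i. \<bar>x i - side t\<bar> = \<rho> t \<longrightarrow>
        E UNIV (q t) + ennreal \<gamma>1 \<le> E UNIV x"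
      using strict_excess[OF side_Suc q side_mem(1)[of t], of "\<rho> t"] \<rho>(1)[of t] avoid by blast
    obtain \<gamma>2 where \<gamma>2: "\<gamma>2 > 0" "\<forall>x\<in>het (side t) (side (Suc t)). \<forall>i. \<bar>x i - side (Suc t)\<bar> = \<rho>' t \<longrightarrow>
        E UNIV (q t) + ennreal \<gamma>2 \<le> E UNIV x"
      using strict_excess[OF side_Suc q side_mem(1)[of "Suc t"], of "\<rho>' t"] \<rho>(2)[of t] avoid by blast
    have "E UNIV (q t) + ennreal (min \<gamma>1 \<gamma>2) \<le> E UNIV (q t) + ennreal \<gamma>1"
      "E UNIV (q t) + ennreal (min \<gamma>1 \<gamma>2) \<le> E UNIV (q t) + ennreal \<gamma>2"
      by (intro add_left_mono ennreal_leI; simp)+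
    note le = order_trans[OF this(1)] order_trans[OF this(2)]
    have "E UNIV (q t) + ennreal (min \<gamma>1 \<gamma>2) \<le> E UNIV x"
      if "x \<in> het (side t) (side (Suc t))" "\<bar>x i - side t\<bar> = \<rho> t \<or> \<bar>x i - side (Suc t)\<bar> = \<rho>' t" for x i
      using that(2)
    proof
      assume "\<bar>x i - side t\<bar> = \<rho> t"
      with \<gamma>1(2) that(1) show ?thesis by (intro le(1)) blast
    next
      assume "\<bar>x i - side (Suc t)\<bar> = \<rho>' t"
      with \<gamma>2(2) that(1) show ?thesis by (intro le(2)) blast
    qed
    then show ?thesis using \<gamma>1(1) \<gamma>2(1) by (intro exI[of _ "min \<gamma>1 \<gamma>2"]) simp
  qed
  then obtain \<gamma>s where \<gamma>s: "\<And>t. \<gamma>s t > 0" "\<And>t x i. x \<in> het (side t) (side (Suc t)) \<Longrightarrow>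
      \<bar>x i - side t\<bar> = \<rho> t \<or> \<bar>x i - side (Suc t)\<bar> = \<rho>' t \<Longrightarrow> E UNIV (q t) + ennreal (\<gamma>s t) \<le> E UNIV x"
    by metis
  obtain \<gamma>a where \<gamma>a: "\<gamma>a > 0" "excursion a \<rho>0 \<gamma>a"
    using ex_excursion[of a \<rho>0] \<rho>0 by auto
  obtain \<gamma>b where \<gamma>b: "\<gamma>b > 0" "excursion b \<rho>0 \<gamma>b"
    using ex_excursion[of b \<rho>0] \<rho>0 by auto
  define G where "G = insert \<gamma>a (insert \<gamma>b (\<gamma>s ` {..2*k}))"
  define \<gamma> where "\<gamma> = Min G"
  have G: "finite G" "G \<noteq> {}" by (auto simp: G_def)
  have "\<gamma> \<in> G" unfolding \<gamma>_def by (rule Min_in[OF G])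
  moreover have "\<gamma> \<le> c" if "c \<in> G" for c unfolding \<gamma>_def using G(1) that by (rule Min_le)
  ultimately have \<gamma>: "\<gamma> > 0" "\<gamma> \<le> \<gamma>a" "\<gamma> \<le> \<gamma>b" "\<And>t. t \<le> 2 * k \<Longrightarrow> \<gamma> \<le> \<gamma>s t"
    using \<gamma>a(1) \<gamma>b(1) \<gamma>s(1) by (auto simp: G_def)
  have exc: "excursion \<sigma> \<rho>0 \<gamma>" if "\<sigma> \<in> {a, b}" for \<sigma>
    using that excursion_mono[OF \<gamma>a(2) \<gamma>(2)] excursion_mono[OF \<gamma>b(2) \<gamma>(3)] by auto
  have exq: "E UNIV (q t) + ennreal \<gamma> \<le> E UNIV x"
    if "t \<le> 2 * k" "x \<in> het (side t) (side (Suc t))"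
      "\<bar>x i - side t\<bar> = \<rho> t \<or> \<bar>x i - side (Suc t)\<bar> = \<rho>' t" for t x i
    using \<gamma>s(2)[OF that(2,3)] \<gamma>(4)[OF that(1)]
    by (meson add_left_mono ennreal_leI order_trans)
  \<comment> \<open>The factor \<open>16\<close> leaves room for the three exchanges, which together
    cost \<open>12 * r * \<kappa>\<close>, three quarters of \<open>\<gamma>\<close>.\<close>
  define \<kappa> where "\<kappa> = \<gamma> / (16 * real r)"
  have \<kappa>: "\<kappa> > 0" "12 * real r * \<kappa> < \<gamma>" "2 * real r * \<kappa> \<le> \<gamma>" using \<gamma> r by (auto simp: \<kappa>_def field_simps)
  obtain \<delta>0 where \<delta>0: "\<delta>0 > 0" "flat \<kappa> \<delta>0" using ex_flat[OF \<kappa>(1)] by blast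
  \<comment> \<open>Closeness to a well must make \<open>A\<close> at most \<open>\<kappa>\<close>,
    put a block inside the start of an excursion, and be incompatible with a constraint at the other
    well.\<close>
  define \<delta> where "\<delta> = min \<delta>0 (min (\<rho>0 / 4) (Min ((\<lambda>d. b - a - d) ` D)))"
  have "Min ((\<lambda>d. b - a - d) ` D) \<in> (\<lambda>d. b - a - d) ` D" using D by (intro Min_in) auto
  then have "0 < Min ((\<lambda>d. b - a - d) ` D)" using D(3) by auto
  then have \<delta>: "0 < \<delta>" "\<delta> < \<rho>0 / 2" "flat \<kappa> \<delta>"
    using \<delta>0 \<rho>0 flat_mono[OF \<delta>0(2), of \<delta>] by (auto simp: \<delta>_def)
  have \<delta>D: "d + \<delta> \<le> b - a" if "d \<in> D" for d
  proof -
    have "Min ((\<lambda>d. b - a - d) ` D) \<le> b - a - d" using D(1) that by (intro Min_le) auto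
    then show ?thesis by (simp add: \<delta>_def)
  qed
  obtain CA where CA: "CA > 0" "\<And>x. x \<in> X \<Longrightarrow> A x \<le> CA" using A_bounded by blast
  define C where "C = real ((2 * k + 1) * (2 * r + 1)) * CA"
  have C: "0 \<le> C" "E UNIV (step k m) \<le> ennreal C" for m
    using CA E_step[OF CA(2), of k m] by (auto simp: C_def)
  obtain L where L: "blocks C \<delta> L" using ex_blocks[OF \<delta>(1)] by blast
  have "\<exists>R. \<forall>i. (i \<le> - R \<longrightarrow> \<bar>q t i - side t\<bar> \<le> \<delta>) \<and> (R \<le> i \<longrightarrow> \<bar>q t i - side (Suc t)\<bar> \<le> \<delta>)" for t
  proof -
    have lim: "(q t \<longlongrightarrow> side t) at_bot" "(q t \<longlongrightarrow> side (Suc t)) at_top"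
      using q[of t] by (auto simp: minimizer_def het_def)
    obtain R1 where R1: "\<And>i. i \<le> R1 \<Longrightarrow> \<bar>q t i - side t\<bar> < \<delta>"
      using tendstoD[OF lim(1) \<delta>(1)] by (auto simp: eventually_at_bot_linorder dist_real_def)
    obtain R2 where R2: "\<And>i. R2 \<le> i \<Longrightarrow> \<bar>q t i - side (Suc t)\<bar> < \<delta>"
      using tendstoD[OF lim(2) \<delta>(1)] by (auto simp: eventually_at_top_linorder dist_real_def)
    show ?thesis
      by (rule exI[of _ "max (- R1) R2"]) (use R1 R2 in \<open>auto intro!: less_imp_le\<close>)
  qed
  then obtain Rs where Rs: "\<And>t i. i \<le> - Rs t \<Longrightarrow> \<bar>q t i - side t\<bar> \<le> \<delta>"
    "\<And>t i. Rs t \<le> i \<Longrightarrow> \<bar>q t i - side (Suc t)\<bar> \<le> \<delta>" by metis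
  define R where "R = Max (insert 0 (Rs ` {..2*k}))"
  have R: "0 \<le> R" "\<And>t. t \<le> 2 * k \<Longrightarrow> Rs t \<le> R" unfolding R_def by (rule Max_ge; simp)+
  show ?thesis
  proof (intro exI[of _ L] allI impI exI[of _ "2 * R + 4 * int r + 1"])
    fix l m assume l: "L \<le> l" and adm: "admissible k l m"
    have \<rho>\<delta>: "0 < \<rho> t \<and> \<rho> t + \<delta> \<le> b - a" "0 < \<rho>' t \<and> \<rho>' t + \<delta> \<le> b - a" if "t \<le> 2 * k" for t
      using \<delta>D inD[OF that] \<rho> by auto
    have "\<exists>U. minimizer (constrained k \<rho> \<rho>' m l) U \<and> E UNIV U \<le> ennreal C"
      by (rule ex_constrained_minimizer[OF adm _ _ \<delta>(3) less_imp_le[OF \<kappa>(1)] less_imp_le[OF \<delta>(1)] \<delta>(2) \<rho>0(2)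
          _ \<kappa>(3) C(2,1) L l]) (erule \<rho>\<delta> exc)+
    then obtain U where U: "minimizer (constrained k \<rho> \<rho>' m l) U" "E UNIV U \<le> ennreal C" by blast
    have "\<bar>U i - \<sigma>\<bar> < d" if N: "\<forall>t\<le>2*k. 2 * R + 4 * int r + 1 \<le> m (2*t+2) - m (2*t+1)"
      and c: "(i, \<sigma>, d) \<in> constraints k \<rho> \<rho>' m l" for i \<sigma> d
    proof (rule minimizer_strict[OF adm _ _ \<delta>(3) less_imp_le[OF \<kappa>(1)] \<delta>(1,2) exc \<kappa>(2) q exq R(1) _ _ L l U _ c])
      show "\<rho>0 \<le> \<rho> t \<and> \<rho> t + \<delta> \<le> b - a" "\<rho>0 \<le> \<rho>' t \<and> \<rho>' t + \<delta> \<le> b - a" if "t \<le> 2 * k" for t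
        using \<rho>\<delta>[OF that] inD[OF that] \<rho>0(3) by auto
      show "\<bar>q t i - side t\<bar> \<le> \<delta>" if "t \<le> 2 * k" "i \<le> - R" for t i
        using Rs(1)[of i t] R(2)[OF that(1)] that by simp
      show "\<bar>q t i - side (Suc t)\<bar> \<le> \<delta>" if "t \<le> 2 * k" "R \<le> i" for t i
        using Rs(2)[of t i] R(2)[OF that(1)] that by simp
    qed (use N in auto)
    with U show "\<exists>U. minimizer (constrained k \<rho> \<rho>' m l) U \<and>
      ((\<forall>t\<le>2*k. 2 * R + 4 * int r + 1 \<le> m (2*t+2) - m (2*t+1)) \<longrightarrow>
       (\<forall>(i, \<sigma>, d)\<in>constraints k \<rho> \<rho>' m l. \<bar>U i - \<sigma>\<bar> < d))"
      by blast
  qed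
qed

section \<open>Minimality with respect to a single site of the chain\<close>

definition local_energy :: "int \<Rightarrow> (int \<Rightarrow> real) \<Rightarrow> real" where
  "local_energy p x = (\<Sum>n = p - int r..p + int r. h (tr n x))"

text \<open>The part cut off by truncating at a well is a finite perturbation of a constant ground
  state, so its energy is nonnegative by the sorting argument.\<close>

lemma bump_sum_nonneg:
  assumes \<sigma>: "\<sigma> \<in> {a, b}"
  shows "0 \<le> local_energy p ((\<lambda>_. \<sigma>)(p := \<tau>))"
proof -
  \<comment> \<open>With period \<open>2 * r + 1\<close> the copies of the bump do not interact:
    every window contains exactly one of them.\<close>
  define N where "N = 2 * r + 1"
  define y where "y i = (if (i - int r) mod int N = 0 then \<tau> else \<sigma>)" for i
  have "0 \<le> (\<Sum>j<N. h (\<lambda>_. y (int j)))" by (intro sum_nonneg h_nonneg)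
  also have "\<dots> \<le> (\<Sum>j<N. h (tr (int j) y))"
    unfolding tr_def
  proof (rule periodic_sum_ge_constants[OF sub])
    fix i
    have "i + int N - int r = (i - int r) + int N" by simp
    then show "y (i + int N) = y i" unfolding y_def by (metis mod_add_self2)
  qed simp
  also have "\<dots> = (\<Sum>j<N. h (tr (p - int r + int j) ((\<lambda>_. \<sigma>)(p := \<tau>))))"
  proof (rule sum.cong[OF refl], rule local)
    fix j i assume j: "j \<in> {..<N}" and i: "i \<in> {- int r..int r}"
    have "(int j + i - int r) mod int N = 0 \<longleftrightarrow> int j + i - int r = 0"
    proof
      assume "(int j + i - int r) mod int N = 0"
      then obtain c where c: "int j + i - int r = int N * c" by (auto simp: dvd_def simp flip: dvd_eq_mod_eq_0)
      have "\<bar>int j + i - int r\<bar> < int N" using j i by (auto simp: N_def)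
      then have "int N * \<bar>c\<bar> < int N * 1" unfolding c by (simp add: abs_mult)
      then have "c = 0" by (simp add: N_def)
      then show "int j + i - int r = 0" using c by simp
    qed simp
    then show "tr (int j) y i = tr (p - int r + int j) ((\<lambda>_. \<sigma>)(p := \<tau>)) i"
      by (auto simp: tr_apply y_def)
  qed
  also have "\<dots> = local_energy p ((\<lambda>_. \<sigma>)(p := \<tau>))"
    unfolding local_energy_def
    by (rule sum.reindex_bij_witness[of _ "\<lambda>n. nat (n - p + int r)" "\<lambda>j. p - int r + int j"]) (auto simp: N_def)
  finally show ?thesis .
qed

text \<open>Submodularity applied to the chain and the constant \<open>\<sigma>\<close>, which has
  no energy: their \<open>sup\<close> and \<open>inf\<close> are the truncated chain and a single
  bump on the well, and the bump has nonnegative energy.\<close>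

lemma truncation_sum_le:
  assumes x: "x \<in> X" and \<tau>: "\<tau> < a \<and> \<sigma> = a \<or> b < \<tau> \<and> \<sigma> = b"
  shows "local_energy p (x(p := \<sigma>)) \<le> local_energy p (x(p := \<tau>))"
proof -
  have xb: "a \<le> x i" "x i \<le> b" for i using x by (auto simp: box_def)
  have "h (tr n (x(p := \<sigma>))) + h (tr n ((\<lambda>_. \<sigma>)(p := \<tau>))) \<le> h (tr n (x(p := \<tau>)))" for n
  proof -
    let ?u = "tr n (x(p := \<tau>))" and ?c = "\<lambda>_::int. \<sigma>"
    have "h (sup ?u ?c) + h (inf ?u ?c) \<le> h ?u + h ?c"
      using sub unfolding submodular_on_def by blast
    moreover have "h ?c = 0" using \<tau> h_a h_b by auto
    moreover have "{sup ?u ?c, inf ?u ?c} = {tr n (x(p := \<sigma>)), tr n ((\<lambda>_. \<sigma>)(p := \<tau>))}"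
    proof (cases "\<sigma> = a")
      case True
      then have "\<tau> < a" using \<tau> ab by auto
      then have "sup ?u ?c = tr n (x(p := \<sigma>))" "inf ?u ?c = tr n ((\<lambda>_. \<sigma>)(p := \<tau>))"
        using True xb by (auto simp: fun_eq_iff sup_max inf_min tr_apply)
      then show ?thesis by simp
    next
      case False
      then have "b < \<tau>" "\<sigma> = b" using \<tau> by auto
      then have "inf ?u ?c = tr n (x(p := \<sigma>))" "sup ?u ?c = tr n ((\<lambda>_. \<sigma>)(p := \<tau>))"
        using xb by (auto simp: fun_eq_iff sup_max inf_min tr_apply)
      then show ?thesis by auto
    qed
    ultimately show ?thesis by (auto simp: doubleton_eq_iff)
  qed
  then have "local_energy p (x(p := \<sigma>)) + local_energy p ((\<lambda>_. \<sigma>)(p := \<tau>)) \<le> local_energy p (x(p := \<tau>))"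
    unfolding local_energy_def sum.distrib[symmetric] by (rule sum_mono)
  then show ?thesis using bump_sum_nonneg[of \<sigma> p \<tau>] \<tau> by auto
qed

lemma sum_h_telescope:
  "(\<Sum>n = c..c + int j. h (tr n x)) = (\<Sum>n = c..c + int j. A (tr n x)) + V (tr (c + int j + 1) x) - V (tr c x)"
proof (induction j)
  case (Suc j)
  have "{c..c + int (Suc j)} = insert (c + int j + 1) {c..c + int j}" by auto
  then show ?case using Suc by (simp add: A_def algebra_simps)
qed (simp add: A_def add.commute)

text \<open>Terms that do not see \<open>p\<close> cancel. The boundary values of \<open>V\<close>
  see the \<open>2 * r\<close> sites just before \<open>p\<close> and the \<open>2 * r\<close> sites
  just after it, hence agree for both chains, and \<open>A\<close> can be turned back into
  \<open>h\<close>.\<close>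

lemma E_le_imp_sum_le:
  assumes xy: "x \<in> X" "y \<in> X" and eq: "\<And>i. i \<noteq> p \<Longrightarrow> x i = y i"
    and fin: "E UNIV x < \<infinity>" and le: "E UNIV x \<le> E UNIV y"
  shows "local_energy p x \<le> local_energy p y"
proof -
  let ?I = "{p - int r..p + int r}"
  have out: "E (- ?I) x = E (- ?I) y"
    by (rule E_cong, rule A_local) (use xy in \<open>auto simp: tr_apply intro!: eq\<close>)
  have UN: "E UNIV z = E (- ?I) z + E ?I z" for z
    using E_Un[of "- ?I" ?I z] by simp
  have "E (- ?I) x < \<infinity>" using fin UN[of x] by (simp add: less_top[symmetric])
  then have "E ?I x \<le> E ?I y" using le unfolding UN out by (auto simp: less_top[symmetric])
  then have le: "(\<Sum>n\<in>?I. A (tr n x)) \<le> (\<Sum>n\<in>?I. A (tr n y))"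
    using xy by (simp add: E_finite ennreal_le_iff sum_nonneg A_nonneg)
  have I: "?I = {p - int r..(p - int r) + int (2 * r)}" by auto
  have "V (tr (p - int r) x) = V (tr (p - int r) y)"
    "V (tr (p - int r + int (2 * r) + 1) x) = V (tr (p - int r + int (2 * r) + 1) y)"
    by (rule V_local; use xy in \<open>auto simp: tr_apply intro!: eq\<close>)+
  then show ?thesis using le unfolding local_energy_def I sum_h_telescope by simp
qed

text \<open>Variations within \<open>[a, b]\<close> are admissible by the slack of the constraints.
  A variation beyond an obstacle is no competitor, but its truncation at the well is one and does
  not have more local energy.\<close>

lemma constrained_local_min:
  assumes U: "minimizer (constrained k \<rho> \<rho>' m l) U"
    and strict: "\<forall>(i, \<sigma>, d)\<in>constraints k \<rho> \<rho>' m l. \<bar>U i - \<sigma>\<bar> < d"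
  shows "\<exists>\<eta>>0. \<forall>\<tau>. \<bar>\<tau> - U p\<bar> < \<eta> \<longrightarrow>
    local_energy p U \<le> local_energy p (U(p := \<tau>))"
proof -
  let ?C = "constraints k \<rho> \<rho>' m l"
  have UX: "U \<in> X" and Ulim: "(U \<longlongrightarrow> a) at_bot" "(U \<longlongrightarrow> b) at_top"
    using U by (auto simp: minimizer_def constrained_def het_def)
  \<comment> \<open>The smallest slack; the element \<open>1\<close> keeps the set nonempty when
    there are no constraints.\<close>
  define \<eta> where "\<eta> = Min (insert 1 ((\<lambda>(i, \<sigma>, d). d - \<bar>U i - \<sigma>\<bar>) ` ?C))"
  have \<eta>: "\<eta> > 0" unfolding \<eta>_def using strict by (subst Min_gr_iff) auto
  have \<eta>C: "\<eta> \<le> d - \<bar>U i - \<sigma>\<bar>" if "(i, \<sigma>, d) \<in> ?C" for i \<sigma> d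
    unfolding \<eta>_def using that by (intro Min_le) force+
  have inner: "local_energy p U \<le> local_energy p (U(p := \<tau>))"
    if \<tau>: "\<bar>\<tau> - U p\<bar> < \<eta>" "a \<le> \<tau>" "\<tau> \<le> b" for \<tau>
  proof -
    have X': "U(p := \<tau>) \<in> X" using UX \<tau> by (auto simp: box_def)
    have "\<bar>(U(p := \<tau>)) i - \<sigma>\<bar> \<le> d" if "(i, \<sigma>, d) \<in> ?C" for i \<sigma> d
      using \<eta>C[OF that] \<tau> by auto
    moreover have "(U(p := \<tau>) \<longlongrightarrow> a) at_bot"
    proof (rule Lim_transform_eventually[OF Ulim(1)])
      show "\<forall>\<^sub>F i in at_bot. U i = (U(p := \<tau>)) i"
        using eventually_le_at_bot[of "p - 1"] by eventually_elim auto
    qed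
    moreover have "(U(p := \<tau>) \<longlongrightarrow> b) at_top"
    proof (rule Lim_transform_eventually[OF Ulim(2)])
      show "\<forall>\<^sub>F i in at_top. U i = (U(p := \<tau>)) i"
        using eventually_ge_at_top[of "p + 1"] by eventually_elim auto
    qed
    ultimately have "U(p := \<tau>) \<in> constrained k \<rho> \<rho>' m l"
      using X' by (auto simp: constrained_def het_def)
    then have "E UNIV U \<le> E UNIV (U(p := \<tau>))" using U by (auto simp: minimizer_def)
    then show ?thesis using U UX X' by (intro E_le_imp_sum_le) (auto simp: minimizer_def)
  qed
  have "local_energy p U \<le> local_energy p (U(p := \<tau>))"
    if \<tau>: "\<bar>\<tau> - U p\<bar> < \<eta>" for \<tau>
  proof -
    have Up: "a \<le> U p" "U p \<le> b" using UX by (auto simp: box_def)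
    consider "a \<le> \<tau>" "\<tau> \<le> b" | "\<tau> < a" | "b < \<tau>" by linarith
    then show ?thesis
    proof cases
      case 2
      \<comment> \<open>The obstacle lies between \<open>\<tau>\<close> and \<open>U p\<close>, so
        it is within \<open>\<eta>\<close> of \<open>U p\<close> as well.\<close>
      then show ?thesis using order_trans[OF inner[of a] truncation_sum_le[OF UX, of \<tau> a p]] \<tau> Up ab by auto
    next
      case 3
      then show ?thesis using order_trans[OF inner[of b] truncation_sum_le[OF UX, of \<tau> b p]] \<tau> Up ab by auto
    qed (use inner \<tau> in auto)
  qed
  with \<eta> show ?thesis by blast
qed

end

subsection \<open>Reduction of the lattice model to a chain\<close>

lemma enn2ereal_add_le_cancel:
  assumes "enn2ereal e + ereal c \<le> enn2ereal e' + ereal c"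
  shows "e \<le> e'"
  using assms by (simp add: less_eq_ennreal.rep_eq ereal_add_le_add_iff2)

lemma tendsto_funI:
  fixes f :: "'a \<Rightarrow> 'i \<Rightarrow> real"
  assumes "\<And>i. ((\<lambda>n. f n i) \<longlongrightarrow> l i) F"
  shows "(f \<longlongrightarrow> l) F"
proof -
  have "limitin (product_topology (\<lambda>_::'i. euclidean) UNIV) f l F"
    using assms by (simp add: limitin_componentwise)
  then show ?thesis by (simp add: euclidean_product_topology)
qed

text \<open>Extensional functions form a full product whose factors outside \<open>A\<close> are
  singletons, so Tychonoff applies.\<close>

lemma compact_PiE_interval: "compact (A \<rightarrow>\<^sub>E {a..b::real})"
proof -
  have *: "(A \<rightarrow>\<^sub>E {a..b}) = PiE UNIV (\<lambda>i. if i \<in> A then {a..b} else {undefined})" (is "_ = PiE UNIV ?B")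
    by (auto simp: PiE_def Pi_def extensional_def split: if_splits)
  have "compactin (product_topology (\<lambda>i. euclidean) UNIV) (PiE UNIV ?B)"
    by (subst compactin_PiE) auto
  then show ?thesis unfolding * by (simp add: euclidean_product_topology)
qed

lemma T_nth [simp]: "T d i $ d = i"
  by (simp add: T_def axis_def)

lemma abs_nth_le_l1norm: "\<bar>k $ i\<bar> \<le> l1norm k"
  unfolding l1norm_def by (rule member_le_sum) auto

lemma l1norm_0 [simp]: "l1norm 0 = 0"
  by (simp add: l1norm_def)

lemma l1norm_minus [simp]: "l1norm (- k) = l1norm k"
  by (simp add: l1norm_def)

lemma l1norm_axis [simp]: "l1norm (axis i c) = \<bar>c\<bar>"
  unfolding l1norm_def axis_def by (simp add: if_distrib[of abs] cong: if_cong)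

lemma finite_lball [simp]: "finite (lball r)"
proof (rule finite_subset)
  show "lball r \<subseteq> vec_lambda ` (UNIV \<rightarrow>\<^sub>E {- int r..int r})"
  proof
    fix k :: "int ^ 'n" assume "k \<in> lball r"
    then have "\<bar>k $ i\<bar> \<le> int r" for i using abs_nth_le_l1norm[of k i] by (simp add: lball_def)
    then have "vec_nth k \<in> UNIV \<rightarrow>\<^sub>E {- int r..int r}" by (auto simp: abs_le_iff minus_le_iff)
    then show "k \<in> vec_lambda ` (UNIV \<rightarrow>\<^sub>E {- int r..int r})"
      by (metis image_eqI vec_nth_inverse)
  qed
qed (intro finite_imageI finite_PiE; simp)

lemma lball_nth: "k \<in> lball r \<Longrightarrow> k $ i \<in> {- int r..int r}"
  using abs_nth_le_l1norm[of k i] by (auto simp: lball_def)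

section \<open>Periodic configurations as chains\<close>

lemma periodic_in_multiple:
  fixes u :: "('n::finite) configuration"
  assumes "periodic_in j u"
  shows "u (i + axis j n) = u i"
proof -
  have step: "u (i + axis j (n + 1)) = u (i + axis j n)" for n
  proof -
    have "axis j (n + 1) = axis j n + (axis j 1 :: int ^ 'n)" by (simp add: vec_eq_iff axis_def)
    then show ?thesis using assms unfolding periodic_in_def by (metis add.assoc)
  qed
  have zero: "axis j 0 = (0 :: int ^ 'n)" by (simp add: vec_eq_iff axis_def)
  have base: "u (i + axis j 0) = u i" unfolding zero by simp
  show ?thesis
    by (induction n rule: int_induct[where k = 0]) (use step[of "_ - 1"] step base in auto)
qed

text \<open>Periodicity allows the coordinates other than \<open>d\<close> to be set to
  \<open>0\<close> one after the other.\<close>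

lemma periodic_eq_on_axis:
  fixes u :: "('n::finite) configuration"
  assumes "\<And>j. j \<noteq> d \<Longrightarrow> periodic_in j u"
  shows "u i = u (T d (i $ d))"
proof -
  have "u (\<chi> k. if k \<in> F then 0 else i $ k) = u i" if "finite F" "d \<notin> F" for F
    using that
  proof (induction F)
    case empty
    have "(\<chi> k. i $ k) = i" by (simp add: vec_eq_iff)
    then show ?case by simp
  next
    case (insert j F)
    have "(\<chi> k. if k \<in> insert j F then 0 else i $ k) =
        (\<chi> k. if k \<in> F then 0 else i $ k) + axis j (- (i $ j))"
      using insert.hyps by (auto simp: vec_eq_iff axis_def)
    then show ?case
      using insert periodic_in_multiple[OF assms[of j]] by auto
  qed
  from this[of "UNIV - {d}"] have "u (\<chi> k. if k \<in> UNIV - {d} then 0 else i $ k) = u i" by simp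
  moreover have "(\<chi> k. if k \<in> UNIV - {d} then 0 else i $ k) = T d (i $ d)"
    by (auto simp: vec_eq_iff axis_def T_def)
  ultimately show ?thesis by simp
qed

lemma Per_const: "u \<in> Per \<longleftrightarrow> (\<exists>c. u = (\<lambda>_. c))"
proof
  assume "u \<in> Per"
  then have p: "periodic_in j u" for j by (simp add: Per_def)
  fix d :: 'a
  have "u i = u 0" for i
  proof -
    have "u i = u (T d (i $ d))" by (rule periodic_eq_on_axis) (rule p)
    also have "\<dots> = u (0 + axis d (i $ d))" by (simp add: T_def)
    also have "\<dots> = u 0" by (rule periodic_in_multiple[OF p])
    finally show ?thesis .
  qed
  then show "\<exists>c. u = (\<lambda>_. c)" by blast
qed (auto simp: Per_def periodic_in_def)

definition lift :: "'n::finite \<Rightarrow> (int \<Rightarrow> real) \<Rightarrow> 'n configuration" where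
  "lift d x = (\<lambda>j. x (j $ d))"

lemma lift_const [simp]: "lift d (\<lambda>_. c) = (\<lambda>_. c)"
  by (simp add: lift_def)

lemma lift_T [simp]: "lift d x (T d i) = x i"
  by (simp add: lift_def)

lemma Gamma1_hat_eq: "Gamma1_hat d (\<lambda>_. a) (\<lambda>_. b) = lift d ` box a b"
proof (intro equalityI subsetI)
  fix u assume "u \<in> Gamma1_hat d (\<lambda>_. a) (\<lambda>_. b)"
  then have u: "\<And>j. j \<noteq> d \<Longrightarrow> periodic_in j u" "\<And>j. a \<le> u j" "\<And>j. u j \<le> b"
    by (auto simp: Gamma1_hat_def le_fun_def)
  have "u = lift d (\<lambda>i. u (T d i))"
    using periodic_eq_on_axis[of d u] u(1) by (auto simp: lift_def)
  moreover have "(\<lambda>i. u (T d i)) \<in> box a b" using u by (simp add: box_def)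
  ultimately show "u \<in> lift d ` box a b" by blast
qed (auto simp: Gamma1_hat_def box_def lift_def periodic_in_def le_fun_def axis_def)

lemma asymptotic_lift:
  "asymptotic d (\<lambda>_. \<sigma>) (\<lambda>_. \<sigma>') (lift d x) \<longleftrightarrow> (x \<longlongrightarrow> \<sigma>) at_bot \<and> (x \<longlongrightarrow> \<sigma>') at_top"
  by (simp add: asymptotic_def norm_at_def tendsto_rabs_zero_iff Lim_null[symmetric])

lemma dist0_lift: "dist0 d (\<lambda>_. c) (shift d i (lift d x)) = \<bar>x i - c\<bar>"
  by (simp add: dist0_def norm_at_def shift_def lift_def)

lemma dist0_lift_0: "dist0 d (\<lambda>_. c) (lift d x) = \<bar>x 0 - c\<bar>"
  by (simp add: dist0_def norm_at_def)

text \<open>Even \<open>t\<close> are the transitions from \<open>v0\<close> to \<open>w0\<close>,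
  with conditions (a) and (b); odd \<open>t\<close> are those back, with (c) and (d).\<close>

lemma all_le_even_odd:
  "(\<forall>t\<le>2 * k. Q t) \<longleftrightarrow> (\<forall>j\<in>{0..k}. Q (2 * j)) \<and> (\<forall>j\<in>{0..<k}. Q (2 * j + 1))" for k :: nat
proof (intro iffI conjI ballI allI impI)
  fix t assume *: "(\<forall>j\<in>{0..k}. Q (2 * j)) \<and> (\<forall>j\<in>{0..<k}. Q (2 * j + 1))" and t: "t \<le> 2 * k"
  show "Q t"
  proof (cases "even t")
    case True
    then obtain j where "t = 2 * j" by (elim evenE)
    then show ?thesis using * t by auto
  next
    case False
    then obtain j where "t = 2 * j + 1" by (elim oddE)
    then show ?thesis using * t by auto
  qed
qed auto

section \<open>Windows of lifted chains, and convergence of partial sums\<close>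

definition win :: "nat \<Rightarrow> 'n::finite \<Rightarrow> (int \<Rightarrow> real) \<Rightarrow> 'n configuration" where
  "win r d x = (\<lambda>k\<in>lball r. x (k $ d))"

lemma win_coord_space [simp, intro]: "win r d x \<in> coord_space (lball r)"
  by (simp add: win_def coord_space_def)

lemma S_loc_lift: "S_loc r s j (lift d x) = s (win r d (tr (j $ d) x))"
  by (simp add: S_loc_def lift_def win_def tr_apply)

lemma win_inf: "win r d (inf x y) = inf (win r d x) (win r d y)"
  by (auto simp: win_def inf_min)

lemma win_sup: "win r d (sup x y) = sup (win r d x) (win r d y)"
  by (auto simp: win_def sup_max)

lemma (in chain) V_tendsto:
  assumes x: "x \<in> X" and \<sigma>: "a \<le> \<sigma>" "\<sigma> \<le> b"
  shows "(x \<longlongrightarrow> \<sigma>) at_top \<Longrightarrow> ((\<lambda>n. V (tr n x)) \<longlongrightarrow> V (\<lambda>_. \<sigma>)) at_top"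
    and "(x \<longlongrightarrow> \<sigma>) at_bot \<Longrightarrow> ((\<lambda>n. V (tr n x)) \<longlongrightarrow> V (\<lambda>_. \<sigma>)) at_bot"
proof -
  assume lim: "(x \<longlongrightarrow> \<sigma>) at_top"
  show "((\<lambda>n. V (tr n x)) \<longlongrightarrow> V (\<lambda>_. \<sigma>)) at_top"
  proof (rule LIMSEQ_int_at_top, rule seq_cont_V)
    fix i
    show "(\<lambda>n. tr (int n) x i) \<longlonglongrightarrow> \<sigma>"
      using filterlim_compose[OF tr_tendsto_at_top[OF lim, of i] filterlim_int_sequentially]
      by (simp add: tr_apply add.commute)
  qed (use x \<sigma> in auto)
next
  assume lim: "(x \<longlongrightarrow> \<sigma>) at_bot"
  show "((\<lambda>n. V (tr n x)) \<longlongrightarrow> V (\<lambda>_. \<sigma>)) at_bot"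
  proof (rule LIMSEQ_int_at_bot, rule seq_cont_V)
    fix i
    have "filterlim (\<lambda>n. - int n) at_bot sequentially"
      unfolding filterlim_at_bot
    proof
      fix Z show "\<forall>\<^sub>F n in sequentially. - int n \<le> Z"
        using eventually_ge_at_top[of "nat (- Z)"] by eventually_elim simp
    qed
    from filterlim_compose[OF tr_tendsto_at_bot[OF lim, of i] this]
    show "(\<lambda>n. tr (- int n) x i) \<longlonglongrightarrow> \<sigma>"
      by (simp add: tr_apply add.commute)
  qed (use x \<sigma> in auto)
qed

text \<open>Sums of \<open>h\<close> over intervals are sums of \<open>A\<close> plus a difference
  of two values of \<open>V\<close>. The former converge because growing intervals exhaust the
  integers, the latter because translates of \<open>x\<close> tend to constants. So the liminf in
  \<open>J1\<close> is a limit.\<close>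

lemma (in chain) partial_sums_tendsto:
  assumes x: "x \<in> het \<sigma> \<sigma>'" and \<sigma>: "\<sigma> \<in> {a, b}" "\<sigma>' \<in> {a, b}"
  shows "((\<lambda>(p, q). ereal (\<Sum>n = p..q. h (tr n x))) \<longlongrightarrow>
    enn2ereal (E UNIV x) + ereal (V (\<lambda>_. \<sigma>') - V (\<lambda>_. \<sigma>))) (at_bot \<times>\<^sub>F at_top)"
proof -
  have xX: "x \<in> X" and lim: "(x \<longlongrightarrow> \<sigma>) at_bot" "(x \<longlongrightarrow> \<sigma>') at_top" using x by (auto simp: het_def)
  have \<sigma>': "a \<le> \<sigma>" "\<sigma> \<le> b" "a \<le> \<sigma>'" "\<sigma>' \<le> b" using \<sigma> ab by auto
  let ?F = "at_bot \<times>\<^sub>F at_top :: (int \<times> int) filter"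
  have sets: "filterlim (\<lambda>(p, q). {p..q}) (finite_subsets_at_top UNIV) ?F"
    unfolding filterlim_finite_subsets_at_top
  proof (intro allI impI)
    fix G :: "int set" assume G: "finite G \<and> G \<subseteq> UNIV"
    have "\<forall>\<^sub>F p in at_bot. \<forall>n\<in>G. p \<le> n" "\<forall>\<^sub>F q in at_top. \<forall>n\<in>G. n \<le> q"
      using G by (auto intro!: eventually_ball_finite eventually_le_at_bot eventually_ge_at_top)
    from eventually_prodI[OF this]
    show "\<forall>\<^sub>F y in ?F. finite (case y of (p, q) \<Rightarrow> {p..q}) \<and> G \<subseteq> (case y of (p, q) \<Rightarrow> {p..q}) \<and>
        (case y of (p, q) \<Rightarrow> {p..q}) \<subseteq> UNIV"
      by eventually_elim auto
  qed
  have "((\<lambda>n. ennreal (A (tr n x))) has_sum E UNIV x) UNIV"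
    unfolding E_def by (rule has_sum_infsum) (simp add: nonneg_summable_on_complete)
  then have "((\<lambda>pq. \<Sum>n\<in>(case pq of (p, q) \<Rightarrow> {p..q}). ennreal (A (tr n x))) \<longlongrightarrow> E UNIV x) ?F"
    unfolding has_sum_def by (rule filterlim_compose[OF _ sets])
  from isCont_tendsto_compose[OF continuous_at_enn2ereal this]
  have "((\<lambda>(p, q). ereal (\<Sum>n = p..q. A (tr n x))) \<longlongrightarrow> enn2ereal (E UNIV x)) ?F"
  proof (rule Lim_transform_eventually)
    have "enn2ereal (\<Sum>n = p..q. ennreal (A (tr n x))) = ereal (\<Sum>n = p..q. A (tr n x))" for p q
      using xX by (subst sum_ennreal) (auto simp: A_nonneg sum_nonneg)
    then show "\<forall>\<^sub>F y in ?F. enn2ereal (\<Sum>n\<in>(case y of (p, q) \<Rightarrow> {p..q}). ennreal (A (tr n x))) =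
        (case y of (p, q) \<Rightarrow> ereal (\<Sum>n = p..q. A (tr n x)))"
      by (intro always_eventually allI) (simp only: case_prod_beta')
  qed
  moreover have "((\<lambda>(p, q). ereal (V (tr (q + 1) x) - V (tr p x))) \<longlongrightarrow> ereal (V (\<lambda>_. \<sigma>') - V (\<lambda>_. \<sigma>))) ?F"
  proof -
    have "filterlim (\<lambda>q. q + 1) at_top (at_top :: int filter)"
      unfolding filterlim_at_top
    proof
      fix Z :: int show "\<forall>\<^sub>F q in at_top. Z \<le> q + 1"
        using eventually_ge_at_top[of "Z - 1"] by eventually_elim simp
    qed
    from filterlim_compose[OF filterlim_compose[OF V_tendsto(1)[OF xX \<sigma>'(3,4) lim(2)] this] filterlim_snd]
    have 1: "((\<lambda>y. V (tr (snd y + 1) x)) \<longlongrightarrow> V (\<lambda>_. \<sigma>')) ?F" .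
    have 2: "((\<lambda>y. V (tr (fst y) x)) \<longlongrightarrow> V (\<lambda>_. \<sigma>)) ?F"
      by (rule filterlim_compose[OF V_tendsto(2)[OF xX \<sigma>'(1,2) lim(1)] filterlim_fst])
    show ?thesis
      using tendsto_diff[OF 1 2] by (simp add: case_prod_beta')
  qed
  ultimately have "((\<lambda>y. (case y of (p, q) \<Rightarrow> ereal (\<Sum>n = p..q. A (tr n x))) +
      (case y of (p, q) \<Rightarrow> ereal (V (tr (q + 1) x) - V (tr p x)))) \<longlongrightarrow>
      enn2ereal (E UNIV x) + ereal (V (\<lambda>_. \<sigma>') - V (\<lambda>_. \<sigma>))) ?F"
    by (intro tendsto_add_ereal_general1) auto
  then show ?thesis
  proof (rule Lim_transform_eventually)
    \<comment> \<open>Telescoping needs a nonempty interval, which holds eventually.\<close>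
    have "\<forall>\<^sub>F y in ?F. fst y \<le> 0 \<and> 0 \<le> snd y"
      using eventually_prodI[OF eventually_le_at_bot[of "0::int"] eventually_ge_at_top[of "0::int"]] by simp
    then show "\<forall>\<^sub>F y in ?F. (case y of (p, q) \<Rightarrow> ereal (\<Sum>n = p..q. A (tr n x))) +
        (case y of (p, q) \<Rightarrow> ereal (V (tr (q + 1) x) - V (tr p x))) =
        (case y of (p, q) \<Rightarrow> ereal (\<Sum>n = p..q. h (tr n x)))"
    proof eventually_elim
      case (elim y)
      then show ?case
        using sum_h_telescope[where c = "fst y" and j = "nat (snd y - fst y)" and x = x] by (auto simp: case_prod_beta')
    qed
  qed
qed

text \<open>A single jump between the wells. It shows that the infimum in \<open>c1\<close> is not
  infinite, so elements of \<open>M1\<close> have finite energy.\<close>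

lemma (in chain) ex_finite_energy:
  assumes "\<sigma> \<in> {a, b}" "\<sigma>' \<in> {a, b}"
  shows "\<exists>x\<in>het \<sigma> \<sigma>'. E UNIV x < \<infinity>"
proof -
  define x where "x = glue 0 (\<lambda>_. \<sigma>) (\<lambda>_. \<sigma>')"
  have c: "(\<lambda>_. \<sigma>) \<in> X" "(\<lambda>_. \<sigma>') \<in> X" using assms ab by auto
  then have xX: "x \<in> X" by (simp add: x_def)
  have "E UNIV x = E {- int r..int r} x"
    unfolding E_def
  proof (rule infsum_cong_neutral)
    fix p assume "p \<in> UNIV - {- int r..int r}"
    then consider "p < - int r" | "int r < p" by force
    then have "A (tr p x) = 0"
    proof cases
      case 1
      then have "A (tr p x) = A (\<lambda>_. \<sigma>)"
        using xX c by (intro A_local) (auto simp: tr_apply x_def glue_def)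
      then show ?thesis using assms h_a h_b by (auto simp: A_const)
    next
      case 2
      then have "A (tr p x) = A (\<lambda>_. \<sigma>')"
        using xX c by (intro A_local) (auto simp: tr_apply x_def glue_def)
      then show ?thesis using assms h_a h_b by (auto simp: A_const)
    qed
    then show "ennreal (A (tr p x)) = 0" by simp
  qed auto
  also have "\<dots> < \<infinity>" using xX by (simp add: E_finite)
  finally have "E UNIV x < \<infinity>" .
  moreover have "x \<in> het \<sigma> \<sigma>'"
    using xX by (auto simp: het_def x_def intro!: glue_tendsto_at_bot glue_tendsto_at_top)
  ultimately show ?thesis by blast
qed

subsection \<open>The lattice model\<close>

locale lattice_model =
  fixes d :: "'n::finite" and r :: nat and s :: "'n configuration \<Rightarrow> real" and a b :: real
  assumes r: "r \<ge> 1" and C2: "C2_coord (lball r) s" and S2: "S2 r s" and S3: "S3 r s"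
    and adj: "adjacent (M0 r s) (\<lambda>_. a) (\<lambda>_. b)"
begin

definition h :: "(int \<Rightarrow> real) \<Rightarrow> real" where "h x = s (win r d x) - c0 r s"

lemma ab: "a < b"
  using adj by (auto simp: adjacent_def below_def)

lemma S_loc_const: "S_loc r s 0 (\<lambda>_. c) = s (win r d (\<lambda>_. c))"
  using S_loc_lift[of r s 0 d "\<lambda>_. c"] by simp

lemma c0_le: "c0 r s \<le> s (win r d (\<lambda>_. c))"
proof -
  have "S_loc r s 0 ` Per \<subseteq> s ` coord_space (lball r)"
    by (auto simp: S_loc_def coord_space_def)
  then have "bdd_below (S_loc r s 0 ` Per)"
    using S2 unfolding S2_def by (meson bdd_below_mono)
  then have "c0 r s \<le> S_loc r s 0 (\<lambda>_. c)"
    unfolding c0_def by (rule cINF_lower) (auto simp: Per_const)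
  then show ?thesis by (simp add: S_loc_const)
qed

lemma axis_in_lball: "axis d 1 \<in> lball r" and zero_in_lball: "0 \<in> lball r"
  using r by (auto simp: lball_def)

lemma mixed_le:
  "u \<in> coord_space (lball r) \<Longrightarrow> k \<in> lball r \<Longrightarrow> j \<in> lball r \<Longrightarrow> k \<noteq> j \<Longrightarrow> pd k (pd j s) u \<le> 0"
  using S3 by (simp add: S3_def)

lemma sub_s: "submodular_on (coord_space (lball r)) s"
  by (rule submodular_on_coord_space[OF finite_lball C2 mixed_le])

text \<open>S3 gives a negative mixed derivative at each point; its maximum over the compact box is
  still negative and yields \<open>\<epsilon>\<close>.\<close>

lemma ex_strict_submodular:
  "\<exists>\<epsilon>>0. submodular_on (lball r \<rightarrow>\<^sub>E {a..b}) (\<lambda>u. s u - \<epsilon> * (u (axis d 1) - u 0)\<^sup>2)"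
proof -
  let ?B = "lball r \<rightarrow>\<^sub>E {a..b} :: 'n configuration set" and ?f = "pd 0 (pd (axis d 1) s)"
  have sub: "?B \<subseteq> coord_space (lball r)" by (auto simp: coord_space_def PiE_def)
  have "continuous_on (coord_space (lball r)) ?f"
    using C2 axis_in_lball zero_in_lball by (auto simp: C2_coord_def C1_coord_def)
  then have "continuous_on ?B ?f" using sub by (rule continuous_on_subset)
  moreover have "?B \<noteq> {}" using ab by (auto simp: PiE_eq_empty_iff)
  ultimately have "\<exists>u\<in>?B. \<forall>v\<in>?B. ?f v \<le> ?f u" by (intro continuous_attains_sup compact_PiE_interval)
  then obtain u where u: "u \<in> ?B" "\<forall>v\<in>?B. ?f v \<le> ?f u" by (elim bexE)
  have "u \<in> coord_space (lball r)" using u(1) sub by (rule rev_subsetD)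
  from conjunct2[OF bspec[OF S3[unfolded S3_def] this]] have neg: "?f u < 0" by simp
  have nz: "axis d 1 \<noteq> (0 :: int ^ 'n)" by (simp add: axis_eq_0_iff)
  \<comment> \<open>Half of the maximum is taken because the square contributes
    \<open>2 * \<epsilon>\<close> to the mixed derivative.\<close>
  have "submodular_on ?B (\<lambda>v. s v - (- ?f u / 2) * (v (axis d 1) - v 0)\<^sup>2)"
  proof (rule submodular_on_box_minus_square[OF finite_lball C2 zero_in_lball axis_in_lball _ mixed_le])
    show "0 \<noteq> axis d (1 :: int)" using nz by (rule not_sym)
    show "?f v \<le> - 2 * (- ?f u / 2)" if "v \<in> ?B" for v using u(2)[rule_format, OF that] by simp
  qed
  with neg show ?thesis by (intro exI[of _ "- ?f u / 2"]) simp
qed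

lemma win_box: "x \<in> box a b \<Longrightarrow> win r d x \<in> lball r \<rightarrow>\<^sub>E {a..b}"
  by (auto simp: win_def box_def)

lemma win_at: "win r d x (axis d 1) = x 1" "win r d x 0 = x 0"
  using axis_in_lball zero_in_lball by (auto simp: win_def)

lemma win_cong: "(\<And>i. i \<in> {- int r..int r} \<Longrightarrow> x i = y i) \<Longrightarrow> win r d x = win r d y"
  using lball_nth[of _ r d] by (auto simp: win_def)

lemma ex_chain: "\<exists>\<epsilon>. chain r h a b \<epsilon>"
proof -
  obtain \<epsilon> where \<epsilon>: "\<epsilon> > 0" "submodular_on (lball r \<rightarrow>\<^sub>E {a..b}) (\<lambda>u. s u - \<epsilon> * (u (axis d 1) - u 0)\<^sup>2)"
    using ex_strict_submodular by blast
  have "chain r h a b \<epsilon>"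
  proof
    show "h x = h y" if "\<And>i. i \<in> {- int r..int r} \<Longrightarrow> x i = y i" for x y
      using win_cong[OF that] by (simp add: h_def)
    show "seq_cont r a b h"
      unfolding seq_cont_def h_def
    proof (intro allI impI tendsto_diff tendsto_const)
      fix f :: "nat \<Rightarrow> int \<Rightarrow> real" and l assume l: "\<forall>i\<in>{- int r..int r}. (\<lambda>n. f n i) \<longlonglongrightarrow> l i"
      have "(\<lambda>n. win r d (f n)) \<longlonglongrightarrow> win r d l"
      proof (rule tendsto_funI)
        fix k :: "int ^ 'n" show "(\<lambda>n. win r d (f n) k) \<longlonglongrightarrow> win r d l k"
          using l lball_nth[of k r d] by (cases "k \<in> lball r") (auto simp: win_def)
      qed
      moreover have "continuous_on (coord_space (lball r)) s"
        using C2 by (auto simp: C2_coord_def C1_coord_def)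
      ultimately show "(\<lambda>n. s (win r d (f n))) \<longlonglongrightarrow> s (win r d l)"
        by (intro continuous_on_tendsto_compose[of "coord_space (lball r)" s]) auto
    qed
    show "submodular_on UNIV h"
      unfolding submodular_on_def
    proof (intro ballI conjI)
      fix x y :: "int \<Rightarrow> real"
      have "s (sup (win r d x) (win r d y)) + s (inf (win r d x) (win r d y)) \<le> s (win r d x) + s (win r d y)"
        using sub_s unfolding submodular_on_def by blast
      then show "h (sup x y) + h (inf x y) \<le> h x + h y" by (simp add: h_def win_inf win_sup)
    qed auto
    show "submodular_on (box a b) (\<lambda>x. h x - \<epsilon> * (x 1 - x 0)\<^sup>2)"
      unfolding submodular_on_def
    proof (intro ballI conjI)
      fix x y :: "int \<Rightarrow> real" assume xy: "x \<in> box a b" "y \<in> box a b"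
      show "inf x y \<in> box a b" "sup x y \<in> box a b"
        using xy by (auto simp: box_def inf_min sup_max min_def max_def)
      have "(s (sup (win r d x) (win r d y)) - \<epsilon> * (sup (win r d x) (win r d y) (axis d 1) - sup (win r d x) (win r d y) 0)\<^sup>2) +
        (s (inf (win r d x) (win r d y)) - \<epsilon> * (inf (win r d x) (win r d y) (axis d 1) - inf (win r d x) (win r d y) 0)\<^sup>2)
        \<le> (s (win r d x) - \<epsilon> * (win r d x (axis d 1) - win r d x 0)\<^sup>2) +
        (s (win r d y) - \<epsilon> * (win r d y (axis d 1) - win r d y 0)\<^sup>2)"
        using \<epsilon>(2) win_box[OF xy(1)] win_box[OF xy(2)] unfolding submodular_on_def by blast
      then show "h (sup x y) - \<epsilon> * (sup x y 1 - sup x y 0)\<^sup>2 + (h (inf x y) - \<epsilon> * (inf x y 1 - inf x y 0)\<^sup>2)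
          \<le> h x - \<epsilon> * (x 1 - x 0)\<^sup>2 + (h y - \<epsilon> * (y 1 - y 0)\<^sup>2)"
        unfolding win_inf[symmetric] win_sup[symmetric] win_at by (simp add: h_def)
    qed
    show "0 \<le> h (\<lambda>_. c)" for c using c0_le[of c] by (simp add: h_def)
    have "S_loc r s 0 (\<lambda>_. a) = c0 r s" "S_loc r s 0 (\<lambda>_. b) = c0 r s"
      using adj by (auto simp: adjacent_def M0_def)
    then show "h (\<lambda>_. a) = 0" "h (\<lambda>_. b) = 0"
      by (simp_all add: S_loc_const h_def)
    \<comment> \<open>Fully periodic configurations are the constants, so a zero between the wells
      would be an element of \<open>M0\<close> inside the gap.\<close>
    show "0 < h (\<lambda>_. c)" if c: "a < c" "c < b" for c
    proof (rule ccontr)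
      assume "\<not> 0 < h (\<lambda>_. c)"
      then have "S_loc r s 0 (\<lambda>_. c) = c0 r s" using c0_le[of c] by (simp add: h_def S_loc_const)
      then have "(\<lambda>_. c) \<in> M0 r s" by (auto simp: M0_def Per_const)
      moreover have "(\<lambda>_. a) \<lless> (\<lambda>_. c)" "(\<lambda>_. c) \<lless> (\<lambda>_. b)" using c by (simp_all add: below_def)
      ultimately show False using adj unfolding adjacent_def by blast
    qed
  qed (use r ab \<epsilon> in auto)
  then show ?thesis ..
qed

text \<open>A choice, because the sublocale needs a term for a constant that is known merely to
  exist.\<close>

definition \<epsilon> :: real where "\<epsilon> = (SOME \<epsilon>. chain r h a b \<epsilon>)"

sublocale chain r h a b \<epsilon>
  unfolding \<epsilon>_def using ex_chain by (rule someI_ex)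

text \<open>The additive constant is finite and depends on the limits of the chain alone, so
  \<open>J1\<close> and \<open>E\<close> have the same minimizers in every class with prescribed
  limits.\<close>

lemma J1_lift:
  assumes x: "x \<in> het \<sigma> \<sigma>'" and \<sigma>: "\<sigma> \<in> {a, b}" "\<sigma>' \<in> {a, b}"
  shows "J1 d r s (lift d x) = enn2ereal (E UNIV x) + ereal (V (\<lambda>_. \<sigma>') - V (\<lambda>_. \<sigma>))"
proof -
  have "J1_part d r s p q (lift d x) = (\<Sum>n = p..q. h (tr n x))" for p q
    by (simp add: J1_part_def J1_term_def S_loc_lift h_def)
  then show ?thesis
    unfolding J1_def
    using lim_imp_Liminf[OF _ partial_sums_tendsto[OF x \<sigma>]] by (simp add: prod_filter_eq_bot)
qed

lemma Gamma1_eq: "Gamma1 d (\<lambda>_. a) (\<lambda>_. b) (\<lambda>_. \<sigma>) (\<lambda>_. \<sigma>') = lift d ` het \<sigma> \<sigma>'"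
  by (auto simp: Gamma1_def Gamma1_hat_eq asymptotic_lift het_def)

lemma M1_eq:
  assumes \<sigma>: "\<sigma> \<in> {a, b}" "\<sigma>' \<in> {a, b}"
  shows "M1 d r s (\<lambda>_. a) (\<lambda>_. b) (\<lambda>_. \<sigma>) (\<lambda>_. \<sigma>') = lift d ` Collect (minimizer (het \<sigma> \<sigma>'))"
proof -
  let ?c = "ereal (V (\<lambda>_. \<sigma>') - V (\<lambda>_. \<sigma>))"
  have INF: "c1 d r s (\<lambda>_. a) (\<lambda>_. b) (\<lambda>_. \<sigma>) (\<lambda>_. \<sigma>') = (INF x\<in>het \<sigma> \<sigma>'. enn2ereal (E UNIV x) + ?c)"
    unfolding c1_def Gamma1_eq image_image by (intro INF_cong refl J1_lift \<sigma>)
  have "enn2ereal (E UNIV x) + ?c = (INF x\<in>het \<sigma> \<sigma>'. enn2ereal (E UNIV x) + ?c) \<longleftrightarrow> minimizer (het \<sigma> \<sigma>') x"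
    if x: "x \<in> het \<sigma> \<sigma>'" for x
  proof
    assume eq: "enn2ereal (E UNIV x) + ?c = (INF x\<in>het \<sigma> \<sigma>'. enn2ereal (E UNIV x) + ?c)"
    have "E UNIV x \<le> E UNIV z" if "z \<in> het \<sigma> \<sigma>'" for z
      by (rule enn2ereal_add_le_cancel, subst eq, rule INF_lower[OF that])
    moreover obtain z where "z \<in> het \<sigma> \<sigma>'" "E UNIV z < \<infinity>" using ex_finite_energy[OF \<sigma>] by blast
    ultimately show "minimizer (het \<sigma> \<sigma>') x"
      using x unfolding minimizer_def by (blast intro: order_le_less_trans)
  next
    assume "minimizer (het \<sigma> \<sigma>') x"
    then show "enn2ereal (E UNIV x) + ?c = (INF x\<in>het \<sigma> \<sigma>'. enn2ereal (E UNIV x) + ?c)"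
      using x by (intro antisym INF_greatest INF_lower)
        (auto simp: minimizer_def less_eq_ennreal.rep_eq intro!: add_right_mono)
  qed
  then show ?thesis
    unfolding M1_def INF Gamma1_eq using J1_lift[OF _ \<sigma>] by (auto simp: minimizer_def)
qed

lemma Y_eq:
  assumes "\<And>j. \<rho> (2 * j) = \<rho>1" "\<And>j. \<rho>' (2 * j) = \<rho>2" "\<And>j. \<rho> (2 * j + 1) = \<rho>3" "\<And>j. \<rho>' (2 * j + 1) = \<rho>4"
  shows "Y d (\<lambda>_. a) (\<lambda>_. b) \<rho>1 \<rho>2 \<rho>3 \<rho>4 k m l = lift d ` constrained k \<rho> \<rho>' m l"
proof -
  have "(\<forall>(i, \<sigma>, c)\<in>constraints k \<rho> \<rho>' m l. \<bar>x i - \<sigma>\<bar> \<le> c) \<longleftrightarrow>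
      (\<forall>j\<in>{0..k}. \<forall>i\<in>{m (1 + 4 * j) - int l .. m (1 + 4 * j) - 1}. \<bar>x i - a\<bar> \<le> \<rho>1) \<and>
      (\<forall>j\<in>{0..k}. \<forall>i\<in>{m (2 + 4 * j) .. m (2 + 4 * j) + int l - 1}. \<bar>x i - b\<bar> \<le> \<rho>2) \<and>
      (\<forall>j\<in>{0..<k}. \<forall>i\<in>{m (3 + 4 * j) - int l .. m (3 + 4 * j) - 1}. \<bar>x i - b\<bar> \<le> \<rho>3) \<and>
      (\<forall>j\<in>{0..<k}. \<forall>i\<in>{m (4 + 4 * j) .. m (4 + 4 * j) + int l - 1}. \<bar>x i - a\<bar> \<le> \<rho>4)" for x :: "int \<Rightarrow> real"
  proof -
    have "(\<forall>(i, \<sigma>, c)\<in>constraints k \<rho> \<rho>' m l. \<bar>x i - \<sigma>\<bar> \<le> c) \<longleftrightarrow>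
      (\<forall>t\<le>2*k. (\<forall>i\<in>{m (2*t+1) - int l..m (2*t+1) - 1}. \<bar>x i - side t\<bar> \<le> \<rho> t) \<and>
        (\<forall>i\<in>{m (2*t+2)..m (2*t+2) + int l - 1}. \<bar>x i - side (Suc t)\<bar> \<le> \<rho>' t))"
      unfolding constraints_def by (simp add: ball_Un) blast
    moreover have "2 * (2 * j) + 1 = 1 + 4 * j" "2 * (2 * j) + 2 = 2 + 4 * j"
      "2 * (2 * j + 1) + 1 = 3 + 4 * j" "2 * (2 * j + 1) + 2 = 4 + 4 * j" for j :: nat
      by simp_all
    moreover have "side (2 * j) = a" "side (Suc (2 * j)) = b" "side (2 * j + 1) = b" "side (Suc (2 * j + 1)) = a" for j
      by (simp_all add: side_def)
    ultimately show ?thesis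
      unfolding all_le_even_odd[where Q = "\<lambda>t. (\<forall>i\<in>{m (2*t+1) - int l..m (2*t+1) - 1}. \<bar>x i - side t\<bar> \<le> \<rho> t) \<and>
        (\<forall>i\<in>{m (2*t+2)..m (2*t+2) + int l - 1}. \<bar>x i - side (Suc t)\<bar> \<le> \<rho>' t)"]
      by (simp only: assms ball_conj_distrib) blast
  qed
  then show ?thesis
    unfolding Y_def constrained_def Gamma1_hat_eq het_def
    by (auto simp: asymptotic_lift dist0_lift image_iff)
qed

section \<open>The Euler-Lagrange equation\<close>

lemma window_update:
  assumes "i - j \<in> lball r"
  shows "S_loc r s j ((lift d x)(i := \<tau>)) = s ((win r d (tr (j $ d) x))(i - j := \<tau>))"
proof -
  have "(\<lambda>k\<in>lball r. ((lift d x)(i := \<tau>)) (j + k)) = (win r d (tr (j $ d) x))(i - j := \<tau>)"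
    using assms by (auto simp: win_def lift_def tr_apply fun_eq_iff algebra_simps)
  then show ?thesis by (simp add: S_loc_def)
qed

lemma pd_S_loc:
  assumes "i - j \<in> lball r"
  shows "pd i (S_loc r s j) (lift d x) = pd (i - j) s (win r d (tr (j $ d) x))"
  unfolding pd_def window_update[OF assms] using assms by (simp add: lift_def win_def tr_apply)

text \<open>Minimality is only known for variations of a whole hyperplane of sites. By submodularity
  such a variation costs at most the sum of the corresponding single-site variations, so
  the latter have a minimum as well and the single-site derivative vanishes.\<close>

lemma local_min_imp_solution:
  assumes min: "\<And>p. \<exists>\<eta>>0. \<forall>\<tau>. \<bar>\<tau> - U p\<bar> < \<eta> \<longrightarrow>
    local_energy p U \<le> local_energy p (U(p := \<tau>))"
  shows "is_solution r s (lift d U)"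
  unfolding is_solution_def
proof
  fix i :: "int ^ 'n"
  define p where "p = i $ d"
  \<comment> \<open>The window centred at \<open>i - k\<close>, in which the site \<open>i\<close>
    occupies position \<open>k\<close>.\<close>
  define W where "W k = win r d (tr (p - k $ d) U)" for k :: "int ^ 'n"
  \<comment> \<open>The derivative of this sum of single-site variations at \<open>U p\<close> is
    the left-hand side of (EL) at \<open>i\<close>.\<close>
  define e where "e \<tau> = (\<Sum>k\<in>lball r. s ((W k)(k := \<tau>)) - s (W k))" for \<tau>
  have Wk: "W k k = U p" if "k \<in> lball r" for k using that by (simp add: W_def win_def tr_apply)
  have C1: "C1_coord (lball r) s" using C2 by (simp add: C2_coord_def)
  have deriv: "(e has_real_derivative (\<Sum>k\<in>lball r. pd k s (W k))) (at (U p))"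
    unfolding e_def
  proof (rule DERIV_sum)
    fix k :: "int ^ 'n" assume k: "k \<in> lball r"
    have "W k = (W k)(k := U p)" using Wk[OF k] by (metis fun_upd_triv)
    then show "((\<lambda>\<tau>. s ((W k)(k := \<tau>)) - s (W k)) has_real_derivative pd k s (W k)) (at (U p))"
      using C1_coord_has_pd[OF C1 _ k, of "W k" "U p"]
      by (auto intro!: derivative_eq_intros simp: W_def)
  qed
  obtain \<eta> where \<eta>: "\<eta> > 0" "\<And>\<tau>. \<bar>\<tau> - U p\<bar> < \<eta> \<Longrightarrow>
      local_energy p U \<le> local_energy p (U(p := \<tau>))"
    using min by blast
  have "e (U p) \<le> e \<tau>" if \<tau>: "\<bar>U p - \<tau>\<bar> < \<eta>" for \<tau>
  proof -
    let ?I = "{p - int r..p + int r}" and ?K = "\<lambda>n. {k\<in>lball r. p = n + k $ d}"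
    have "0 \<le> (\<Sum>n\<in>?I. h (tr n (U(p := \<tau>))) - h (tr n U))"
      using \<eta>(2)[of \<tau>] \<tau> by (simp add: local_energy_def sum_subtractf abs_minus_commute)
    also have "\<dots> \<le> (\<Sum>n\<in>?I. \<Sum>k\<in>?K n. s ((win r d (tr n U))(k := \<tau>)) - s (win r d (tr n U)))"
    proof (rule sum_mono)
      fix n
      have "win r d (tr n (U(p := \<tau>))) = (\<lambda>k. if k \<in> ?K n then \<tau> else win r d (tr n U) k)"
        by (auto simp: win_def tr_apply)
      then have "h (tr n (U(p := \<tau>))) - h (tr n U) =
          s (\<lambda>k. if k \<in> ?K n then \<tau> else win r d (tr n U) k) - s (win r d (tr n U))"
        by (simp add: h_def)
      also have "\<dots> \<le> (\<Sum>k\<in>?K n. s ((win r d (tr n U))(k := \<tau>)) - s (win r d (tr n U)))"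
        by (rule submodular_block_variation_le[OF sub_s win_coord_space, where c = "U p"]) (auto simp: win_def tr_apply)
      finally show "h (tr n (U(p := \<tau>))) - h (tr n U) \<le>
          (\<Sum>k\<in>?K n. s ((win r d (tr n U))(k := \<tau>)) - s (win r d (tr n U)))" .
    qed
    \<comment> \<open>Every position \<open>k\<close> meets the hyperplane for exactly one centre,
      \<open>n = p - k $ d\<close>, so the double sum collapses to one term per
      \<open>k\<close>.\<close>
    also have "\<dots> = (\<Sum>k\<in>lball r. \<Sum>n | n \<in> ?I \<and> p = n + k $ d. s ((win r d (tr n U))(k := \<tau>)) - s (win r d (tr n U)))"
      by (rule sum.swap_restrict) auto
    also have "\<dots> = e \<tau>"
      unfolding e_def
    proof (rule sum.cong[OF refl])
      fix k :: "int ^ 'n" assume "k \<in> lball r"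
      then have "{n \<in> ?I. p = n + k $ d} = {p - k $ d}" using lball_nth[of k r d] by auto
      then show "(\<Sum>n | n \<in> ?I \<and> p = n + k $ d. s ((win r d (tr n U))(k := \<tau>)) - s (win r d (tr n U))) =
          s ((W k)(k := \<tau>)) - s (W k)" by (simp add: W_def)
    qed
    finally have "0 \<le> e \<tau>" .
    moreover have "e (U p) = 0"
      unfolding e_def by (rule sum.neutral) (metis Wk diff_self fun_upd_triv)
    ultimately show ?thesis by simp
  qed
  then have "(\<Sum>k\<in>lball r. pd k s (W k)) = 0" using DERIV_local_min[OF deriv \<eta>(1)] by blast
  moreover have "(\<Sum>j | l1norm (j - i) \<le> int r. pd i (S_loc r s j) (lift d U)) = (\<Sum>k\<in>lball r. pd k s (W k))"
  proof (rule sum.reindex_bij_witness[of _ "\<lambda>k. i - k" "\<lambda>j. i - j"])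
    fix j assume "j \<in> {j. l1norm (j - i) \<le> int r}"
    then have j: "i - j \<in> lball r" using l1norm_minus[of "j - i"] by (simp add: lball_def)
    then show "i - j \<in> lball r" .
    show "pd (i - j) s (W (i - j)) = pd i (S_loc r s j) (lift d U)"
      unfolding pd_S_loc[OF j] by (simp add: W_def p_def)
  next
    fix k :: "int ^ 'n" assume "k \<in> lball r"
    then show "i - k \<in> {j. l1norm (j - i) \<le> int r}" by (simp add: lball_def)
  qed auto
  ultimately show "(\<Sum>j | l1norm (j - i) \<le> int r. pd i (S_loc r s j) (lift d U)) = 0" by simp
qed

end

theorem theorem4p3:
  fixes d :: "'n::finite"
    and r k :: nat
    and s :: "'n configuration \<Rightarrow> real"
    and v0 w0 :: "'n configuration"
    and \<rho>1 \<rho>2 \<rho>3 \<rho>4 :: real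
  assumes "CARD('n) \<ge> 2" and "r \<ge> 1" and "k \<ge> 1"
    and "C2_coord (lball r) s" and "S1 r s" and "S2 r s" and "S3 r s"
    and "adjacent (M0 r s) v0 w0"
    and "\<exists>v1 w1. adjacent (M1 d r s v0 w0 v0 w0) v1 w1"
    and "\<exists>v1 w1. adjacent (M1 d r s v0 w0 w0 v0) v1 w1"
    and "\<rho>1 \<in> {0<..<dist0 d v0 w0}" and "\<rho>1 \<notin> dist0 d v0 ` M1 d r s v0 w0 v0 w0"
    and "\<rho>2 \<in> {0<..<dist0 d v0 w0}" and "\<rho>2 \<notin> dist0 d w0 ` M1 d r s v0 w0 v0 w0"
    and "\<rho>3 \<in> {0<..<dist0 d v0 w0}" and "\<rho>3 \<notin> dist0 d w0 ` M1 d r s v0 w0 w0 v0"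
    and "\<rho>4 \<in> {0<..<dist0 d v0 w0}" and "\<rho>4 \<notin> dist0 d v0 ` M1 d r s v0 w0 w0 v0"
  shows "\<exists>L. \<forall>l\<ge>L. \<exists>N::int. \<forall>m. admissible k l m \<longrightarrow>
           (\<exists>U\<in>Y d v0 w0 \<rho>1 \<rho>2 \<rho>3 \<rho>4 k m l.
              J1 d r s U = (INF u\<in>Y d v0 w0 \<rho>1 \<rho>2 \<rho>3 \<rho>4 k m l. J1 d r s u) \<and>
              ((\<forall>i\<in>{1..2 * k + 1}. m (2 * i) - m (2 * i - 1) \<ge> N) \<longrightarrow> is_solution r s U))"
proof -
  obtain a b where v0: "v0 = (\<lambda>_. a)" and w0: "w0 = (\<lambda>_. b)"
    using assms(8) by (auto simp: adjacent_def M0_def Per_const)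
  interpret lattice_model d r s a b
    by unfold_locales (use assms in \<open>auto simp: v0 w0\<close>)
  have M1ab: "M1 d r s (\<lambda>_. a) (\<lambda>_. b) (\<lambda>_. a) (\<lambda>_. b) = lift d ` Collect (minimizer (het a b))"
    and M1ba: "M1 d r s (\<lambda>_. a) (\<lambda>_. b) (\<lambda>_. b) (\<lambda>_. a) = lift d ` Collect (minimizer (het b a))"
    using M1_eq[of a b] M1_eq[of b a] by simp_all
  \<comment> \<open>The gap conditions provide minimizing heteroclinics in both directions, from
    which the replacement pieces are cut.\<close>
  obtain q0 q1 where q01: "minimizer (het a b) q0" "minimizer (het b a) q1"
    using assms(9,10) unfolding v0 w0 M1ab M1ba adjacent_def by blast
  define q where "q t = (if even t then q0 else q1)" for t :: nat
  \<comment> \<open>The window before an even transition is at \<open>v0\<close>, the one before an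
    odd transition at \<open>w0\<close>; for \<open>\<rho>'\<close> the wells are
    interchanged.\<close>
  define \<rho> where "\<rho> t = (if even t then \<rho>1 else \<rho>3)" for t :: nat
  define \<rho>' where "\<rho>' t = (if even t then \<rho>2 else \<rho>4)" for t :: nat
  have q: "minimizer (het (side t) (side (Suc t))) (q t)" for t
    using q01 by (simp add: q_def side_def)
  have D: "dist0 d v0 w0 = b - a"
    using dist0_lift_0[of d a "\<lambda>_. b"] ab by (simp add: v0 w0)
  have \<rho>: "0 < \<rho> t \<and> \<rho> t < b - a" "0 < \<rho>' t \<and> \<rho>' t < b - a" for t
    using assms(11,13,15,17) by (simp_all add: D \<rho>_def \<rho>'_def)
  have avoid: "\<bar>x 0 - side t\<bar> \<noteq> \<rho> t \<and> \<bar>x 0 - side (Suc t)\<bar> \<noteq> \<rho>' t"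
    if "minimizer (het (side t) (side (Suc t))) x" for t x
    using assms(12,14,16,18) that unfolding v0 w0 M1ab M1ba
    by (cases "even t") (auto simp: side_def \<rho>_def \<rho>'_def image_iff dist0_lift_0)
  have Y: "Y d v0 w0 \<rho>1 \<rho>2 \<rho>3 \<rho>4 k m l = lift d ` constrained k \<rho> \<rho>' m l" for m l
    unfolding v0 w0 by (rule Y_eq) (simp_all add: \<rho>_def \<rho>'_def)
  let ?good = "\<lambda>l N. \<forall>m. admissible k l m \<longrightarrow> (\<exists>U. minimizer (constrained k \<rho> \<rho>' m l) U \<and>
    ((\<forall>t\<le>2*k. N \<le> m (2*t+2) - m (2*t+1)) \<longrightarrow> (\<forall>(i, \<sigma>, c)\<in>constraints k \<rho> \<rho>' m l. \<bar>U i - \<sigma>\<bar> < c)))"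
  have "\<exists>L. \<forall>l\<ge>L. \<exists>N. ?good l N"
    by (rule constrained_minimizers[of q], rule q, rule \<rho>(1), rule \<rho>(2), erule avoid)
  then obtain L where L: "\<forall>l\<ge>L. \<exists>N. ?good l N" ..
  show ?thesis
  proof (intro exI[of _ L] allI impI)
    fix l assume "L \<le> l"
    with L have "\<exists>N. ?good l N"
      by simp
    then obtain N where N: "?good l N" ..
    show "\<exists>N::int. \<forall>m. admissible k l m \<longrightarrow> (\<exists>U\<in>Y d v0 w0 \<rho>1 \<rho>2 \<rho>3 \<rho>4 k m l.
        J1 d r s U = (INF u\<in>Y d v0 w0 \<rho>1 \<rho>2 \<rho>3 \<rho>4 k m l. J1 d r s u) \<and>
        ((\<forall>i\<in>{1..2 * k + 1}. m (2 * i) - m (2 * i - 1) \<ge> N) \<longrightarrow> is_solution r s U))"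
    proof (intro exI[of _ N] allI impI)
      fix m assume "admissible k l m"
      with N have "\<exists>U. minimizer (constrained k \<rho> \<rho>' m l) U \<and>
        ((\<forall>t\<le>2*k. N \<le> m (2*t+2) - m (2*t+1)) \<longrightarrow> (\<forall>(i, \<sigma>, c)\<in>constraints k \<rho> \<rho>' m l. \<bar>U i - \<sigma>\<bar> < c))"
        by simp
      then obtain U where U: "minimizer (constrained k \<rho> \<rho>' m l) U"
        "(\<forall>t\<le>2*k. N \<le> m (2*t+2) - m (2*t+1)) \<longrightarrow> (\<forall>(i, \<sigma>, c)\<in>constraints k \<rho> \<rho>' m l. \<bar>U i - \<sigma>\<bar> < c)"
        by (elim exE conjE)
      have J: "J1 d r s (lift d x) = enn2ereal (E UNIV x) + ereal (V (\<lambda>_. b) - V (\<lambda>_. a))"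
        if "x \<in> constrained k \<rho> \<rho>' m l" for x
        using that by (intro J1_lift) (auto simp: constrained_def)
      have UK: "U \<in> constrained k \<rho> \<rho>' m l" using U(1) by (simp add: minimizer_def)
      have "J1 d r s (lift d U) = (INF u\<in>lift d ` constrained k \<rho> \<rho>' m l. J1 d r s u)"
      proof (intro antisym INF_greatest INF_lower imageI UK)
        fix u assume "u \<in> lift d ` constrained k \<rho> \<rho>' m l"
        then show "J1 d r s (lift d U) \<le> J1 d r s u"
          using U(1) J by (auto simp: minimizer_def less_eq_ennreal.rep_eq intro!: add_right_mono)
      qed
      moreover have "is_solution r s (lift d U)"
        if far: "\<forall>i\<in>{1..2 * k + 1}. m (2 * i) - m (2 * i - 1) \<ge> N"
      proof -
        \<comment> \<open>Transitions are counted from \<open>0\<close> to \<open>2 * k\<close>, the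
          differences in the claim from \<open>1\<close> to \<open>2 * k + 1\<close>.\<close>
        have "N \<le> m (2*t+2) - m (2*t+1)" if "t \<le> 2 * k" for t
          using far[rule_format, of "t + 1"] that by simp
        then have "\<forall>(i, \<sigma>, c)\<in>constraints k \<rho> \<rho>' m l. \<bar>U i - \<sigma>\<bar> < c" using U(2) by simp
        then show ?thesis by (rule local_min_imp_solution[OF constrained_local_min[OF U(1)]])
      qed
      ultimately show "\<exists>U\<in>Y d v0 w0 \<rho>1 \<rho>2 \<rho>3 \<rho>4 k m l.
          J1 d r s U = (INF u\<in>Y d v0 w0 \<rho>1 \<rho>2 \<rho>3 \<rho>4 k m l. J1 d r s u) \<and>
          ((\<forall>i\<in>{1..2 * k + 1}. m (2 * i) - m (2 * i - 1) \<ge> N) \<longrightarrow> is_solution r s U)"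
        unfolding Y by (intro bexI[OF _ imageI[OF UK]] conjI impI)
    qed
  qed
qed

end
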